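(* Let $n\geqslant1$ and $\ell\geqslant0$. Let $(u,v)$ be the solution of $$\begin{cases} u_{tt}-\Delta u+v=0,& x\in\mathbb{R}^n,\ t>0,\\ v_t-\Delta v-u_t=0,& x\in\mathbb{R}^n,\ t>0,\\ (u,u_t,v)(0,x)=(u_0,u_1,v_0)(x),& x\in\mathbb{R}^n,\end{cases}$$ with $u_0,u_1\in H^{\ell-1}\cap L^1$ and $v_0=0$, and let $w$ be the solution of $$\begin{cases} w_{tt}-\Delta w+(-\Delta)^{-1}w_t=0,& x\in\mathbb{R}^n,\ t>0,\\ w(0,x)=w_0(x),\ w_t(0,x)=w_1(x),& x\in\mathbb{R}^n,\end{cases}$$ with $w_0=u_0$ and $w_1\in H^{\ell-1}\cap L^1$. Then $$\|u(t,\cdot)-w(t,\cdot)\|_{L^2}\lesssim(1+t)^{-\min\left\{\frac n8+\frac12,\frac n4\right\}}\|(u_0,u_1,w_1)\|_{L^1\times L^1\times L^1}+(1+t)^{-\frac\ell2}\|(u_0,u_1,w_1)\|_{H^{\ell-1}\times H^{\ell-1}\times H^{\ell-1}}.$$ Particularly, when $\ell>\frac n4$, $$\lim_{t\to+\infty}t^{\frac n8}\|u(t,\cdot)-w(t,\cdot)\|_{L^2}=0.$$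
   Context: $f\lesssim g$ means $f\leqslant Cg$ for some constant $C>0$, independent of $t$ and of the Cauchy data. $H^s$ is the $L^2$-based Bessel potential space for any $s\in\mathbb R$. $(-\Delta)^{-1}$ is the Riesz potential operator, i.e. the Fourier multiplier with symbol $|\xi|^{-2}$. Solutions are understood via the partial Fourier transform in $x$. *)

theory Defs
  imports "HOL-Analysis.Analysis"
begin

text \<open>Functions on \<open>R^n\<close> are maps from an arbitrary Euclidean space \<open>'a\<close>
  with \<open>n = DIM('a)\<close>.  All functions are complex valued, which includes the real valued case.\<close>

subsection \<open>Lebesgue spaces, Fourier transform, Bessel potential spaces\<close>

definition L1_space :: "('a::euclidean_space \<Rightarrow> complex) set" where
  "L1_space = {f. integrable lebesgue f}"

definition norm_L1 :: "('a::euclidean_space \<Rightarrow> complex) \<Rightarrow> real" where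
  "norm_L1 f = (LINT x|lebesgue. norm (f x))"

definition L2_space :: "('a::euclidean_space \<Rightarrow> complex) set" where
  "L2_space = {f. f \<in> borel_measurable lebesgue \<and> integrable lebesgue (\<lambda>x. (norm (f x))\<^sup>2)}"

definition norm_L2 :: "('a::euclidean_space \<Rightarrow> complex) \<Rightarrow> real" where
  "norm_L2 f = sqrt (LINT x|lebesgue. (norm (f x))\<^sup>2)"

text \<open>Unitary normalisation, with no \<open>2\<pi>\<close> in the exponent, so that the symbol of
  \<open>-\<Delta>\<close> is \<open>|\<xi>|^2\<close>.\<close>

definition fourier :: "('a::euclidean_space \<Rightarrow> complex) \<Rightarrow> 'a \<Rightarrow> complex" where
  "fourier f \<xi> = of_real ((2 * pi) powr (- real DIM('a) / 2)) *
     (LINT x|lebesgue. cis (- (x \<bullet> \<xi>)) * f x)"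

text \<open>\<open>bessel_weight s f\<close> is \<open>(1 + |\<xi>|^2)^(s/2)\<close> times the Fourier transform of \<open>f\<close>.  For
  integrable \<open>f\<close> the Fourier transform in the sense of tempered distributions is the function
  \<open>fourier f\<close>, so \<open>L1_Sobolev s\<close> is the intersection of \<open>L^1\<close> with \<open>H^s\<close>, for every real \<open>s\<close>
  (also negative \<open>s\<close>), and \<open>norm_Sobolev s\<close> is the norm of \<open>H^s\<close> on it.\<close>

definition bessel_weight :: "real \<Rightarrow> ('a::euclidean_space \<Rightarrow> complex) \<Rightarrow> 'a \<Rightarrow> complex" where
  "bessel_weight s f \<xi> = of_real ((1 + (norm \<xi>)\<^sup>2) powr (s / 2)) * fourier f \<xi>"

definition L1_Sobolev :: "real \<Rightarrow> ('a::euclidean_space \<Rightarrow> complex) set" where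
  "L1_Sobolev s = {f \<in> L1_space. bessel_weight s f \<in> L2_space}"

definition norm_Sobolev :: "real \<Rightarrow> ('a::euclidean_space \<Rightarrow> complex) \<Rightarrow> real" where
  "norm_Sobolev s f = norm_L2 (bessel_weight s f)"

subsection \<open>Tempered distributions\<close>

text \<open>For \<open>l < 1\<close> the data lie in a Sobolev space of negative order and \<open>u(t)\<close>, \<open>v(t)\<close>, \<open>w(t)\<close>
  need not be functions.  They are therefore tempered distributions: functionals on the Schwartz
  space, whose values outside that space are irrelevant.\<close>

fun iter_deriv :: "'a::euclidean_space list \<Rightarrow> ('a \<Rightarrow> complex) \<Rightarrow> 'a \<Rightarrow> complex" where
  "iter_deriv [] f = f"
| "iter_deriv (b # bs) f = (\<lambda>x. frechet_derivative (iter_deriv bs f) (at x) b)"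

definition schwartz_space :: "('a::euclidean_space \<Rightarrow> complex) set" where
  "schwartz_space = {\<phi>. \<forall>bs \<in> lists Basis.
     (\<forall>x. iter_deriv bs \<phi> differentiable (at x)) \<and>
     (\<forall>k::nat. bounded (range (\<lambda>x. norm x ^ k * norm (iter_deriv bs \<phi> x))))}"

definition schwartz_seminorm :: "nat \<Rightarrow> 'a::euclidean_space list \<Rightarrow> ('a \<Rightarrow> complex) \<Rightarrow> real" where
  "schwartz_seminorm k bs \<phi> = (SUP x. norm x ^ k * norm (iter_deriv bs \<phi> x))"

type_synonym 'a distr = "('a \<Rightarrow> complex) \<Rightarrow> complex"

definition tempered :: "'a::euclidean_space distr \<Rightarrow> bool" where
  "tempered T \<longleftrightarrow>
     (\<forall>\<phi>\<in>schwartz_space. \<forall>\<psi>\<in>schwartz_space. T (\<lambda>x. \<phi> x + \<psi> x) = T \<phi> + T \<psi>) \<and>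
     (\<forall>\<phi>\<in>schwartz_space. \<forall>c. T (\<lambda>x. c * \<phi> x) = c * T \<phi>) \<and>
     (\<exists>C m. \<forall>\<phi>\<in>schwartz_space. norm (T \<phi>) \<le>
        C * (\<Sum>k\<le>m. \<Sum>bs\<in>{bs \<in> lists Basis. length bs \<le> m}. schwartz_seminorm k bs \<phi>))"

text \<open>\<open>T\<close> is the regular distribution given by the function \<open>f\<close>.\<close>

definition represents :: "('a::euclidean_space \<Rightarrow> complex) \<Rightarrow> 'a distr \<Rightarrow> bool" where
  "represents f T \<longleftrightarrow> f \<in> borel_measurable lebesgue \<and>
     (\<forall>\<phi>\<in>schwartz_space. integrable lebesgue (\<lambda>x. f x * \<phi> x) \<and>
        T \<phi> = (LINT x|lebesgue. f x * \<phi> x))"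

definition fourier_distr :: "'a::euclidean_space distr \<Rightarrow> 'a distr" where
  "fourier_distr T = (\<lambda>\<phi>. T (fourier \<phi>))"

text \<open>Representing functions are unique almost everywhere, so the infimum below runs over at
  most one value; it is \<open>\<infinity>\<close> if \<open>T\<close> is not given by a square integrable function.\<close>

definition norm_L2_distr :: "'a::euclidean_space distr \<Rightarrow> ennreal" where
  "norm_L2_distr T = (INF f \<in> {f \<in> L2_space. represents f T}. ennreal (norm_L2 f))"

subsection \<open>The two Cauchy problems\<close>

text \<open>\<open>u_tt - \<Delta> u + v = 0\<close>, \<open>v_t - \<Delta> v - u_t = 0\<close> with data \<open>(u, u_t, v)(0) = (u0, u1, v0)\<close>,
  solved through the partial Fourier transform: \<open>U t\<close> and \<open>V t\<close> are the Fourier transforms of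
  \<open>u t\<close> and \<open>v t\<close>, and for almost every frequency they solve the resulting system of ordinary
  differential equations in \<open>t\<close>.\<close>

definition wave_heat_solution ::
  "('a::euclidean_space \<Rightarrow> complex) \<Rightarrow> ('a \<Rightarrow> complex) \<Rightarrow> ('a \<Rightarrow> complex) \<Rightarrow>
   (real \<Rightarrow> 'a distr) \<Rightarrow> (real \<Rightarrow> 'a distr) \<Rightarrow> bool" where
  "wave_heat_solution u0 u1 v0 u v \<longleftrightarrow>
     (\<forall>t\<ge>0. tempered (u t) \<and> tempered (v t)) \<and>
     (\<exists>U V.
        (\<forall>t\<ge>0. represents (U t) (fourier_distr (u t)) \<and> represents (V t) (fourier_distr (v t))) \<and>
        (AE \<xi> in lebesgue. \<exists>U' U'' V'.
           (\<forall>t\<ge>0. ((\<lambda>s. U s \<xi>) has_vector_derivative U' t) (at t within {0..})) \<and>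
           continuous_on {0..} U' \<and>
           continuous_on {0..} (\<lambda>t. V t \<xi>) \<and>
           (\<forall>t>0. (U' has_vector_derivative U'' t) (at t) \<and>
                   ((\<lambda>s. V s \<xi>) has_vector_derivative V' t) (at t) \<and>
                   U'' t + (norm \<xi>)\<^sup>2 *\<^sub>R U t \<xi> + V t \<xi> = 0 \<and>
                   V' t + (norm \<xi>)\<^sup>2 *\<^sub>R V t \<xi> - U' t = 0) \<and>
           U 0 \<xi> = fourier u0 \<xi> \<and> U' 0 = fourier u1 \<xi> \<and> V 0 \<xi> = fourier v0 \<xi>))"

text \<open>\<open>w_tt - \<Delta> w + (-\<Delta>)^(-1) w_t = 0\<close> with data \<open>(w, w_t)(0) = (w0, w1)\<close>, in the same sense;
  \<open>(-\<Delta>)^(-1)\<close> is the Fourier multiplier \<open>|\<xi>|^(-2)\<close>.\<close>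

definition riesz_damped_wave_solution ::
  "('a::euclidean_space \<Rightarrow> complex) \<Rightarrow> ('a \<Rightarrow> complex) \<Rightarrow> (real \<Rightarrow> 'a distr) \<Rightarrow> bool" where
  "riesz_damped_wave_solution w0 w1 w \<longleftrightarrow>
     (\<forall>t\<ge>0. tempered (w t)) \<and>
     (\<exists>W.
        (\<forall>t\<ge>0. represents (W t) (fourier_distr (w t))) \<and>
        (AE \<xi> in lebesgue. \<exists>W' W''.
           (\<forall>t\<ge>0. ((\<lambda>s. W s \<xi>) has_vector_derivative W' t) (at t within {0..})) \<and>
           continuous_on {0..} W' \<and>
           (\<forall>t>0. (W' has_vector_derivative W'' t) (at t) \<and>
                   W'' t + (norm \<xi>)\<^sup>2 *\<^sub>R W t \<xi> + inverse ((norm \<xi>)\<^sup>2) *\<^sub>R W' t = 0) \<and>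
           W 0 \<xi> = fourier w0 \<xi> \<and> W' 0 = fourier w1 \<xi>))"

end

theory Submission
  imports Defs "HOL-Probability.Probability"
begin

text \<open>
  The estimate is proved frequency by frequency and then integrated.  Write \<open>U\<close>, \<open>V\<close>, \<open>W\<close> for
  the Fourier transforms of \<open>u\<close>, \<open>v\<close>, \<open>w\<close> and put \<open>\<rho> = |\<xi>|^2\<close>.  Eliminating
  \<open>v\<close> turns the first system into a third order equation for \<open>U\<close> with characteristic polynomial
  \<open>(x + \<rho>)(x^2 + \<rho>) + x\<close>.  It has a root \<open>- s\<close> with \<open>0 < s < \<rho>\<close>, and dividing this root out leaves a
  damped oscillator \<open>x^2 + p x + q\<close>.  Instead of solving for the other two roots, the proof obtains the
  exponential decay of damped oscillators, with or without a forcing term, from quadratic Lyapunov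
  functionals (\<open>underdamped_decay\<close>, \<open>overdamped_decay\<close>), whose constants do not depend on \<open>\<rho>\<close>.

  At low frequencies \<open>s\<close> is comparable with \<open>\<rho>^2\<close>, the oscillator has damping \<open>p\<close> of size \<open>\<rho>\<close>, and the
  mode \<open>exp (- s t)\<close> enters \<open>U\<close> with amplitude \<open>U(0)\<close> up to an error of size \<open>\<rho>\<close>.  The overdamped
  equation for \<open>W\<close>, with coefficients \<open>1/\<rho>\<close> and \<open>\<rho>\<close>, has a slow mode of nearly the same rate.  Both
  solutions are therefore close to \<open>exp (- s t) U(0)\<close>, and \<open>|U - W|\<close> is at most a constant times
  \<open>exp (- c \<rho> t) + \<rho> exp (- c \<rho>^2 t)\<close> (\<open>low_frequency_difference\<close>).  With integrable data the two
  terms have \<open>L^2\<close> norms of size \<open>t^(-n/4)\<close> and \<open>t^(-n/8 - 1/2)\<close>.  The profile \<open>exp (- s t) U(0)\<close>,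
  whose size is only \<open>t^(-n/8)\<close>, has cancelled.

  At high frequencies \<open>s\<close> is comparable with \<open>\<rho>\<close>, while \<open>p\<close> and \<open>q\<close> agree with the coefficients \<open>1/\<rho>\<close>
  and \<open>\<rho>\<close> of the equation for \<open>W\<close> up to \<open>O(1/\<rho>^2)\<close> and \<open>O(1/\<rho>)\<close>.  So \<open>U - W\<close> solves the equation
  for \<open>W\<close> with a small forcing and gains a factor \<open>1/|\<xi>|\<close> over \<open>U\<close> and \<open>W\<close> themselves:
  \<open>|U - W|\<close> is at most a constant times \<open>|\<xi>|^(-1) exp (- c t / \<rho>)\<close>
  (\<open>high_frequency_difference\<close>).  The decay degenerates as \<open>\<rho>\<close> grows and has to be paid for by
  regularity: \<open>exp (- c t / \<rho>)\<close> is at most a constant times \<open>(\<rho> / (1 + t))^(l/2)\<close>, which explains the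
  rate \<open>(1 + t)^(-l/2)\<close> and the Sobolev order \<open>l - 1\<close>.

  The solutions are only known as distributions, so the \<open>L^2\<close> bound on the Fourier side has to be
  carried back.  That is \<open>norm_L2_distr_le_fourier\<close>: if the Fourier transform of \<open>T\<close> is given by a
  square integrable \<open>D\<close>, then \<open>T\<close> itself is given by a square integrable function of no larger norm.
  It rests on the Fourier transform mapping the Schwartz space onto itself (\<open>FT_schwartz\<close>,
  \<open>FT_inversion\<close>) and on one half of Plancherel's theorem (\<open>FT_L2_bound\<close>).\<close>

section \<open>The Schwartz space\<close>

abbreviation partial_deriv :: "'a::euclidean_space \<Rightarrow> ('a \<Rightarrow> complex) \<Rightarrow> 'a \<Rightarrow> complex" where
  "partial_deriv b f \<equiv> (\<lambda>x. frechet_derivative f (at x) b)"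

definition rapidly_decreasing :: "('a::euclidean_space \<Rightarrow> complex) \<Rightarrow> bool" where
  "rapidly_decreasing f \<longleftrightarrow> (\<forall>k::nat. \<exists>C. \<forall>x. norm x ^ k * norm (f x) \<le> C)"

lemma rapidly_decreasing_iff:
  "rapidly_decreasing f \<longleftrightarrow> (\<forall>k::nat. bounded (range (\<lambda>x. norm x ^ k * norm (f x))))"
  unfolding rapidly_decreasing_def bounded_iff by simp

text \<open>The derivatives in \<open>iter_deriv\<close> are added on the outside, so any family of rapidly decreasing
  differentiable functions that is closed under partial derivatives lies in the Schwartz space.
  With a suitable family, each closure property below is checked on first derivatives.\<close>

lemma schwartz_coinduct:
  assumes f: "f \<in> \<F>"
    and diff: "\<And>g x. g \<in> \<F> \<Longrightarrow> g differentiable (at x)"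
    and rapid: "\<And>g. g \<in> \<F> \<Longrightarrow> rapidly_decreasing g"
    and deriv: "\<And>g b. g \<in> \<F> \<Longrightarrow> b \<in> Basis \<Longrightarrow> partial_deriv b g \<in> \<F>"
  shows "f \<in> schwartz_space"
proof -
  have "iter_deriv bs f \<in> \<F>" if "bs \<in> lists Basis" for bs
    using that by (induction bs) (auto intro: f deriv)
  then show ?thesis
    using diff rapid by (auto simp: schwartz_space_def rapidly_decreasing_iff)
qed

lemma schwartz_differentiable: "f \<in> schwartz_space \<Longrightarrow> f differentiable (at x)"
  and schwartz_rapidly_decreasing: "f \<in> schwartz_space \<Longrightarrow> rapidly_decreasing f"
  unfolding schwartz_space_def rapidly_decreasing_iff
  by (force dest: bspec[of _ _ "[]"])+

lemma iter_deriv_snoc: "iter_deriv bs (partial_deriv b f) = iter_deriv (bs @ [b]) f"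
  by (induction bs) auto

lemma schwartz_partial_deriv:
  "f \<in> schwartz_space \<Longrightarrow> b \<in> Basis \<Longrightarrow> partial_deriv b f \<in> schwartz_space"
  unfolding schwartz_space_def by (auto simp: iter_deriv_snoc)

lemma partial_deriv_eqI: "(f has_derivative f') (at x) \<Longrightarrow> frechet_derivative f (at x) b = f' b"
  using frechet_derivative_at by metis

lemma schwartz_has_derivative:
  "f \<in> schwartz_space \<Longrightarrow> (f has_derivative frechet_derivative f (at x)) (at x)"
  using schwartz_differentiable frechet_derivative_works by blast

lemma rapidly_decreasing_add:
  assumes "rapidly_decreasing f" "rapidly_decreasing g"
  shows "rapidly_decreasing (\<lambda>x. f x + g x)"
  unfolding rapidly_decreasing_def
proof
  fix k
  obtain C D where "\<And>x. norm x ^ k * norm (f x) \<le> C" "\<And>x. norm x ^ k * norm (g x) \<le> D"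
    using assms unfolding rapidly_decreasing_def by meson
  then have "norm x ^ k * norm (f x + g x) \<le> C + D" for x
    by (smt (verit) mult_left_mono norm_triangle_ineq distrib_left norm_ge_zero zero_le_power)
  then show "\<exists>C. \<forall>x. norm x ^ k * norm (f x + g x) \<le> C" by blast
qed

lemma rapidly_decreasing_cmult:
  assumes "rapidly_decreasing f" shows "rapidly_decreasing (\<lambda>x. c * f x)"
  unfolding rapidly_decreasing_def
proof
  fix k
  obtain C where "\<And>x. norm x ^ k * norm (f x) \<le> C"
    using assms unfolding rapidly_decreasing_def by meson
  then have "norm c * (norm x ^ k * norm (f x)) \<le> norm c * C" for x
    by (intro mult_left_mono) auto
  then show "\<exists>C. \<forall>x. norm x ^ k * norm (c * f x) \<le> C"
    by (auto simp: norm_mult mult_ac)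
qed

lemma rapidly_decreasing_coordinate:
  assumes "rapidly_decreasing f" and b: "b \<in> Basis"
  shows "rapidly_decreasing (\<lambda>x. of_real (x \<bullet> b) * f x)"
  unfolding rapidly_decreasing_def
proof
  fix k
  obtain C where C: "\<And>x. norm x ^ Suc k * norm (f x) \<le> C"
    using assms unfolding rapidly_decreasing_def by meson
  have "norm x ^ k * norm (of_real (x \<bullet> b) * f x) \<le> C" for x
  proof -
    have "norm x ^ k * (\<bar>x \<bullet> b\<bar> * norm (f x)) \<le> norm x ^ k * (norm x * norm (f x))"
      using Basis_le_norm[OF b] by (intro mult_left_mono mult_right_mono) auto
    with C[of x] show ?thesis by (simp add: norm_mult mult_ac)
  qed
  then show "\<exists>C. \<forall>x. norm x ^ k * norm (of_real (x \<bullet> b) * f x) \<le> C" by blast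
qed

lemma schwartz_add:
  fixes f :: "'a::euclidean_space \<Rightarrow> complex"
  assumes "f \<in> schwartz_space" "g \<in> schwartz_space"
  shows "(\<lambda>x. f x + g x) \<in> schwartz_space"
proof (rule schwartz_coinduct)
  let ?F = "{\<lambda>x. f x + g x | f g. f \<in> schwartz_space \<and> g \<in> schwartz_space} :: ('a \<Rightarrow> complex) set"
  show "(\<lambda>x. f x + g x) \<in> ?F" using assms by blast
  fix h assume "h \<in> ?F"
  then obtain f g where h: "h = (\<lambda>x. f x + g x)" and fg: "f \<in> schwartz_space" "g \<in> schwartz_space" by blast
  have D: "(h has_derivative (\<lambda>v. frechet_derivative f (at x) v + frechet_derivative g (at x) v)) (at x)" for x
    unfolding h using fg by (intro has_derivative_add schwartz_has_derivative)
  then show "h differentiable (at x)" for x by (auto simp: differentiable_def)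
  show "rapidly_decreasing h"
    unfolding h using fg by (intro rapidly_decreasing_add schwartz_rapidly_decreasing)
  fix b :: 'a assume "b \<in> Basis"
  then have "partial_deriv b f \<in> schwartz_space" "partial_deriv b g \<in> schwartz_space"
    using fg by (auto intro: schwartz_partial_deriv)
  moreover have "partial_deriv b h = (\<lambda>x. partial_deriv b f x + partial_deriv b g x)"
    using partial_deriv_eqI[OF D] by auto
  ultimately show "partial_deriv b h \<in> ?F" unfolding mem_Collect_eq
    by (intro exI[of _ "partial_deriv b f"] exI[of _ "partial_deriv b g"] conjI)
qed

lemma schwartz_cmult:
  fixes f :: "'a::euclidean_space \<Rightarrow> complex"
  assumes "f \<in> schwartz_space" shows "(\<lambda>x. c * f x) \<in> schwartz_space"
proof (rule schwartz_coinduct)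
  let ?F = "{\<lambda>x. c * f x | f. f \<in> schwartz_space} :: ('a \<Rightarrow> complex) set"
  show "(\<lambda>x. c * f x) \<in> ?F" using assms by blast
  fix h assume "h \<in> ?F"
  then obtain f where h: "h = (\<lambda>x. c * f x)" and f: "f \<in> schwartz_space" by blast
  have D: "(h has_derivative (\<lambda>v. c * frechet_derivative f (at x) v)) (at x)" for x
    unfolding h using f by (intro has_derivative_mult_right schwartz_has_derivative)
  then show "h differentiable (at x)" for x by (auto simp: differentiable_def)
  show "rapidly_decreasing h"
    unfolding h using f by (intro rapidly_decreasing_cmult schwartz_rapidly_decreasing)
  fix b :: 'a assume "b \<in> Basis"
  then have "partial_deriv b f \<in> schwartz_space" using f by (rule schwartz_partial_deriv[rotated])
  moreover have "partial_deriv b h = (\<lambda>x. c * partial_deriv b f x)"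
    using partial_deriv_eqI[OF D] by auto
  ultimately show "partial_deriv b h \<in> ?F" unfolding mem_Collect_eq
    by (intro exI[of _ "partial_deriv b f"] conjI)
qed

lemma schwartz_coordinate:
  fixes f :: "'a::euclidean_space \<Rightarrow> complex"
  assumes f: "f \<in> schwartz_space" and c: "c \<in> Basis"
  shows "(\<lambda>x. of_real (x \<bullet> c) * f x) \<in> schwartz_space"
proof (rule schwartz_coinduct)
  \<comment> \<open>By the product rule a family of products alone is not closed under differentiation;
    adding an arbitrary Schwartz function makes it so.\<close>
  let ?F = "{\<lambda>x. of_real (x \<bullet> c) * f x + g x | f g. f \<in> schwartz_space \<and> g \<in> schwartz_space} :: ('a \<Rightarrow> complex) set"
  have "(\<lambda>x::'a. 0) \<in> schwartz_space" using schwartz_cmult[OF f, of 0] by simp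
  then show "(\<lambda>x. of_real (x \<bullet> c) * f x) \<in> ?F" using f by force
  fix h assume "h \<in> ?F"
  then obtain f g where h: "h = (\<lambda>x. of_real (x \<bullet> c) * f x + g x)"
    and fg: "f \<in> schwartz_space" "g \<in> schwartz_space" by blast
  have D: "(h has_derivative (\<lambda>v. of_real (x \<bullet> c) * frechet_derivative f (at x) v +
      (of_real (v \<bullet> c) * f x + frechet_derivative g (at x) v))) (at x)" for x
  proof -
    have "((\<lambda>x. complex_of_real (x \<bullet> c)) has_derivative (\<lambda>v. of_real (v \<bullet> c))) (at x)"
      by (intro bounded_linear_imp_has_derivative
          bounded_linear_compose[OF bounded_linear_of_real bounded_linear_inner_left])
    from has_derivative_add[OF has_derivative_mult[OF this schwartz_has_derivative[OF fg(1)]]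
        schwartz_has_derivative[OF fg(2)]]
    show ?thesis unfolding h by (simp add: add.assoc)
  qed
  then show "h differentiable (at x)" for x by (auto simp: differentiable_def)
  show "rapidly_decreasing h"
    unfolding h using fg c
    by (intro rapidly_decreasing_add rapidly_decreasing_coordinate schwartz_rapidly_decreasing)
  fix b :: 'a assume b: "b \<in> Basis"
  have "(\<lambda>x. of_real (b \<bullet> c) * f x + partial_deriv b g x) \<in> schwartz_space"
    using fg b by (intro schwartz_add schwartz_cmult schwartz_partial_deriv)
  moreover have "partial_deriv b h =
      (\<lambda>x. of_real (x \<bullet> c) * partial_deriv b f x + (of_real (b \<bullet> c) * f x + partial_deriv b g x))"
    using partial_deriv_eqI[OF D] by auto
  ultimately show "partial_deriv b h \<in> ?F"
    using schwartz_partial_deriv[OF fg(1) b] unfolding mem_Collect_eq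
    by (intro exI[of _ "partial_deriv b f"]
        exI[of _ "\<lambda>x. of_real (b \<bullet> c) * f x + partial_deriv b g x"] conjI)
qed

lemma rapidly_decreasing_bound:
  fixes f :: "'a::euclidean_space \<Rightarrow> complex"
  assumes "rapidly_decreasing f"
  obtains C where "C \<ge> 0" "\<And>x. norm (f x) \<le> C * inverse ((1 + norm x) ^ N)"
proof -
  obtain C D where C: "\<And>x. norm x ^ 0 * norm (f x) \<le> C" and D: "\<And>x. norm x ^ N * norm (f x) \<le> D"
    using assms unfolding rapidly_decreasing_def by meson
  have "norm (f x) \<le> (2 ^ N * (C + D)) * inverse ((1 + norm x) ^ N)" for x
  proof -
    have "(1 + norm x) ^ N \<le> 2 ^ N * (1 + norm x ^ N)"
    proof (cases "norm x \<le> 1")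
      case True
      then have "(1 + norm x) ^ N \<le> 2 ^ N * 1" by (simp add: power_mono)
      then show ?thesis by (simp add: distrib_left add_increasing2)
    next
      case False
      then have "(1 + norm x) ^ N \<le> (2 * norm x) ^ N" by (intro power_mono) auto
      then show ?thesis by (simp add: power_mult_distrib distrib_left add_increasing)
    qed
    then have "(1 + norm x) ^ N * norm (f x) \<le> 2 ^ N * (1 + norm x ^ N) * norm (f x)"
      by (rule mult_right_mono) simp
    also have "\<dots> = 2 ^ N * (norm x ^ 0 * norm (f x) + norm x ^ N * norm (f x))"
      by (simp add: algebra_simps)
    also have "\<dots> \<le> 2 ^ N * (C + D)"
      using C[of x] D[of x] by (intro mult_left_mono add_mono) auto
    finally have "(1 + norm x) ^ N * norm (f x) \<le> 2 ^ N * (C + D)" .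
    moreover have "(1 + norm x) ^ N > 0" by (simp add: add_pos_nonneg)
    ultimately show ?thesis by (simp add: field_simps)
  qed
  moreover have "0 \<le> 2 ^ N * (C + D)"
    using order_trans[OF _ C[of 0]] order_trans[OF _ D[of 0]] by simp
  ultimately show ?thesis using that by blast
qed

lemma integrable_coordinate_product:
  fixes f :: "'a::euclidean_space \<Rightarrow> real \<Rightarrow> 'b::{real_normed_field,banach,second_countable_topology}"
  assumes "\<And>b. b \<in> Basis \<Longrightarrow> integrable lborel (f b)"
  shows "integrable lborel (\<lambda>x. \<Prod>b\<in>Basis. f b (x \<bullet> b))"
    and "(LINT x|lborel. (\<Prod>b\<in>Basis. f b (x \<bullet> b))) = (\<Prod>b\<in>Basis. LINT x|lborel. f b x)"
proof -
  interpret product_sigma_finite "\<lambda>_::'a. lborel :: real measure" by standard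
  have m: "(\<lambda>x. \<Prod>b\<in>Basis. f b (x \<bullet> b)) \<in> borel_measurable borel"
  proof (rule borel_measurable_prod)
    fix b :: 'a assume "b \<in> Basis"
    then have [measurable]: "f b \<in> borel_measurable borel"
      using borel_measurable_integrable[OF assms] by simp
    show "(\<lambda>x. f b (x \<bullet> b)) \<in> borel_measurable borel" by measurable
  qed
  have e: "(\<Prod>b\<in>Basis. f b ((\<Sum>c\<in>Basis. x c *\<^sub>R c) \<bullet> b)) = (\<Prod>b\<in>Basis. f b (x b))" for x
    by (intro prod.cong) auto
  have S: "(\<lambda>x. \<Sum>c\<in>Basis. x c *\<^sub>R c) \<in> (\<Pi>\<^sub>M b\<in>Basis. (lborel :: real measure)) \<rightarrow>\<^sub>M (borel :: 'a measure)"
    by measurable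
  show "integrable lborel (\<lambda>x. \<Prod>b\<in>Basis. f b (x \<bullet> b))"
    unfolding lborel_eq[where 'a='a] integrable_distr_eq[OF S m] e
    by (rule product_integrable_prod[OF finite_Basis assms])
  show "(LINT x|lborel. (\<Prod>b\<in>Basis. f b (x \<bullet> b))) = (\<Prod>b\<in>Basis. LINT x|lborel. f b x)"
    unfolding lborel_eq[where 'a='a] integral_distr[OF S m] e
    by (rule product_integral_prod[OF finite_Basis assms])
qed

text \<open>The product over the coordinates of the one-dimensional integrable functions
  \<open>1 / (1 + x_b^2)\<close> dominates a power of \<open>1 / (1 + |x|)\<close>.\<close>

lemma integrable_inverse_power_norm:
  "integrable lborel (\<lambda>x::'a::euclidean_space. inverse ((1 + norm x) ^ (2 * DIM('a))))"
proof (rule Bochner_Integration.integrable_bound)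
  have "integrable lborel (\<lambda>x::real. inverse (1 + x\<^sup>2))"
    using integrable_inverse_1_plus_square by (simp add: set_integrable_def)
  then show "integrable lborel (\<lambda>x::'a. \<Prod>b\<in>Basis. inverse (1 + (x \<bullet> b)\<^sup>2))"
    by (intro integrable_coordinate_product)
  show "AE x::'a in lborel. norm (inverse ((1 + norm x) ^ (2 * DIM('a)))) \<le> norm (\<Prod>b\<in>Basis. inverse (1 + (x \<bullet> b)\<^sup>2))"
  proof (rule AE_I2)
    fix x :: 'a
    have "(\<Prod>b\<in>(Basis::'a set). inverse ((1 + norm x)\<^sup>2)) \<le> (\<Prod>b\<in>(Basis::'a set). inverse (1 + (x \<bullet> b)\<^sup>2))"
    proof (rule prod_mono, intro conjI le_imp_inverse_le)
      fix b :: 'a assume "b \<in> Basis"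
      then have "\<bar>x \<bullet> b\<bar>\<^sup>2 \<le> norm x ^ 2" by (intro power_mono) (auto simp: Basis_le_norm)
      then have "(x \<bullet> b)\<^sup>2 \<le> (norm x)\<^sup>2" by simp
      also have "(norm x)\<^sup>2 \<le> (norm x)\<^sup>2 + 2 * norm x" by simp
      finally show "1 + (x \<bullet> b)\<^sup>2 \<le> (1 + norm x)\<^sup>2" by (simp add: power2_sum)
    qed (auto simp: add_pos_nonneg)
    then show "norm (inverse ((1 + norm x) ^ (2 * DIM('a)))) \<le> norm (\<Prod>b\<in>Basis. inverse (1 + (x \<bullet> b)\<^sup>2))"
      by (simp add: power_inverse power_mult abs_prod)
  qed
qed simp

lemma rapidly_decreasing_integrable:
  fixes f :: "'a::euclidean_space \<Rightarrow> complex"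
  assumes "rapidly_decreasing f" "f \<in> borel_measurable borel"
  shows "integrable lborel f"
proof -
  obtain C where C: "\<And>x. norm (f x) \<le> C * inverse ((1 + norm x) ^ (2 * DIM('a)))"
    using rapidly_decreasing_bound[OF assms(1)] by metis
  show ?thesis
  proof (rule Bochner_Integration.integrable_bound)
    show "integrable lborel (\<lambda>x::'a. C * inverse ((1 + norm x) ^ (2 * DIM('a))))"
      by (intro integrable_mult_right integrable_inverse_power_norm)
    show "AE x in lborel. norm (f x) \<le> norm (C * inverse ((1 + norm x) ^ (2 * DIM('a))))"
      using C by (intro AE_I2) (metis abs_ge_self order_trans real_norm_def)
  qed (use assms(2) in simp)
qed

lemma schwartz_continuous: "f \<in> schwartz_space \<Longrightarrow> continuous_on UNIV f"
  by (meson schwartz_differentiable continuous_at_imp_continuous_on differentiable_imp_continuous_within)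

lemma schwartz_measurable: "f \<in> schwartz_space \<Longrightarrow> f \<in> borel_measurable borel"
  by (intro borel_measurable_continuous_onI schwartz_continuous)

lemma schwartz_integrable: "f \<in> schwartz_space \<Longrightarrow> integrable lborel f"
  by (intro rapidly_decreasing_integrable schwartz_rapidly_decreasing schwartz_measurable)

section \<open>The Fourier transform on the Schwartz space\<close>

text \<open>The unnormalised Fourier integral, over Borel-Lebesgue measure because its products are again of that
  kind, as Fubini's theorem demands.  The values \<open>- 1\<close> and \<open>1\<close> of \<open>\<sigma>\<close> give the transform and its inverse, up to a
  constant factor.\<close>

definition FT :: "real \<Rightarrow> ('a::euclidean_space \<Rightarrow> complex) \<Rightarrow> 'a \<Rightarrow> complex" where
  "FT \<sigma> f \<xi> = (LINT x|lborel. cis (\<sigma> * (x \<bullet> \<xi>)) * f x)"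

lemma measurable_cis_inner [measurable]:
  "(\<lambda>x::'a::euclidean_space. cis (\<sigma> * (x \<bullet> \<xi>))) \<in> borel_measurable borel"
  by (intro borel_measurable_continuous_onI continuous_intros)

lemma integrable_cis_mult:
  fixes f :: "'a::euclidean_space \<Rightarrow> complex"
  assumes "integrable lborel f" shows "integrable lborel (\<lambda>x. cis (\<sigma> * (x \<bullet> \<xi>)) * f x)"
  by (rule Bochner_Integration.integrable_bound[OF assms])
     (use assms in \<open>auto simp: norm_mult\<close>)

lemma FT_norm_le: "norm (FT \<sigma> f \<xi>) \<le> (LINT x|lborel. norm (f x))"
  unfolding FT_def by (rule order_trans[OF integral_norm_bound]) (simp add: norm_mult)

lemma has_derivative_quadratic:
  fixes f :: "'a::real_normed_vector \<Rightarrow> 'b::real_normed_vector"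
  assumes bl: "bounded_linear f'" and e: "\<And>h. norm (f (x + h) - f x - f' h) \<le> C * (norm h)\<^sup>2"
  shows "(f has_derivative f') (at x)"
  unfolding has_derivative_at
proof (intro conjI bl)
  show "(\<lambda>h. norm (f (x + h) - f x - f' h) / norm h) \<midarrow>0\<rightarrow> 0"
  proof (rule Lim_null_comparison)
    show "eventually (\<lambda>h. norm (norm (f (x + h) - f x - f' h) / norm h) \<le> C * norm h) (at 0)"
      using e by (auto simp: eventually_at_filter divide_le_eq power2_eq_square mult.assoc)
    show "(\<lambda>h. C * norm h) \<midarrow>0\<rightarrow> 0" by (auto intro!: tendsto_eq_intros)
  qed
qed

lemma cis_taylor: "norm (cis a - 1 - \<i> * of_real a) \<le> a\<^sup>2"
proof -
  have "norm (cis a - 1 - \<i> * of_real a) \<le> a\<^sup>2 / 2"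
    using iexp_approx1[of a 1] by (simp add: cis_conv_exp numeral_2_eq_2 diff_diff_eq)
  also have "\<dots> \<le> a\<^sup>2" by simp
  finally show ?thesis .
qed

lemma schwartz_coordinate_transform:
  "f \<in> schwartz_space \<Longrightarrow> b \<in> Basis \<Longrightarrow> (\<lambda>x. \<i> * of_real \<sigma> * (of_real (x \<bullet> b) * f x)) \<in> schwartz_space"
  by (intro schwartz_cmult schwartz_coordinate)

text \<open>The Taylor error of the exponential is quadratic in \<open>h\<close> with the integrable weight \<open>|x|^2 |f|\<close>,
  which gives total differentiability at once.  The gradient is again a Fourier integral of Schwartz functions.\<close>

lemma FT_has_derivative:
  fixes f :: "'a::euclidean_space \<Rightarrow> complex"
  assumes f: "f \<in> schwartz_space"
  shows "(FT \<sigma> f has_derivative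
    (\<lambda>h. \<Sum>b\<in>Basis. of_real (h \<bullet> b) * FT \<sigma> (\<lambda>x. \<i> * of_real \<sigma> * (of_real (x \<bullet> b) * f x)) \<xi>)) (at \<xi>)"
proof (rule has_derivative_quadratic)
  let ?g = "\<lambda>b x. \<i> * of_real \<sigma> * (of_real (x \<bullet> b) * f x)"
  let ?d = "\<lambda>h. \<Sum>b\<in>Basis. of_real (h \<bullet> b) * FT \<sigma> (?g b) \<xi>"
  show "bounded_linear ?d"
    by (intro bounded_linear_sum bounded_linear_mult_const
        bounded_linear_compose[OF bounded_linear_of_real bounded_linear_inner_left])
  let ?C = "LINT x|lborel. \<sigma>\<^sup>2 * ((norm x)\<^sup>2 * norm (f x))"
  have if2: "integrable lborel (\<lambda>x. (norm x)\<^sup>2 * norm (f x))"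
  proof -
    have "rapidly_decreasing (\<lambda>x. of_real ((norm x)\<^sup>2) * f x)"
      unfolding rapidly_decreasing_def
    proof
      fix k
      obtain C where "\<And>x. norm x ^ (k + 2) * norm (f x) \<le> C"
        using schwartz_rapidly_decreasing[OF f] unfolding rapidly_decreasing_def by meson
      moreover have E: "norm x ^ k * norm (of_real ((norm x)\<^sup>2) * f x) = norm x ^ (k + 2) * norm (f x)" for x
        by (simp only: norm_mult norm_of_real abs_power2 power_add mult.assoc)
      ultimately show "\<exists>C. \<forall>x. norm x ^ k * norm (of_real ((norm x)\<^sup>2) * f x) \<le> C"
        unfolding E by blast
    qed
    then have "integrable lborel (\<lambda>x. of_real ((norm x)\<^sup>2) * f x)"
      using schwartz_measurable[OF f] by (intro rapidly_decreasing_integrable) auto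
    from integrable_norm[OF this] show ?thesis by (simp add: norm_mult norm_power)
  qed
  fix h :: 'a
  have ig: "integrable lborel (\<lambda>x. cis (\<sigma> * (x \<bullet> \<xi>)) * ?g b x)" if "b \<in> Basis" for b
    by (intro integrable_cis_mult schwartz_integrable schwartz_coordinate_transform f that)
  have sum: "(\<Sum>b\<in>Basis. of_real (h \<bullet> b) * (cis (\<sigma> * (x \<bullet> \<xi>)) * ?g b x)) =
      cis (\<sigma> * (x \<bullet> \<xi>)) * f x * (\<i> * of_real (\<sigma> * (x \<bullet> h)))" for x
  proof -
    have "x \<bullet> h = (\<Sum>b\<in>Basis. (h \<bullet> b) * (x \<bullet> b))"
      by (subst euclidean_inner) (simp add: mult.commute)
    then show ?thesis by (simp add: sum_distrib_left sum_distrib_right mult_ac)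
  qed
  have int_sum: "integrable lborel (\<lambda>x. \<Sum>b\<in>Basis. of_real (h \<bullet> b) * (cis (\<sigma> * (x \<bullet> \<xi>)) * ?g b x))"
    using ig by (intro Bochner_Integration.integrable_sum integrable_mult_right) auto
  have "?d h = (LINT x|lborel. (\<Sum>b\<in>Basis. of_real (h \<bullet> b) * (cis (\<sigma> * (x \<bullet> \<xi>)) * ?g b x)))"
    unfolding FT_def using ig by (subst Bochner_Integration.integral_sum) auto
  then have d: "?d h = (LINT x|lborel. cis (\<sigma> * (x \<bullet> \<xi>)) * f x * (\<i> * of_real (\<sigma> * (x \<bullet> h))))"
    unfolding sum .
  have int1: "integrable lborel (\<lambda>x. cis (\<sigma> * (x \<bullet> (\<xi> + h))) * f x)"
    and int2: "integrable lborel (\<lambda>x. cis (\<sigma> * (x \<bullet> \<xi>)) * f x)"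
    by (intro integrable_cis_mult schwartz_integrable f)+
  have int3: "integrable lborel (\<lambda>x. cis (\<sigma> * (x \<bullet> \<xi>)) * f x * (\<i> * of_real (\<sigma> * (x \<bullet> h))))"
    using int_sum unfolding sum .
  have "FT \<sigma> f (\<xi> + h) - FT \<sigma> f \<xi> - ?d h = (LINT x|lborel. cis (\<sigma> * (x \<bullet> (\<xi> + h))) * f x -
      cis (\<sigma> * (x \<bullet> \<xi>)) * f x - cis (\<sigma> * (x \<bullet> \<xi>)) * f x * (\<i> * of_real (\<sigma> * (x \<bullet> h))))"
    unfolding d unfolding FT_def using int1 int2 int3 by simp
  also have "\<dots> = (LINT x|lborel. cis (\<sigma> * (x \<bullet> \<xi>)) * f x * (cis (\<sigma> * (x \<bullet> h)) - 1 - \<i> * of_real (\<sigma> * (x \<bullet> h))))"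
    by (intro Bochner_Integration.integral_cong) (auto simp: inner_add_right distrib_left cis_mult[symmetric] algebra_simps)
  also have "norm \<dots> \<le> (LINT x|lborel. \<sigma>\<^sup>2 * ((norm x)\<^sup>2 * norm (f x)) * (norm h)\<^sup>2)"
  proof (rule Bochner_Integration.integral_norm_bound_integral)
    show "integrable lborel (\<lambda>x. \<sigma>\<^sup>2 * ((norm x)\<^sup>2 * norm (f x)) * (norm h)\<^sup>2)"
      using if2 by (intro integrable_mult_left integrable_mult_right)
    show "integrable lborel (\<lambda>x. cis (\<sigma> * (x \<bullet> \<xi>)) * f x * (cis (\<sigma> * (x \<bullet> h)) - 1 - \<i> * of_real (\<sigma> * (x \<bullet> h))))"
    proof -
      have "integrable lborel (\<lambda>x. cis (\<sigma> * (x \<bullet> (\<xi> + h))) * f x -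
        cis (\<sigma> * (x \<bullet> \<xi>)) * f x - cis (\<sigma> * (x \<bullet> \<xi>)) * f x * (\<i> * of_real (\<sigma> * (x \<bullet> h))))"
        using int1 int2 int3 by simp
      then show ?thesis
        by (rule back_subst[of "integrable lborel"])
          (auto simp: inner_add_right distrib_left cis_mult[symmetric] algebra_simps)
    qed
    fix x :: 'a
    have "(\<sigma> * (x \<bullet> h))\<^sup>2 \<le> \<sigma>\<^sup>2 * ((norm h)\<^sup>2 * (norm x)\<^sup>2)"
    proof -
      have "\<bar>x \<bullet> h\<bar>\<^sup>2 \<le> (norm x * norm h)\<^sup>2" by (intro power_mono Cauchy_Schwarz_ineq2) auto
      then show ?thesis by (simp add: power_mult_distrib mult_left_mono mult.commute)
    qed
    then have "norm (f x) * norm (cis (\<sigma> * (x \<bullet> h)) - 1 - \<i> * of_real (\<sigma> * (x \<bullet> h))) \<le>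
      norm (f x) * (\<sigma>\<^sup>2 * ((norm h)\<^sup>2 * (norm x)\<^sup>2))"
      using order_trans[OF cis_taylor[of "\<sigma> * (x \<bullet> h)"]] by (intro mult_left_mono) auto
    then show "norm (cis (\<sigma> * (x \<bullet> \<xi>)) * f x * (cis (\<sigma> * (x \<bullet> h)) - 1 - \<i> * of_real (\<sigma> * (x \<bullet> h)))) \<le>
        \<sigma>\<^sup>2 * ((norm x)\<^sup>2 * norm (f x)) * (norm h)\<^sup>2"
      by (simp add: norm_mult mult_ac)
  qed
  also have "\<dots> = ?C * (norm h)\<^sup>2" by (rule integral_mult_left_zero)
  finally show "norm (FT \<sigma> f (\<xi> + h) - FT \<sigma> f \<xi> - ?d h) \<le> ?C * (norm h)\<^sup>2" .
qed

lemma schwartz_line_derivative: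
  assumes f: "f \<in> schwartz_space"
  shows "((\<lambda>u. f (u *\<^sub>R b + x)) has_vector_derivative partial_deriv b f (u *\<^sub>R b + x)) (at u)"
proof -
  have "((\<lambda>u. u *\<^sub>R b + x) has_derivative (\<lambda>h. h *\<^sub>R b)) (at u)"
    by (auto intro!: derivative_eq_intros)
  from has_derivative_compose[OF this schwartz_has_derivative[OF f]]
  have "((\<lambda>u. f (u *\<^sub>R b + x)) has_derivative (\<lambda>h. frechet_derivative f (at (u *\<^sub>R b + x)) (h *\<^sub>R b))) (at u)" .
  moreover have "linear (frechet_derivative f (at (u *\<^sub>R b + x)))"
    by (intro linear_frechet_derivative schwartz_differentiable f)
  ultimately show ?thesis by (simp add: has_vector_derivative_def linear_cmul)
qed

lemma lborel_shift:
  fixes f :: "'a::euclidean_space \<Rightarrow> 'b::{banach,second_countable_topology}"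
  assumes [measurable]: "f \<in> borel_measurable borel"
  shows "(LINT x|lborel. f (a + x)) = (LINT x|lborel. f x)"
    and "integrable lborel (\<lambda>x. f (a + x)) \<longleftrightarrow> integrable lborel f"
proof -
  have "(LINT x|distr lborel borel ((+) a). f x) = (LINT x|lborel. f (a + x))"
    by (rule integral_distr) auto
  then show "(LINT x|lborel. f (a + x)) = (LINT x|lborel. f x)" by (simp add: lborel_distr_plus)
  have "integrable (distr lborel borel ((+) a)) f \<longleftrightarrow> integrable lborel (\<lambda>x. f (a + x))"
    by (rule integrable_distr_eq) auto
  then show "integrable lborel (\<lambda>x. f (a + x)) \<longleftrightarrow> integrable lborel f" by (simp add: lborel_distr_plus)
qed

lemma FT_translate:
  assumes [measurable]: "f \<in> borel_measurable borel"
  shows "FT \<sigma> (\<lambda>x. f (a + x)) \<xi> = cis (- \<sigma> * (a \<bullet> \<xi>)) * FT \<sigma> f \<xi>"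
proof -
  have "cis (- \<sigma> * (a \<bullet> \<xi>)) * FT \<sigma> f \<xi> = (LINT x|lborel. cis (- \<sigma> * (a \<bullet> \<xi>)) * (cis (\<sigma> * (x \<bullet> \<xi>)) * f x))"
    unfolding FT_def by simp
  also have "\<dots> = (LINT x|lborel. cis (- \<sigma> * (a \<bullet> \<xi>)) * (cis (\<sigma> * ((a + x) \<bullet> \<xi>)) * f (a + x)))"
    by (rule lborel_shift(1)[symmetric]) measurable
  also have "\<dots> = FT \<sigma> (\<lambda>x. f (a + x)) \<xi>"
  proof -
    have "cis (- \<sigma> * (a \<bullet> \<xi>)) * cis (\<sigma> * ((a + x) \<bullet> \<xi>)) = cis (\<sigma> * (x \<bullet> \<xi>))" for x
      by (simp add: cis_mult inner_add_left distrib_left)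
    then show ?thesis unfolding FT_def by (simp only: mult.assoc[symmetric])
  qed
  finally show ?thesis ..
qed

text \<open>A translation of \<open>f\<close> multiplies its transform by a phase.  Dividing by the length of the translation
  and letting it tend to \<open>0\<close> gives the rule for derivatives.  The mean value theorem provides the dominating function.\<close>

lemma FT_partial_deriv:
  fixes f :: "'a::euclidean_space \<Rightarrow> complex"
  assumes f: "f \<in> schwartz_space" and b: "b \<in> Basis"
  shows "FT \<sigma> (partial_deriv b f) \<xi> = - \<i> * of_real (\<sigma> * (b \<bullet> \<xi>)) * FT \<sigma> f \<xi>"
proof (rule LIMSEQ_unique)
  define s :: "nat \<Rightarrow> real" where "s n = inverse (real (Suc n))" for n
  have s: "0 < s n" "s n \<le> 1" for n by (auto simp: s_def inverse_le_1_iff)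
  have s0: "s \<longlonglongrightarrow> 0" unfolding s_def by (rule LIMSEQ_inverse_real_of_nat)
  have s0': "filterlim s (at 0) sequentially"
    using s0 s(1) by (auto simp: filterlim_at intro!: always_eventually) (metis less_irrefl)
  define q where "q n x = (f (s n *\<^sub>R b + x) - f x) / of_real (s n)" for n x
  note [measurable] = schwartz_measurable[OF f] schwartz_measurable[OF schwartz_partial_deriv[OF f b]]
  obtain C where C: "C \<ge> 0" "\<And>x. norm (partial_deriv b f x) \<le> C * inverse ((1 + norm x) ^ (2 * DIM('a)))"
    using rapidly_decreasing_bound[OF schwartz_rapidly_decreasing[OF schwartz_partial_deriv[OF f b]]] by metis
  \<comment> \<open>The point of the mean value theorem is at distance at most \<open>1\<close> from \<open>x\<close>,
    which costs a factor \<open>2\<close> in \<open>1 + |x|\<close>.\<close>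
  let ?w = "\<lambda>x::'a. (C * 2 ^ (2 * DIM('a))) * inverse ((1 + norm x) ^ (2 * DIM('a)))"
  have q_le: "norm (q n x) \<le> ?w x" for n x
  proof -
    have "\<exists>u\<in>{0<..<s n}. norm (f (s n *\<^sub>R b + x) - f (0 *\<^sub>R b + x)) \<le> norm ((s n - 0) *\<^sub>R partial_deriv b f (u *\<^sub>R b + x))"
      using schwartz_line_derivative[OF f, of b x] s(1)[of n]
      by (intro mvt_general[where f = "\<lambda>u. f (u *\<^sub>R b + x)" and f' = "\<lambda>u h. h *\<^sub>R partial_deriv b f (u *\<^sub>R b + x)"])
        (auto simp: has_vector_derivative_def intro!: continuous_at_imp_continuous_on has_derivative_continuous)
    then obtain u where u: "0 < u" "u < s n"
      and le: "norm (f (s n *\<^sub>R b + x) - f x) \<le> s n * norm (partial_deriv b f (u *\<^sub>R b + x))"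
      using s(1)[of n] by auto
    have "norm (q n x) \<le> norm (partial_deriv b f (u *\<^sub>R b + x))"
      using le s(1)[of n] by (simp add: q_def norm_divide divide_le_eq mult.commute)
    also have "\<dots> \<le> C * inverse ((1 + norm (u *\<^sub>R b + x)) ^ (2 * DIM('a)))" by (rule C)
    also have "\<dots> \<le> C * (2 ^ (2 * DIM('a)) * inverse ((1 + norm x) ^ (2 * DIM('a))))"
    proof (rule mult_left_mono)
      have "norm x \<le> norm (u *\<^sub>R b + x) + norm (u *\<^sub>R b)"
        using norm_triangle_ineq4[of "u *\<^sub>R b + x" "u *\<^sub>R b"] by simp
      moreover have "norm (u *\<^sub>R b) \<le> 1" using u s(2)[of n] b by simp
      ultimately have "1 + norm x \<le> 2 * (1 + norm (u *\<^sub>R b + x))"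
        using norm_ge_zero[of "u *\<^sub>R b + x"] unfolding distrib_left by linarith
      then have "(1 + norm x) ^ (2 * DIM('a)) \<le> 2 ^ (2 * DIM('a)) * (1 + norm (u *\<^sub>R b + x)) ^ (2 * DIM('a))"
        unfolding power_mult_distrib[symmetric] by (intro power_mono) auto
      moreover have "(1 + norm x) ^ (2 * DIM('a)) > 0" "(1 + norm (u *\<^sub>R b + x)) ^ (2 * DIM('a)) > 0"
        by (auto simp: add_pos_nonneg)
      ultimately show "inverse ((1 + norm (u *\<^sub>R b + x)) ^ (2 * DIM('a))) \<le> 2 ^ (2 * DIM('a)) * inverse ((1 + norm x) ^ (2 * DIM('a)))"
        by (simp add: field_simps)
    qed (rule C)
    finally show ?thesis by (simp add: mult.assoc)
  qed
  show "(\<lambda>n. FT \<sigma> (q n) \<xi>) \<longlonglongrightarrow> FT \<sigma> (partial_deriv b f) \<xi>"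
    unfolding FT_def
  proof (rule integral_dominated_convergence[where w = ?w])
    show "integrable lborel ?w" by (intro integrable_mult_right integrable_inverse_power_norm)
    show "AE x in lborel. norm (cis (\<sigma> * (x \<bullet> \<xi>)) * q n x) \<le> ?w x" for n
      using q_le by (auto simp: norm_mult)
    show "AE x in lborel. (\<lambda>n. cis (\<sigma> * (x \<bullet> \<xi>)) * q n x) \<longlonglongrightarrow> cis (\<sigma> * (x \<bullet> \<xi>)) * partial_deriv b f x"
    proof (intro AE_I2 tendsto_mult tendsto_const)
      fix x
      have "(\<lambda>h. norm (f ((0 + h) *\<^sub>R b + x) - f (0 *\<^sub>R b + x) - h *\<^sub>R partial_deriv b f (0 *\<^sub>R b + x)) / norm h) \<midarrow>0\<rightarrow> 0"
        using schwartz_line_derivative[OF f, of b x 0]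
        unfolding has_vector_derivative_def has_derivative_at by blast
      then have "(\<lambda>n. norm (f ((0 + s n) *\<^sub>R b + x) - f (0 *\<^sub>R b + x) - s n *\<^sub>R partial_deriv b f (0 *\<^sub>R b + x)) / norm (s n)) \<longlonglongrightarrow> 0"
        by (rule filterlim_compose[OF _ s0'])
      moreover have "norm (f ((0 + s n) *\<^sub>R b + x) - f (0 *\<^sub>R b + x) - s n *\<^sub>R partial_deriv b f (0 *\<^sub>R b + x)) / norm (s n)
          = norm (q n x - partial_deriv b f x)" for n
      proof -
        have "q n x - partial_deriv b f x = (f (s n *\<^sub>R b + x) - f x - s n *\<^sub>R partial_deriv b f x) / of_real (s n)"
          using s(1)[of n] by (simp add: q_def scaleR_conv_of_real diff_divide_distrib)
        then show ?thesis by (simp add: norm_divide)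
      qed
      ultimately show "(\<lambda>n. q n x) \<longlonglongrightarrow> partial_deriv b f x"
        by (simp add: LIM_zero_cancel tendsto_norm_zero_iff)
    qed
  qed (simp_all add: q_def[abs_def])
  have q: "FT \<sigma> (q n) \<xi> = (cis (- \<sigma> * (b \<bullet> \<xi>) * s n) - 1) / of_real (s n) * FT \<sigma> f \<xi>" for n
  proof -
    have i: "integrable lborel f" by (rule schwartz_integrable[OF f])
    have i': "integrable lborel (\<lambda>x. f (s n *\<^sub>R b + x))" using i by (subst lborel_shift) auto
    have "FT \<sigma> (q n) \<xi> = (LINT x|lborel. (cis (\<sigma> * (x \<bullet> \<xi>)) * f (s n *\<^sub>R b + x) - cis (\<sigma> * (x \<bullet> \<xi>)) * f x) / of_real (s n))"
      unfolding FT_def q_def by (simp add: algebra_simps)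
    also have "\<dots> = (FT \<sigma> (\<lambda>x. f (s n *\<^sub>R b + x)) \<xi> - FT \<sigma> f \<xi>) / of_real (s n)"
      unfolding FT_def using integrable_cis_mult[OF i] integrable_cis_mult[OF i'] by simp
    finally show ?thesis by (subst (asm) FT_translate) (auto simp: algebra_simps)
  qed
  let ?a = "- \<sigma> * (b \<bullet> \<xi>)"
  have "(\<lambda>n. (cis (?a * s n) - 1) / of_real (s n) - \<i> * of_real ?a) \<longlonglongrightarrow> 0"
  proof (rule Lim_null_comparison)
    show "eventually (\<lambda>n. norm ((cis (?a * s n) - 1) / of_real (s n) - \<i> * of_real ?a) \<le> ?a\<^sup>2 * s n) sequentially"
    proof (intro always_eventually allI)
      fix n
      have "(cis (?a * s n) - 1) / of_real (s n) - \<i> * of_real ?a = (cis (?a * s n) - 1 - \<i> * of_real (?a * s n)) / of_real (s n)"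
        using s(1)[of n] by (simp add: diff_divide_distrib add_divide_distrib)
      then have "norm ((cis (?a * s n) - 1) / of_real (s n) - \<i> * of_real ?a) \<le> (?a * s n)\<^sup>2 / s n"
        using cis_taylor[of "?a * s n"] s(1)[of n] by (simp add: norm_divide divide_right_mono)
      then show "norm ((cis (?a * s n) - 1) / of_real (s n) - \<i> * of_real ?a) \<le> ?a\<^sup>2 * s n"
        using s(1)[of n] by (simp add: power2_eq_square mult_ac)
    qed
    show "(\<lambda>n. ?a\<^sup>2 * s n) \<longlonglongrightarrow> 0" using tendsto_mult_right_zero[OF s0] by simp
  qed
  then have "(\<lambda>n. (cis (?a * s n) - 1) / of_real (s n)) \<longlonglongrightarrow> \<i> * of_real ?a" by (rule LIM_zero_cancel)
  then have "(\<lambda>n. (cis (?a * s n) - 1) / of_real (s n) * FT \<sigma> f \<xi>) \<longlonglongrightarrow> \<i> * of_real ?a * FT \<sigma> f \<xi>"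
    by (intro tendsto_mult tendsto_const)
  then show "(\<lambda>n. FT \<sigma> (q n) \<xi>) \<longlonglongrightarrow> - \<i> * of_real (\<sigma> * (b \<bullet> \<xi>)) * FT \<sigma> f \<xi>"
    unfolding q by simp
qed

lemma FT_rapidly_decreasing:
  fixes f :: "'a::euclidean_space \<Rightarrow> complex"
  assumes f: "f \<in> schwartz_space" and \<sigma>: "\<bar>\<sigma>\<bar> = 1"
  shows "rapidly_decreasing (FT \<sigma> f)"
proof -
  have "\<exists>C. \<forall>\<xi>. norm \<xi> ^ k * norm (FT \<sigma> f \<xi>) \<le> C" for k
    using f
  proof (induction k arbitrary: f)
    case 0
    then show ?case using FT_norm_le by auto
  next
    case (Suc k)
    have "\<forall>b\<in>Basis. \<exists>C. \<forall>\<xi>. norm \<xi> ^ k * norm (FT \<sigma> (partial_deriv b f) \<xi>) \<le> C"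
      using Suc schwartz_partial_deriv by blast
    then obtain C where C: "\<And>b \<xi>. b \<in> Basis \<Longrightarrow> norm \<xi> ^ k * norm (FT \<sigma> (partial_deriv b f) \<xi>) \<le> C b"
      by metis
    have "norm \<xi> ^ Suc k * norm (FT \<sigma> f \<xi>) \<le> (\<Sum>b\<in>Basis. C b)" for \<xi>
    proof -
      have "norm \<xi> ^ Suc k * norm (FT \<sigma> f \<xi>) = norm \<xi> * (norm \<xi> ^ k * norm (FT \<sigma> f \<xi>))" by simp
      also have "\<dots> \<le> (\<Sum>b\<in>Basis. \<bar>\<xi> \<bullet> b\<bar>) * (norm \<xi> ^ k * norm (FT \<sigma> f \<xi>))"
        by (intro mult_right_mono norm_le_l1) auto
      also have "\<dots> = (\<Sum>b\<in>Basis. norm \<xi> ^ k * norm (FT \<sigma> (partial_deriv b f) \<xi>))"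
        unfolding sum_distrib_right
        by (intro sum.cong refl) (simp add: FT_partial_deriv[OF Suc.prems] norm_mult abs_mult \<sigma> inner_commute)
      also have "\<dots> \<le> (\<Sum>b\<in>Basis. C b)" by (intro sum_mono C)
      finally show ?thesis .
    qed
    then show ?case by blast
  qed
  then show ?thesis by (simp add: rapidly_decreasing_def)
qed

theorem FT_schwartz:
  fixes f :: "'a::euclidean_space \<Rightarrow> complex"
  assumes f: "f \<in> schwartz_space" and \<sigma>: "\<bar>\<sigma>\<bar> = 1"
  shows "FT \<sigma> f \<in> schwartz_space"
proof (rule schwartz_coinduct)
  let ?F = "FT \<sigma> ` schwartz_space :: ('a \<Rightarrow> complex) set"
  show "FT \<sigma> f \<in> ?F" using f by blast
  fix g assume "g \<in> ?F"
  then obtain f where g: "g = FT \<sigma> f" and f: "f \<in> schwartz_space" by blast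
  show "g differentiable (at x)" for x
    unfolding g using FT_has_derivative[OF f] by (auto simp: differentiable_def)
  show "rapidly_decreasing g" unfolding g by (rule FT_rapidly_decreasing[OF f \<sigma>])
  fix b :: 'a assume b: "b \<in> Basis"
  have "partial_deriv b g = FT \<sigma> (\<lambda>x. \<i> * of_real \<sigma> * (of_real (x \<bullet> b) * f x))"
    unfolding g partial_deriv_eqI[OF FT_has_derivative[OF f]]
    using b by (simp add: inner_Basis if_distrib[of of_real] if_distrib[of "\<lambda>c. c * _"] cong: if_cong)
  then show "partial_deriv b g \<in> ?F" using schwartz_coordinate_transform[OF f b] by blast
qed

section \<open>Gaussians and Fourier inversion\<close>

lemma lborel_scale:
  fixes f :: "'a::euclidean_space \<Rightarrow> 'b::{banach,second_countable_topology}"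
  assumes [measurable]: "f \<in> borel_measurable borel" and c: "c > 0"
  shows "(LINT x|lborel. f x) = c ^ DIM('a) *\<^sub>R (LINT x|lborel. f (a + c *\<^sub>R x))"
    and "integrable lborel (\<lambda>x. f (a + c *\<^sub>R x)) \<longleftrightarrow> integrable lborel f"
proof -
  have L: "lborel = density (distr lborel borel (\<lambda>x. a + c *\<^sub>R x)) (\<lambda>_. ennreal (c ^ DIM('a)))"
    using lborel_affine[of c a] c by simp
  have "(LINT x|lborel. f x) = (LINT x|density (distr lborel borel (\<lambda>x. a + c *\<^sub>R x)) (\<lambda>_. ennreal (c ^ DIM('a))). f x)"
    by (subst L) simp
  also have "\<dots> = (LINT x|distr lborel borel (\<lambda>x. a + c *\<^sub>R x). c ^ DIM('a) *\<^sub>R f x)"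
    using c by (intro integral_density) auto
  also have "\<dots> = (LINT x|lborel. c ^ DIM('a) *\<^sub>R f (a + c *\<^sub>R x))"
    by (rule integral_distr) auto
  finally show "(LINT x|lborel. f x) = c ^ DIM('a) *\<^sub>R (LINT x|lborel. f (a + c *\<^sub>R x))" by simp
  have "integrable lborel f \<longleftrightarrow> integrable (density (distr lborel borel (\<lambda>x. a + c *\<^sub>R x)) (\<lambda>_. ennreal (c ^ DIM('a)))) f"
    by (subst L) simp
  also have "\<dots> \<longleftrightarrow> integrable (distr lborel borel (\<lambda>x. a + c *\<^sub>R x)) (\<lambda>x. c ^ DIM('a) *\<^sub>R f x)"
    using c by (intro integrable_density) auto
  also have "\<dots> \<longleftrightarrow> integrable lborel (\<lambda>x. c ^ DIM('a) *\<^sub>R f (a + c *\<^sub>R x))"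
    by (rule integrable_distr_eq) auto
  also have "\<dots> \<longleftrightarrow> integrable lborel (\<lambda>x. f (a + c *\<^sub>R x))"
  proof
    assume "integrable lborel (\<lambda>x. c ^ DIM('a) *\<^sub>R f (a + c *\<^sub>R x))"
    then have "integrable lborel (\<lambda>x. inverse (c ^ DIM('a)) *\<^sub>R (c ^ DIM('a) *\<^sub>R f (a + c *\<^sub>R x)))"
      by (rule integrable_scaleR_right)
    then show "integrable lborel (\<lambda>x. f (a + c *\<^sub>R x))" using c by simp
  qed (rule integrable_scaleR_right)
  finally show "integrable lborel (\<lambda>x. f (a + c *\<^sub>R x)) \<longleftrightarrow> integrable lborel f" ..
qed

lemma gauss_FT_real:
  "integrable lborel (\<lambda>x::real. cis (a * x) * of_real (exp (- x\<^sup>2 / 2)))"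
  "(LINT x::real|lborel. cis (a * x) * of_real (exp (- x\<^sup>2 / 2))) = of_real (sqrt (2 * pi) * exp (- a\<^sup>2 / 2))"
proof -
  have "integrable lborel (\<lambda>x. sqrt (2 * pi) * std_normal_density x)"
    by (intro integrable_mult_right integrable_normal_density) auto
  then have i: "integrable lborel (\<lambda>x::real. exp (- x\<^sup>2 / 2))"
    by (simp add: std_normal_density_def)
  then have "integrable lborel (\<lambda>x::real. complex_of_real (exp (- x\<^sup>2 / 2)))"
    by (rule integrable_of_real)
  then show "integrable lborel (\<lambda>x::real. cis (a * x) * of_real (exp (- x\<^sup>2 / 2)))"
    using integrable_cis_mult[of "\<lambda>x::real. complex_of_real (exp (- x\<^sup>2 / 2))" a 1]
    by simp
  have "of_real (exp (- a\<^sup>2 / 2)) = (LINT x|density lborel (\<lambda>x. ennreal (std_normal_density x)). iexp (a * x))"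
    using fun_cong[OF char_std_normal_distribution, of a] by (simp add: char_def)
  also have "\<dots> = (LINT x|lborel. std_normal_density x *\<^sub>R iexp (a * x))"
    by (rule integral_density) auto
  also have "\<dots> = (LINT x|lborel. of_real (1 / sqrt (2 * pi)) * (cis (a * x) * of_real (exp (- x\<^sup>2 / 2))))"
    by (intro Bochner_Integration.integral_cong refl)
      (simp add: std_normal_density_def scaleR_conv_of_real cis_conv_exp)
  finally show "(LINT x::real|lborel. cis (a * x) * of_real (exp (- x\<^sup>2 / 2))) = of_real (sqrt (2 * pi) * exp (- a\<^sup>2 / 2))"
    by (simp add: field_simps)
qed

definition gauss :: "real \<Rightarrow> 'a::euclidean_space \<Rightarrow> real" where
  "gauss \<delta> x = exp (- (\<delta> * norm x)\<^sup>2 / 2)"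

lemma gauss_nonneg: "gauss \<delta> x \<ge> 0" and gauss_le_1: "gauss \<delta> x \<le> 1"
  by (auto simp: gauss_def)

lemma measurable_gauss [measurable]: "gauss \<delta> \<in> borel_measurable borel"
  unfolding gauss_def by measurable

text \<open>The Gaussian and the character both split into products over the coordinates, so this reduces to the
  characteristic function of the normal distribution.\<close>

lemma gauss_FT_unit:
  fixes z :: "'a::euclidean_space"
  shows "integrable lborel (\<lambda>x. cis (z \<bullet> x) * of_real (gauss 1 x))"
    and "(LINT x|lborel. cis (z \<bullet> x) * of_real (gauss 1 x)) = of_real (sqrt (2 * pi) ^ DIM('a) * gauss 1 z)"
proof -
  have cis_sum: "cis (\<Sum>b\<in>A. g b) = (\<Prod>b\<in>A. cis (g b))" if "finite A" for g and A :: "'a set"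
    using that by (induction A) (auto simp: cis_mult[symmetric])
  have nrm: "(norm x)\<^sup>2 = (\<Sum>b\<in>Basis. (x \<bullet> b)\<^sup>2)" for x :: 'a
    unfolding power2_norm_eq_inner by (subst euclidean_inner) (simp add: power2_eq_square)
  have gp: "gauss 1 x = (\<Prod>b\<in>Basis. exp (- (x \<bullet> b)\<^sup>2 / 2))" for x :: 'a
    by (simp add: gauss_def nrm exp_sum[symmetric] sum_negf sum_divide_distrib)
  have e: "cis (z \<bullet> x) * of_real (gauss 1 x) = (\<Prod>b\<in>Basis. cis ((z \<bullet> b) * (x \<bullet> b)) * of_real (exp (- (x \<bullet> b)\<^sup>2 / 2)))" for x
    unfolding prod.distrib gp of_real_prod by (subst euclidean_inner) (simp add: cis_sum)
  show "integrable lborel (\<lambda>x. cis (z \<bullet> x) * of_real (gauss 1 x))"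
    unfolding e by (intro integrable_coordinate_product gauss_FT_real)
  have "(LINT x|lborel. cis (z \<bullet> x) * of_real (gauss 1 x)) = (\<Prod>b\<in>Basis. of_real (sqrt (2 * pi) * exp (- (z \<bullet> b)\<^sup>2 / 2)))"
    unfolding e gauss_FT_real(2)[symmetric]
    by (rule integrable_coordinate_product(2)) (rule gauss_FT_real(1))
  also have "\<dots> = of_real (sqrt (2 * pi) ^ DIM('a) * gauss 1 z)"
    unfolding gp by (simp add: prod.distrib)
  finally show "(LINT x|lborel. cis (z \<bullet> x) * of_real (gauss 1 x)) = of_real (sqrt (2 * pi) ^ DIM('a) * gauss 1 z)" .
qed

lemma gauss_FT:
  fixes z :: "'a::euclidean_space"
  assumes \<delta>: "\<delta> > 0"
  shows "integrable lborel (\<lambda>x. cis (z \<bullet> x) * of_real (gauss \<delta> x))"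
    and "(LINT x|lborel. cis (z \<bullet> x) * of_real (gauss \<delta> x)) = of_real ((sqrt (2 * pi) / \<delta>) ^ DIM('a) * gauss (1 / \<delta>) z)"
proof -
  let ?f = "\<lambda>x. cis ((z /\<^sub>R \<delta>) \<bullet> x) * of_real (gauss 1 x)"
  have e: "?f (0 + \<delta> *\<^sub>R x) = cis (z \<bullet> x) * of_real (gauss \<delta> x)" for x
    using \<delta> by (simp add: gauss_def mult.assoc[symmetric])
  have m: "?f \<in> borel_measurable borel" using borel_measurable_integrable[OF gauss_FT_unit(1)[of "z /\<^sub>R \<delta>"]] by simp
  show "integrable lborel (\<lambda>x. cis (z \<bullet> x) * of_real (gauss \<delta> x))"
    using lborel_scale(2)[OF m \<delta>, of 0] gauss_FT_unit(1) unfolding e by (rule iffD2)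
  let ?I = "LINT x|lborel. cis (z \<bullet> x) * complex_of_real (gauss \<delta> x)"
  have 1: "\<delta> ^ DIM('a) *\<^sub>R ?I = of_real (sqrt (2 * pi) ^ DIM('a) * gauss 1 (z /\<^sub>R \<delta>))"
    using lborel_scale(1)[OF m \<delta>, of 0] unfolding e gauss_FT_unit(2) by (rule sym)
  have 2: "gauss 1 (z /\<^sub>R \<delta>) = gauss (1 / \<delta>) z" using \<delta> by (simp add: gauss_def inverse_eq_divide)
  have "?I = inverse (\<delta> ^ DIM('a)) *\<^sub>R (\<delta> ^ DIM('a) *\<^sub>R ?I)" using \<delta> by simp
  also have "\<dots> = of_real (inverse (\<delta> ^ DIM('a)) * (sqrt (2 * pi) ^ DIM('a) * gauss (1 / \<delta>) z))"
    unfolding 1 2 unfolding scaleR_conv_of_real of_real_mult ..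
  also have "inverse (\<delta> ^ DIM('a)) * (sqrt (2 * pi) ^ DIM('a) * gauss (1 / \<delta>) z) = (sqrt (2 * pi) / \<delta>) ^ DIM('a) * gauss (1 / \<delta>) z"
    unfolding power_divide using \<delta> by (simp add: field_simps)
  finally show "?I = of_real ((sqrt (2 * pi) / \<delta>) ^ DIM('a) * gauss (1 / \<delta>) z)" .
qed

lemma gauss_integral:
  assumes \<delta>: "\<delta> > 0"
  shows "integrable lborel (gauss \<delta> :: 'a::euclidean_space \<Rightarrow> real)"
    and "(LINT x|lborel. gauss \<delta> (x::'a)) = (sqrt (2 * pi) / \<delta>) ^ DIM('a)"
proof -
  have "integrable lborel (\<lambda>x::'a. complex_of_real (gauss \<delta> x))"
    using gauss_FT(1)[OF \<delta>, of 0] by simp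
  then show "integrable lborel (gauss \<delta> :: 'a \<Rightarrow> real)"
    using integrable_Re by fastforce
  have "complex_of_real (LINT x|lborel. gauss \<delta> (x::'a)) = of_real ((sqrt (2 * pi) / \<delta>) ^ DIM('a))"
    using gauss_FT(2)[OF \<delta>, of 0] by (simp add: gauss_def[of _ 0])
  then show "(LINT x|lborel. gauss \<delta> (x::'a)) = (sqrt (2 * pi) / \<delta>) ^ DIM('a)"
    by (simp only: of_real_eq_iff)
qed

lemma integrable_bounded_tensor:
  fixes f g :: "'a::euclidean_space \<Rightarrow> complex"
  assumes f: "integrable lborel f" and g: "integrable lborel g"
    and K[measurable]: "K \<in> borel_measurable (borel \<Otimes>\<^sub>M borel)" and K1: "\<And>z. norm (K z) \<le> 1"
  shows "integrable (lborel \<Otimes>\<^sub>M lborel) (\<lambda>(x, y). K (x, y) * f x * g y)"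
proof (rule Bochner_Integration.integrable_bound)
  have [measurable]: "f \<in> borel_measurable borel" "g \<in> borel_measurable borel"
    using f g by (auto dest: borel_measurable_integrable)
  show "integrable (lborel \<Otimes>\<^sub>M lborel) (\<lambda>z. f (fst z) * g (snd z))"
  proof (rule lborel_pair.Fubini_integrable)
    have "(\<lambda>x. LINT y|lborel. norm (f (fst (x, y)) * g (snd (x, y)))) = (\<lambda>x. norm (f x) * (LINT y|lborel. norm (g y)))"
      by (simp add: norm_mult)
    then show "integrable lborel (\<lambda>x. LINT y|lborel. norm (f (fst (x, y)) * g (snd (x, y))))"
      using f by simp
    show "AE x in lborel. integrable lborel (\<lambda>y. f (fst (x, y)) * g (snd (x, y)))" using g by simp
  qed measurable
  show "(\<lambda>(x, y). K (x, y) * f x * g y) \<in> borel_measurable (lborel \<Otimes>\<^sub>M lborel)" by measurable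
  show "AE z in lborel \<Otimes>\<^sub>M lborel. norm (case z of (x, y) \<Rightarrow> K (x, y) * f x * g y) \<le> norm (f (fst z) * g (snd z))"
    using K1 by (auto simp: norm_mult mult_left_le_one_le mult.assoc intro!: AE_I2)
qed

lemma fubini_bounded_tensor:
  fixes f g :: "'a::euclidean_space \<Rightarrow> complex"
  assumes "integrable lborel f" "integrable lborel g"
    and "K \<in> borel_measurable (borel \<Otimes>\<^sub>M borel)" "\<And>z. norm (K z) \<le> 1"
  shows "(LINT x|lborel. f x * (LINT y|lborel. K (x, y) * g y)) = (LINT y|lborel. g y * (LINT x|lborel. K (x, y) * f x))"
proof -
  have A: "(LINT y|lborel. LINT x|lborel. K (x, y) * f x * g y) = (LINT x|lborel. LINT y|lborel. K (x, y) * f x * g y)"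
    using integrable_bounded_tensor[OF assms]
    by (intro lborel_pair.Fubini_integral) (simp add: case_prod_unfold)
  have B: "(LINT x|lborel. K (x, y) * f x * g y) = g y * (LINT x|lborel. K (x, y) * f x)" for y
    by (subst integral_mult_right_zero[symmetric]) (simp add: mult_ac)
  have C: "(LINT y|lborel. K (x, y) * f x * g y) = f x * (LINT y|lborel. K (x, y) * g y)" for x
    by (subst integral_mult_right_zero[symmetric]) (simp add: mult_ac)
  show ?thesis using A unfolding B C by (rule sym)
qed

lemma measurable_cis_inner_pair [measurable]:
  "(\<lambda>z::'a::euclidean_space \<times> 'a. cis (\<sigma> * (fst z \<bullet> snd z))) \<in> borel_measurable (borel \<Otimes>\<^sub>M borel)"
  unfolding borel_prod by (intro borel_measurable_continuous_onI continuous_intros)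

text \<open>The transform may be moved from one factor to the other; this is what links integrals over
  \<open>x\<close> and over \<open>\<xi>\<close> in the proofs of inversion, of the \<open>L^2\<close> bound and of its extension.\<close>

lemma FT_multiplication_formula:
  assumes f: "integrable lborel f" and g: "integrable lborel g"
  shows "(LINT x|lborel. f x * FT \<sigma> g x) = (LINT x|lborel. FT \<sigma> f x * g x)"
  using fubini_bounded_tensor[OF f g measurable_cis_inner_pair, of \<sigma>]
  unfolding FT_def by (simp add: inner_commute mult.commute)

lemma FT_measurable [measurable]:
  fixes f :: "'a::euclidean_space \<Rightarrow> complex"
  assumes [measurable]: "f \<in> borel_measurable borel"
  shows "FT \<sigma> f \<in> borel_measurable borel"
proof -
  have "(\<lambda>(\<xi>, x). cis (\<sigma> * (x \<bullet> \<xi>)) * f x) \<in> borel_measurable (borel \<Otimes>\<^sub>M lborel)"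
  proof -
    have "(\<lambda>z::'a\<times>'a. cis (\<sigma> * (fst z \<bullet> snd z)) * f (snd z)) \<in> borel_measurable (borel \<Otimes>\<^sub>M lborel)"
      by measurable
    then show ?thesis by (simp add: case_prod_unfold inner_commute)
  qed
  then show ?thesis unfolding FT_def by (rule lborel.borel_measurable_lebesgue_integral)
qed

text \<open>Insert a Gaussian factor of width \<open>1/\<delta>\<close>.  By the multiplication formula the regularised integral is
  an average of \<open>f\<close> around \<open>y\<close> with a Gaussian of width \<open>\<delta>\<close>, and both sides converge
  as \<open>\<delta>\<close> tends to \<open>0\<close>.\<close>

theorem FT_inversion:
  fixes f :: "'a::euclidean_space \<Rightarrow> complex"
  assumes f: "f \<in> schwartz_space"
  shows "FT (- 1) (FT 1 f) y = of_real ((2 * pi) ^ DIM('a)) * f y"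
proof (rule LIMSEQ_unique)
  define s :: "nat \<Rightarrow> real" where "s n = inverse (real (Suc n))" for n
  have s: "0 < s n" for n by (auto simp: s_def)
  have s0: "s \<longlonglongrightarrow> 0" unfolding s_def by (rule LIMSEQ_inverse_real_of_nat)
  have F: "FT 1 f \<in> schwartz_space" by (rule FT_schwartz[OF f]) simp
  note [measurable] = schwartz_measurable[OF f] schwartz_measurable[OF F]
  let ?I = "\<lambda>n. LINT \<xi>|lborel. cis (- 1 * (\<xi> \<bullet> y)) * of_real (gauss (s n) \<xi>) * FT 1 f \<xi>"
  show "?I \<longlonglongrightarrow> FT (- 1) (FT 1 f) y"
    unfolding FT_def[of "- 1"]
  proof (rule integral_dominated_convergence[where w = "\<lambda>\<xi>. norm (FT 1 f \<xi>)"])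
    show "integrable lborel (\<lambda>\<xi>. norm (FT 1 f \<xi>))" by (intro integrable_norm schwartz_integrable F)
    show "AE \<xi> in lborel. (\<lambda>n. cis (- 1 * (\<xi> \<bullet> y)) * of_real (gauss (s n) \<xi>) * FT 1 f \<xi>) \<longlonglongrightarrow> cis (- 1 * (\<xi> \<bullet> y)) * FT 1 f \<xi>"
      unfolding gauss_def by (auto intro!: tendsto_eq_intros s0)
    show "AE \<xi> in lborel. norm (cis (- 1 * (\<xi> \<bullet> y)) * of_real (gauss (s n) \<xi>) * FT 1 f \<xi>) \<le> norm (FT 1 f \<xi>)" for n
      by (intro AE_I2) (simp add: norm_mult mult_left_le_one_le gauss_nonneg gauss_le_1)
  qed measurable
  have I: "?I n = of_real (sqrt (2 * pi) ^ DIM('a)) * (LINT z|lborel. of_real (gauss 1 z) * f (y + s n *\<^sub>R z))" for n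
  proof -
    let ?g = "\<lambda>\<xi>. cis (- 1 * (\<xi> \<bullet> y)) * complex_of_real (gauss (s n) \<xi>)"
    have g: "integrable lborel ?g"
      using gauss_FT(1)[OF s[of n], of "- y"] by (simp add: inner_commute)
    have FTg: "FT 1 ?g x = of_real ((sqrt (2 * pi) / s n) ^ DIM('a) * gauss (1 / s n) (x - y))" for x
      unfolding gauss_FT(2)[OF s[of n], of "x - y", symmetric] FT_def mult.assoc[symmetric]
      by (simp add: cis_mult inner_diff_left inner_diff_right inner_commute)
    have "?I n = (LINT x|lborel. FT 1 ?g x * f x)"
      by (rule FT_multiplication_formula[OF g schwartz_integrable[OF f]])
    also have "\<dots> = s n ^ DIM('a) *\<^sub>R (LINT z|lborel. FT 1 ?g (y + s n *\<^sub>R z) * f (y + s n *\<^sub>R z))"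
    proof (rule lborel_scale(1)[OF _ s])
      have "?g \<in> borel_measurable borel" using borel_measurable_integrable[OF g] by simp
      from borel_measurable_times[OF FT_measurable[OF this] schwartz_measurable[OF f]]
      show "(\<lambda>x. FT 1 ?g x * f x) \<in> borel_measurable borel" .
    qed
    also have "\<dots> = s n ^ DIM('a) *\<^sub>R (LINT z|lborel. of_real ((sqrt (2 * pi) / s n) ^ DIM('a)) * (of_real (gauss 1 z) * f (y + s n *\<^sub>R z)))"
      unfolding FTg using s[of n] by (simp add: gauss_def mult.assoc)
    also have "\<dots> = of_real (sqrt (2 * pi) ^ DIM('a)) * (LINT z|lborel. of_real (gauss 1 z) * f (y + s n *\<^sub>R z))"
      using s[of n] by (simp add: scaleR_conv_of_real power_divide)
    finally show ?thesis .
  qed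
  obtain C where C: "\<And>x. norm (f x) \<le> C"
    using schwartz_rapidly_decreasing[OF f] unfolding rapidly_decreasing_def by (metis mult_1 power_0)
  have "(\<lambda>n. LINT z|lborel. of_real (gauss 1 z) * f (y + s n *\<^sub>R z)) \<longlonglongrightarrow> (LINT z::'a|lborel. of_real (gauss 1 z) * f y)"
  proof (rule integral_dominated_convergence[where w = "\<lambda>z. gauss 1 z * C"])
    show "integrable lborel (\<lambda>z::'a. gauss 1 z * C)" by (intro integrable_mult_left gauss_integral) auto
    show "AE z in lborel. (\<lambda>n. of_real (gauss 1 z) * f (y + s n *\<^sub>R z)) \<longlonglongrightarrow> of_real (gauss 1 z) * f y"
    proof (intro AE_I2 tendsto_mult tendsto_const)
      fix z
      have "(\<lambda>n. y + s n *\<^sub>R z) \<longlonglongrightarrow> y" by (auto intro!: tendsto_eq_intros s0)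
      moreover have "isCont f y" using schwartz_continuous[OF f] by (simp add: continuous_on_eq_continuous_at)
      ultimately show "(\<lambda>n. f (y + s n *\<^sub>R z)) \<longlonglongrightarrow> f y" by (rule isCont_tendsto_compose[rotated])
    qed
    show "AE z in lborel. norm (complex_of_real (gauss 1 z) * f (y + s n *\<^sub>R z)) \<le> gauss 1 z * C" for n
      by (intro AE_I2) (simp add: norm_mult gauss_nonneg mult_left_mono C)
  qed measurable
  then have "?I \<longlonglongrightarrow> of_real (sqrt (2 * pi) ^ DIM('a)) * (LINT z|lborel. of_real (gauss 1 (z::'a)) * f y)"
    unfolding I by (intro tendsto_mult tendsto_const)
  moreover have "(LINT z|lborel. complex_of_real (gauss 1 (z::'a)) * f y) = of_real (sqrt (2 * pi) ^ DIM('a)) * f y"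
    by (simp add: gauss_integral(2))
  moreover have "complex_of_real (sqrt (2 * pi) ^ DIM('a)) * (of_real (sqrt (2 * pi) ^ DIM('a)) * f y) = of_real ((2 * pi) ^ DIM('a)) * f y"
  proof -
    have "sqrt (2 * pi) ^ DIM('a) * sqrt (2 * pi) ^ DIM('a) = (2 * pi) ^ DIM('a)"
      unfolding power_mult_distrib[symmetric] by simp
    then show ?thesis unfolding mult.assoc[symmetric] of_real_mult[symmetric] by simp
  qed
  ultimately show "?I \<longlonglongrightarrow> of_real ((2 * pi) ^ DIM('a)) * f y" by (simp only:)
qed

section \<open>Square integrable functions\<close>

lemma nn_integral_limit_le:
  fixes f :: "nat \<Rightarrow> 'a \<Rightarrow> ennreal"
  assumes [measurable]: "\<And>n. f n \<in> borel_measurable M"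
    and lim: "AE x in M. (\<lambda>n. f n x) \<longlonglongrightarrow> g x"
    and le: "\<And>n. (\<integral>\<^sup>+x. f n x \<partial>M) \<le> B"
  shows "(\<integral>\<^sup>+x. g x \<partial>M) \<le> B"
proof -
  have "(\<integral>\<^sup>+x. g x \<partial>M) = (\<integral>\<^sup>+x. liminf (\<lambda>n. f n x) \<partial>M)"
    by (rule nn_integral_cong_AE) (use lim in \<open>eventually_elim, simp add: lim_imp_Liminf\<close>)
  also have "\<dots> \<le> liminf (\<lambda>n. \<integral>\<^sup>+x. f n x \<partial>M)"
    by (rule nn_integral_liminf) simp
  also have "\<dots> \<le> B"
    using le by (intro Liminf_le) (auto intro: always_eventually)
  finally show ?thesis .
qed

lemma norm_integral_le_nn_integral:
  fixes f :: "'a \<Rightarrow> 'b::{banach,second_countable_topology}"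
  shows "ennreal (norm (integral\<^sup>L M f)) \<le> (\<integral>\<^sup>+x. ennreal (norm (f x)) \<partial>M)"
  by (cases "integrable M f") (auto simp: integral_norm_bound_ennreal not_integrable_integral_eq)

lemma norm_mult_le_weighted:
  fixes a b :: complex
  assumes "k > 0"
  shows "norm (a * b) \<le> k / 2 * (norm a)\<^sup>2 + 1 / (2 * k) * (norm b)\<^sup>2"
proof -
  have "0 \<le> (sqrt k * norm a - norm b / sqrt k)\<^sup>2" by simp
  also have "\<dots> = k * (norm a)\<^sup>2 + (norm b)\<^sup>2 / k - 2 * (norm a * norm b)"
    using assms by (simp add: power2_diff power_mult_distrib power_divide)
  finally show ?thesis using assms by (simp add: norm_mult field_simps)
qed

lemma integrable_product_L2:
  fixes a b :: "'a \<Rightarrow> complex"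
  assumes [measurable]: "a \<in> borel_measurable M" "b \<in> borel_measurable M"
    and "integrable M (\<lambda>x. (norm (a x))\<^sup>2)" "integrable M (\<lambda>x. (norm (b x))\<^sup>2)"
  shows "integrable M (\<lambda>x. a x * b x)"
proof (rule Bochner_Integration.integrable_bound)
  show "integrable M (\<lambda>x. 1 / 2 * (norm (a x))\<^sup>2 + 1 / (2 * 1) * (norm (b x))\<^sup>2)"
    using assms by simp
  show "AE x in M. norm (a x * b x) \<le> norm (1 / 2 * (norm (a x))\<^sup>2 + 1 / (2 * 1) * (norm (b x))\<^sup>2)"
    using norm_mult_le_weighted[of 1] by (intro AE_I2) (smt (verit) real_norm_def)
qed measurable

text \<open>In \<open>2 |a b| \<le> k |a|^2 + |b|^2 / k\<close> the weight \<open>k = 2^j\<close> balances the error \<open>4^(-j)\<close>, and both terms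
  become multiples of \<open>2^(-j)\<close>.\<close>

lemma L2_pairing_tendsto:
  fixes a :: "nat \<Rightarrow> 'a \<Rightarrow> complex"
  assumes [measurable]: "\<And>j. a j \<in> borel_measurable M" "f \<in> borel_measurable M" "b \<in> borel_measurable M"
    and af: "\<And>j. (\<integral>\<^sup>+x. ennreal ((norm (f x - a j x))\<^sup>2) \<partial>M) \<le> ennreal (C * (1/4) ^ j)"
    and a: "\<And>j. integrable M (\<lambda>x. a j x * b x)" and f: "integrable M (\<lambda>x. f x * b x)"
    and b: "integrable M (\<lambda>x. (norm (b x))\<^sup>2)" and C: "C \<ge> 0"
  shows "(\<lambda>j. LINT x|M. a j x * b x) \<longlonglongrightarrow> (LINT x|M. f x * b x)"
proof -
  have i: "integrable M (\<lambda>x. (norm (f x - a j x))\<^sup>2)" for j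
    using af[of j] by (intro integrableI_bounded) (auto simp: le_less_trans)
  have le: "(LINT x|M. (norm (f x - a j x))\<^sup>2) \<le> C * (1/4) ^ j" for j
    using af[of j] C by (subst (asm) nn_integral_eq_integral[OF i]) (auto simp: ennreal_le_iff)
  let ?B = "LINT x|M. (norm (b x))\<^sup>2"
  have "norm ((LINT x|M. f x * b x) - (LINT x|M. a j x * b x)) \<le> (C + ?B) * (1/2) ^ j" for j
  proof -
    have "(LINT x|M. f x * b x) - (LINT x|M. a j x * b x) = (LINT x|M. (f x - a j x) * b x)"
      using a f by (simp add: left_diff_distrib)
    also have "norm \<dots> \<le> (LINT x|M. 2 ^ j / 2 * (norm (f x - a j x))\<^sup>2 + 1 / (2 * 2 ^ j) * (norm (b x))\<^sup>2)"
    proof (rule order_trans[OF integral_norm_bound integral_mono])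
      have "integrable M (\<lambda>x. (f x - a j x) * b x)" using i b by (intro integrable_product_L2) auto
      then show "integrable M (\<lambda>x. norm ((f x - a j x) * b x))" by (rule integrable_norm)
      show "integrable M (\<lambda>x. 2 ^ j / 2 * (norm (f x - a j x))\<^sup>2 + 1 / (2 * 2 ^ j) * (norm (b x))\<^sup>2)"
        using i b by simp
      show "norm ((f x - a j x) * b x) \<le> 2 ^ j / 2 * (norm (f x - a j x))\<^sup>2 + 1 / (2 * 2 ^ j) * (norm (b x))\<^sup>2" for x
        by (rule norm_mult_le_weighted) simp
    qed
    also have "\<dots> = 2 ^ j / 2 * (LINT x|M. (norm (f x - a j x))\<^sup>2) + 1 / (2 * 2 ^ j) * ?B"
      using i[of j] b by simp
    also have "\<dots> \<le> 2 ^ j / 2 * (C * (1/4) ^ j) + 1 / (2 * 2 ^ j) * ?B"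
      using le by (intro add_right_mono mult_left_mono) auto
    also have "\<dots> = 1/2 * ((C + ?B) * (1/2) ^ j)"
    proof -
      have e1: "(2::real) ^ j * (1/4) ^ j = (1/2) ^ j" by (simp flip: power_mult_distrib)
      have e2: "1 / (2 * (2::real) ^ j) = 1/2 * (1/2) ^ j" by (simp add: power_divide)
      have "2 ^ j / 2 * (C * (1/4) ^ j) + 1 / (2 * 2 ^ j) * ?B = 1/2 * (C * (2 ^ j * (1/4) ^ j)) + 1 / (2 * 2 ^ j) * ?B"
        by simp
      also have "\<dots> = 1/2 * ((C + ?B) * (1/2) ^ j)"
        unfolding e1 e2 distrib_left distrib_right by (simp only: mult.assoc mult.left_commute mult.commute)
      finally show ?thesis .
    qed
    also have "\<dots> \<le> (C + ?B) * (1/2) ^ j" using C by simp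
    finally show ?thesis .
  qed
  then have le': "\<forall>j. norm ((LINT x|M. f x * b x) - (LINT x|M. a j x * b x)) \<le> (C + ?B) * (1/2) ^ j" ..
  have null: "(\<lambda>j. (C + ?B) * (1/2::real) ^ j) \<longlonglongrightarrow> 0"
    by (intro tendsto_mult_right_zero LIMSEQ_power_zero) simp
  have "(\<lambda>j. (LINT x|M. f x * b x) - (LINT x|M. a j x * b x)) \<longlonglongrightarrow> 0"
    by (rule Lim_null_comparison[OF always_eventually[OF le'] null])
  from tendsto_diff[OF tendsto_const[of "LINT x|M. f x * b x"] this] show ?thesis by simp
qed

text \<open>The Riesz-Fischer theorem for a sequence with geometric rate: the weighted sum of the squared increments
  has a finite integral, so it is finite almost everywhere, and then so is the sum of the increments.
  Fatou's lemma gives the rate for the limit.\<close>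

lemma L2_fast_cauchy_limit:
  fixes f :: "nat \<Rightarrow> 'a \<Rightarrow> complex"
  assumes [measurable]: "\<And>j. f j \<in> borel_measurable M"
    and cauchy: "\<And>i j. j \<le> i \<Longrightarrow> (\<integral>\<^sup>+x. ennreal ((norm (f i x - f j x))\<^sup>2) \<partial>M) \<le> ennreal (C * (1/4) ^ j)"
    and C: "C \<ge> 0"
  obtains g where "g \<in> borel_measurable M" "AE x in M. (\<lambda>j. f j x) \<longlonglongrightarrow> g x"
    "\<And>j. (\<integral>\<^sup>+x. ennreal ((norm (g x - f j x))\<^sup>2) \<partial>M) \<le> ennreal (C * (1/4) ^ j)"
proof
  define g where "g x = lim (\<lambda>j. f j x)" for x
  show g[measurable]: "g \<in> borel_measurable M" unfolding g_def by measurable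
  define d where "d j x = f (Suc j) x - f j x" for j x
  have [measurable]: "d j \<in> borel_measurable M" for j unfolding d_def by measurable
  have "(\<integral>\<^sup>+x. (\<Sum>j. ennreal (2 ^ j * (norm (d j x))\<^sup>2)) \<partial>M) = (\<Sum>j. \<integral>\<^sup>+x. ennreal (2 ^ j * (norm (d j x))\<^sup>2) \<partial>M)"
    by (rule nn_integral_suminf) measurable
  also have "\<dots> \<le> (\<Sum>j. ennreal (C * (1/2) ^ j))"
  proof (rule suminf_le)
    fix j
    have "(\<integral>\<^sup>+x. ennreal (2 ^ j * (norm (d j x))\<^sup>2) \<partial>M) = ennreal (2 ^ j) * (\<integral>\<^sup>+x. ennreal ((norm (d j x))\<^sup>2) \<partial>M)"
      by (simp add: ennreal_mult nn_integral_cmult)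
    also have "\<dots> \<le> ennreal (2 ^ j) * ennreal (C * (1/4) ^ j)"
      unfolding d_def by (intro mult_left_mono cauchy) auto
    also have "\<dots> = ennreal (C * (2 ^ j * (1/4) ^ j))"
      using C by (simp add: ennreal_mult'[symmetric] mult_ac)
    also have "(2::real) ^ j * (1/4) ^ j = (1/2) ^ j" by (simp flip: power_mult_distrib)
    finally show "(\<integral>\<^sup>+x. ennreal (2 ^ j * (norm (d j x))\<^sup>2) \<partial>M) \<le> ennreal (C * (1/2) ^ j)" .
  qed auto
  also have "\<dots> = ennreal (\<Sum>j. C * (1/2) ^ j)"
    using C by (intro suminf_ennreal2) auto
  also have "\<dots> < \<infinity>" by simp
  finally have "AE x in M. (\<Sum>j. ennreal (2 ^ j * (norm (d j x))\<^sup>2)) \<noteq> \<infinity>"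
    by (intro nn_integral_noteq_infinite) auto
  then show lim: "AE x in M. (\<lambda>j. f j x) \<longlonglongrightarrow> g x"
  proof eventually_elim
    case (elim x)
    then have s: "summable (\<lambda>j. 2 ^ j * (norm (d j x))\<^sup>2)"
      by (intro summable_suminf_not_top) auto
    have "summable (\<lambda>j. norm (d j x))"
    proof (rule summable_comparison_test)
      show "summable (\<lambda>j. 1/2 * (2 ^ j * (norm (d j x))\<^sup>2) + 1/2 * (1/2) ^ j)"
        using s by (intro summable_add summable_mult) auto
      have "norm (d j x) \<le> 1/2 * (2 ^ j * (norm (d j x))\<^sup>2) + 1/2 * (1/2) ^ j" for j
        using norm_mult_le_weighted[of "2 ^ j" "d j x" 1] by (simp add: power_divide)
      then show "\<exists>N. \<forall>n\<ge>N. norm (norm (d n x)) \<le> 1/2 * (2 ^ n * (norm (d n x))\<^sup>2) + 1/2 * (1/2) ^ n"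
        by auto
    qed
    then have "summable (\<lambda>j. d j x)" by (rule summable_norm_cancel)
    then have "convergent (\<lambda>n. \<Sum>j<n. d j x)" by (simp add: summable_iff_convergent)
    moreover have "(\<Sum>j<n. d j x) = f n x - f 0 x" for n
      unfolding d_def by (rule sum_lessThan_telescope)
    ultimately have "convergent (\<lambda>n. f n x - f 0 x)" by simp
    then have "convergent (\<lambda>n. f n x - f 0 x + f 0 x)" by (intro convergent_add convergent_const)
    then show ?case unfolding g_def by (simp add: convergent_LIMSEQ_iff)
  qed
  show "(\<integral>\<^sup>+x. ennreal ((norm (g x - f j x))\<^sup>2) \<partial>M) \<le> ennreal (C * (1/4) ^ j)" for j
  proof (rule nn_integral_limit_le)
    show "AE x in M. (\<lambda>i. ennreal ((norm (f (i + j) x - f j x))\<^sup>2)) \<longlonglongrightarrow> ennreal ((norm (g x - f j x))\<^sup>2)"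
      using lim
    proof eventually_elim
      case (elim x)
      from LIMSEQ_ignore_initial_segment[OF this, of j] show ?case
        by (intro tendsto_ennrealI tendsto_power tendsto_norm tendsto_diff tendsto_const)
    qed
    show "(\<integral>\<^sup>+x. ennreal ((norm (f (i + j) x - f j x))\<^sup>2) \<partial>M) \<le> ennreal (C * (1/4) ^ j)" for i
      by (rule cauchy) simp
  qed measurable
qed

section \<open>The inverse Fourier transform of a square integrable function\<close>

text \<open>With a Gaussian weight, \<open>|FT g|^2\<close> integrates to a double integral of \<open>g(\<xi>)\<close>, \<open>cnj (g(\<eta>))\<close> and a positive
  kernel \<open>\<kappa> (\<xi> - \<eta>)\<close> of total mass \<open>(2 \<pi>)^n\<close>.  Estimating the product by
  \<open>(|g(\<xi>)|^2 + |g(\<eta>)|^2) / 2\<close> gives the bound, uniformly in the weight, which is then removed by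
  Fatou's lemma.\<close>

theorem FT_L2_bound:
  fixes g :: "'a::euclidean_space \<Rightarrow> complex"
  assumes g: "integrable lborel g" and g2: "integrable lborel (\<lambda>x. (norm (g x))\<^sup>2)"
  shows "(\<integral>\<^sup>+x. ennreal ((norm (FT 1 g x))\<^sup>2) \<partial>lborel) \<le> ennreal ((2 * pi) ^ DIM('a) * (LINT x|lborel. (norm (g x))\<^sup>2))"
    (is "_ \<le> ?B")
proof -
  have [measurable]: "g \<in> borel_measurable borel" using borel_measurable_integrable[OF g] by simp
  have weighted: "(\<integral>\<^sup>+x. ennreal (gauss \<delta> x * (norm (FT 1 g x))\<^sup>2) \<partial>lborel) \<le> ?B" if \<delta>: "\<delta> > 0" for \<delta>
  proof -
    define \<kappa> where "\<kappa> z = (sqrt (2 * pi) / \<delta>) ^ DIM('a) * gauss (1 / \<delta>) z" for z :: 'a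
    have [measurable]: "\<kappa> \<in> borel_measurable borel" unfolding \<kappa>_def by measurable
    have \<kappa>_nonneg: "\<kappa> z \<ge> 0" for z
      unfolding \<kappa>_def using \<delta> by (intro mult_nonneg_nonneg zero_le_power gauss_nonneg) simp
    have \<kappa>_int: "(\<integral>\<^sup>+y. ennreal (\<kappa> (x - y)) \<partial>lborel) = ennreal ((2 * pi) ^ DIM('a))" for x
    proof -
      have e: "\<kappa> (x - y) = \<kappa> (- x + y)" for y by (simp add: \<kappa>_def gauss_def norm_minus_commute)
      have i: "integrable lborel \<kappa>" unfolding \<kappa>_def using \<delta> by (intro integrable_mult_right gauss_integral) auto
      have "(\<integral>\<^sup>+y. ennreal (\<kappa> (x - y)) \<partial>lborel) = ennreal (LINT y|lborel. \<kappa> (- x + y))"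
        unfolding e using i \<kappa>_nonneg by (intro nn_integral_eq_integral iffD2[OF lborel_shift(2)]) auto
      also have "(LINT y|lborel. \<kappa> (- x + y)) = (LINT y|lborel. \<kappa> y)" by (rule lborel_shift) measurable
      also have "\<dots> = (sqrt (2 * pi) / \<delta>) ^ DIM('a) * (sqrt (2 * pi) / (1 / \<delta>)) ^ DIM('a)"
        unfolding \<kappa>_def using \<delta> by (subst integral_mult_right_zero) (simp add: gauss_integral)
      also have "\<dots> = (2 * pi) ^ DIM('a)"
        unfolding power_mult_distrib[symmetric] using \<delta> by simp
      finally show ?thesis .
    qed
    let ?c = "\<lambda>x. cnj (g x)"
    have c: "integrable lborel ?c" using g by simp
    from borel_measurable_integrable[OF this] have "?c \<in> borel_measurable borel" by simp
    then have [measurable]: "FT (- 1) ?c \<in> borel_measurable borel" by (rule FT_measurable)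
    have cnj_FT: "cnj (FT 1 g x) = FT (- 1) ?c x" for x
      unfolding FT_def by (subst Bochner_Integration.integral_cnj[symmetric]) (simp add: cis_cnj)
    let ?h = "\<lambda>x. of_real (gauss \<delta> x) * FT (- 1) ?c x"
    have h: "integrable lborel ?h"
    proof (rule Bochner_Integration.integrable_bound)
      show "integrable lborel (\<lambda>x::'a. gauss \<delta> x * (LINT x|lborel. norm (?c x)))"
        by (intro integrable_mult_left gauss_integral \<delta>)
      show "AE x in lborel. norm (?h x) \<le> norm (gauss \<delta> x * (LINT x|lborel. norm (?c x)))"
        using FT_norm_le[of "- 1" ?c] gauss_nonneg
        by (intro AE_I2) (auto simp: norm_mult abs_mult intro!: mult_left_mono order_trans[OF _ abs_ge_self])
    qed measurable
    have FTh: "FT 1 ?h \<xi> = (LINT \<eta>|lborel. of_real (\<kappa> (\<xi> - \<eta>)) * ?c \<eta>)" for \<xi>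
    proof -
      let ?k = "\<lambda>x. cis (1 * (x \<bullet> \<xi>)) * complex_of_real (gauss \<delta> x)"
      have k: "integrable lborel ?k" using gauss_FT(1)[OF \<delta>, of \<xi>] by (simp add: inner_commute)
      have FTk: "FT (- 1) ?k \<eta> = of_real (\<kappa> (\<xi> - \<eta>))" for \<eta>
        unfolding \<kappa>_def gauss_FT(2)[OF \<delta>, symmetric] FT_def mult.assoc[symmetric]
        by (simp add: cis_mult inner_diff_left inner_diff_right inner_commute)
      have "FT 1 ?h \<xi> = (LINT x|lborel. ?k x * FT (- 1) ?c x)"
        unfolding FT_def[of 1] by (simp add: mult.assoc)
      also have "\<dots> = (LINT \<eta>|lborel. of_real (\<kappa> (\<xi> - \<eta>)) * ?c \<eta>)"
        unfolding FT_multiplication_formula[OF k c] FTk ..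
      finally show ?thesis .
    qed
    have int: "integrable lborel (\<lambda>x. gauss \<delta> x * (norm (FT 1 g x))\<^sup>2)"
      and eq: "complex_of_real (LINT x|lborel. gauss \<delta> x * (norm (FT 1 g x))\<^sup>2) = (LINT x|lborel. ?h x * FT 1 g x)"
    proof -
      have e: "?h x * FT 1 g x = complex_of_real (gauss \<delta> x * (norm (FT 1 g x))\<^sup>2)" for x
        unfolding cnj_FT[symmetric] of_real_mult complex_norm_square by (simp add: mult_ac)
      show "complex_of_real (LINT x|lborel. gauss \<delta> x * (norm (FT 1 g x))\<^sup>2) = (LINT x|lborel. ?h x * FT 1 g x)"
        unfolding e by (rule integral_complex_of_real[symmetric])
      show "integrable lborel (\<lambda>x. gauss \<delta> x * (norm (FT 1 g x))\<^sup>2)"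
      proof (rule Bochner_Integration.integrable_bound)
        show "integrable lborel (\<lambda>x::'a. gauss \<delta> x * (LINT x|lborel. norm (g x))\<^sup>2)"
          by (intro integrable_mult_left gauss_integral \<delta>)
        show "AE x in lborel. norm (gauss \<delta> x * (norm (FT 1 g x))\<^sup>2) \<le> norm (gauss \<delta> x * (LINT x|lborel. norm (g x))\<^sup>2)"
          using FT_norm_le[of 1 g] gauss_nonneg
          by (intro AE_I2) (auto simp: abs_mult intro!: mult_left_mono power_mono)
      qed measurable
    qed
    have "(\<integral>\<^sup>+x. ennreal (gauss \<delta> x * (norm (FT 1 g x))\<^sup>2) \<partial>lborel) = ennreal (LINT x|lborel. gauss \<delta> x * (norm (FT 1 g x))\<^sup>2)"
      using int by (intro nn_integral_eq_integral) (auto simp: gauss_nonneg)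
    also have "\<dots> \<le> ennreal (norm (LINT x|lborel. ?h x * FT 1 g x))"
      unfolding eq[symmetric] by (intro ennreal_leI) simp
    also have "(LINT x|lborel. ?h x * FT 1 g x) = (LINT \<xi>|lborel. FT 1 ?h \<xi> * g \<xi>)"
      by (rule FT_multiplication_formula[OF h g])
    also have "ennreal (norm \<dots>) \<le> (\<integral>\<^sup>+\<xi>. ennreal (norm (FT 1 ?h \<xi> * g \<xi>)) \<partial>lborel)"
      by (rule norm_integral_le_nn_integral)
    also have "\<dots> \<le> (\<integral>\<^sup>+\<xi>. (\<integral>\<^sup>+\<eta>. ennreal (1/2 * (\<kappa> (\<xi> - \<eta>) * (norm (g \<eta>))\<^sup>2)) + ennreal (1/2 * (\<kappa> (\<xi> - \<eta>) * (norm (g \<xi>))\<^sup>2)) \<partial>lborel) \<partial>lborel)"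
    proof (rule nn_integral_mono)
      fix \<xi> :: 'a
      have "FT 1 ?h \<xi> * g \<xi> = (LINT \<eta>|lborel. of_real (\<kappa> (\<xi> - \<eta>)) * ?c \<eta> * g \<xi>)"
        unfolding FTh by (rule integral_mult_left_zero[symmetric])
      then have "ennreal (norm (FT 1 ?h \<xi> * g \<xi>)) \<le> (\<integral>\<^sup>+\<eta>. ennreal (norm (of_real (\<kappa> (\<xi> - \<eta>)) * ?c \<eta> * g \<xi>)) \<partial>lborel)"
        by (simp only:) (rule norm_integral_le_nn_integral)
      also have "\<dots> \<le> (\<integral>\<^sup>+\<eta>. ennreal (1/2 * (\<kappa> (\<xi> - \<eta>) * (norm (g \<eta>))\<^sup>2)) + ennreal (1/2 * (\<kappa> (\<xi> - \<eta>) * (norm (g \<xi>))\<^sup>2)) \<partial>lborel)"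
      proof (rule nn_integral_mono)
        fix \<eta> :: 'a
        have "norm (of_real (\<kappa> (\<xi> - \<eta>)) * ?c \<eta> * g \<xi>) = \<kappa> (\<xi> - \<eta>) * norm (?c \<eta> * g \<xi>)"
          using \<kappa>_nonneg by (simp add: norm_mult)
        also have "\<dots> \<le> \<kappa> (\<xi> - \<eta>) * (1 / 2 * (norm (?c \<eta>))\<^sup>2 + 1 / (2 * 1) * (norm (g \<xi>))\<^sup>2)"
          by (intro mult_left_mono norm_mult_le_weighted \<kappa>_nonneg) simp
        also have "\<dots> = 1/2 * (\<kappa> (\<xi> - \<eta>) * (norm (g \<eta>))\<^sup>2) + 1/2 * (\<kappa> (\<xi> - \<eta>) * (norm (g \<xi>))\<^sup>2)"
          by (simp add: algebra_simps)
        finally have le: "norm (of_real (\<kappa> (\<xi> - \<eta>)) * ?c \<eta> * g \<xi>) \<le>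
            1/2 * (\<kappa> (\<xi> - \<eta>) * (norm (g \<eta>))\<^sup>2) + 1/2 * (\<kappa> (\<xi> - \<eta>) * (norm (g \<xi>))\<^sup>2)" .
        have "0 \<le> 1/2 * (\<kappa> (\<xi> - \<eta>) * (norm (g \<eta>))\<^sup>2)" "0 \<le> 1/2 * (\<kappa> (\<xi> - \<eta>) * (norm (g \<xi>))\<^sup>2)"
          using \<kappa>_nonneg by auto
        from ennreal_plus[OF this] ennreal_leI[OF le]
        show "ennreal (norm (of_real (\<kappa> (\<xi> - \<eta>)) * ?c \<eta> * g \<xi>)) \<le>
            ennreal (1/2 * (\<kappa> (\<xi> - \<eta>) * (norm (g \<eta>))\<^sup>2)) + ennreal (1/2 * (\<kappa> (\<xi> - \<eta>) * (norm (g \<xi>))\<^sup>2))"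
          by (simp only:)
      qed
      finally show "ennreal (norm (FT 1 ?h \<xi> * g \<xi>)) \<le> \<dots>" .
    qed
    also have "\<dots> = (\<integral>\<^sup>+\<xi>. (\<integral>\<^sup>+\<eta>. ennreal (1/2 * (\<kappa> (\<xi> - \<eta>) * (norm (g \<eta>))\<^sup>2)) \<partial>lborel) \<partial>lborel) +
        (\<integral>\<^sup>+\<xi>. (\<integral>\<^sup>+\<eta>. ennreal (1/2 * (\<kappa> (\<xi> - \<eta>) * (norm (g \<xi>))\<^sup>2)) \<partial>lborel) \<partial>lborel)"
      by (simp add: nn_integral_add)
    also have "(\<integral>\<^sup>+\<xi>. (\<integral>\<^sup>+\<eta>. ennreal (1/2 * (\<kappa> (\<xi> - \<eta>) * (norm (g \<eta>))\<^sup>2)) \<partial>lborel) \<partial>lborel) =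
        (\<integral>\<^sup>+\<xi>. (\<integral>\<^sup>+\<eta>. ennreal (1/2 * (\<kappa> (\<xi> - \<eta>) * (norm (g \<xi>))\<^sup>2)) \<partial>lborel) \<partial>lborel)"
      by (subst lborel_pair.Fubini') (auto simp: \<kappa>_def gauss_def norm_minus_commute)
    also have "(\<integral>\<^sup>+\<xi>. (\<integral>\<^sup>+\<eta>. ennreal (1/2 * (\<kappa> (\<xi> - \<eta>) * (norm (g \<xi>))\<^sup>2)) \<partial>lborel) \<partial>lborel)
        = ennreal (1/2 * ((2 * pi) ^ DIM('a) * (LINT x|lborel. (norm (g x))\<^sup>2)))"
    proof -
      have "(\<integral>\<^sup>+\<eta>. ennreal (1/2 * (\<kappa> (\<xi> - \<eta>) * (norm (g \<xi>))\<^sup>2)) \<partial>lborel) = ennreal (1/2 * (2 * pi) ^ DIM('a) * (norm (g \<xi>))\<^sup>2)" for \<xi>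
      proof -
        have "(\<integral>\<^sup>+\<eta>. ennreal (1/2 * (\<kappa> (\<xi> - \<eta>) * (norm (g \<xi>))\<^sup>2)) \<partial>lborel) = (\<integral>\<^sup>+\<eta>. ennreal (1/2 * (norm (g \<xi>))\<^sup>2) * ennreal (\<kappa> (\<xi> - \<eta>)) \<partial>lborel)"
          using \<kappa>_nonneg by (intro nn_integral_cong) (simp add: ennreal_mult[symmetric] mult_ac)
        also have "\<dots> = ennreal (1/2 * (norm (g \<xi>))\<^sup>2) * ennreal ((2 * pi) ^ DIM('a))"
          by (subst nn_integral_cmult) (auto simp: \<kappa>_int)
        finally show ?thesis by (simp add: ennreal_mult[symmetric] mult_ac)
      qed
      then have "(\<integral>\<^sup>+\<xi>. (\<integral>\<^sup>+\<eta>. ennreal (1/2 * (\<kappa> (\<xi> - \<eta>) * (norm (g \<xi>))\<^sup>2)) \<partial>lborel) \<partial>lborel) =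
          (\<integral>\<^sup>+\<xi>. ennreal (1/2 * (2 * pi) ^ DIM('a) * (norm (g \<xi>))\<^sup>2) \<partial>lborel)" by simp
      also have "\<dots> = ennreal (LINT \<xi>|lborel. 1/2 * (2 * pi) ^ DIM('a) * (norm (g \<xi>))\<^sup>2)"
        using g2 by (intro nn_integral_eq_integral) auto
      finally show ?thesis by simp
    qed
    also have "ennreal (1/2 * ((2 * pi) ^ DIM('a) * (LINT x|lborel. (norm (g x))\<^sup>2))) + ennreal (1/2 * ((2 * pi) ^ DIM('a) * (LINT x|lborel. (norm (g x))\<^sup>2))) = ?B"
      by (subst ennreal_plus[symmetric]) auto
    finally show ?thesis .
  qed
  show ?thesis
  proof (rule nn_integral_limit_le)
    show "(\<integral>\<^sup>+x. ennreal (gauss (inverse (real (Suc n))) x * (norm (FT 1 g x))\<^sup>2) \<partial>lborel) \<le> ?B" for n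
      by (rule weighted) simp
    show "AE x in lborel. (\<lambda>n. ennreal (gauss (inverse (real (Suc n))) x * (norm (FT 1 g x))\<^sup>2)) \<longlonglongrightarrow> ennreal ((norm (FT 1 g x))\<^sup>2)"
    proof (intro AE_I2 tendsto_ennrealI)
      fix x :: 'a
      have "(\<lambda>n. gauss (inverse (real (Suc n))) x) \<longlonglongrightarrow> exp (- (0 * norm x)\<^sup>2 / 2)"
        unfolding gauss_def by (intro tendsto_intros LIMSEQ_inverse_real_of_nat) auto
      from tendsto_mult[OF this tendsto_const]
      show "(\<lambda>n. gauss (inverse (real (Suc n))) x * (norm (FT 1 g x))\<^sup>2) \<longlonglongrightarrow> (norm (FT 1 g x))\<^sup>2"
        by simp
    qed
  qed measurable
qed

lemma schwartz_square_integrable: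
  fixes \<psi> :: "'a::euclidean_space \<Rightarrow> complex"
  assumes \<psi>: "\<psi> \<in> schwartz_space"
  shows "integrable lborel (\<lambda>x. (norm (\<psi> x))\<^sup>2)"
proof -
  obtain C where C: "\<And>x. norm (\<psi> x) \<le> C"
    using schwartz_rapidly_decreasing[OF \<psi>] unfolding rapidly_decreasing_def by (metis mult_1 power_0)
  show ?thesis
  proof (rule Bochner_Integration.integrable_bound)
    show "integrable lborel (\<lambda>x. C * norm (\<psi> x))"
      by (intro integrable_mult_right integrable_norm schwartz_integrable \<psi>)
    show "AE x in lborel. norm ((norm (\<psi> x))\<^sup>2) \<le> norm (C * norm (\<psi> x))"
    proof (rule AE_I2)
      fix x
      have "norm (\<psi> x) * norm (\<psi> x) \<le> C * norm (\<psi> x)" using C by (intro mult_right_mono) auto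
      also have "\<dots> \<le> \<bar>C * norm (\<psi> x)\<bar>" by simp
      finally show "norm ((norm (\<psi> x))\<^sup>2) \<le> norm (C * norm (\<psi> x))" by (simp add: power2_eq_square)
    qed
  qed (use schwartz_measurable[OF \<psi>] in simp)
qed

lemma norm_diff_square_le:
  fixes a b c :: complex
  shows "(norm (a - b))\<^sup>2 \<le> 2 * (norm (c - a))\<^sup>2 + 2 * (norm (c - b))\<^sup>2"
proof -
  have "norm (a - b) \<le> norm (c - a) + norm (c - b)"
    using norm_triangle_ineq4[of "c - b" "c - a"] by simp
  then have "(norm (a - b))\<^sup>2 \<le> (norm (c - a) + norm (c - b))\<^sup>2" by (intro power_mono) auto
  also have "\<dots> \<le> 2 * (norm (c - a))\<^sup>2 + 2 * (norm (c - b))\<^sup>2"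
    using sum_squares_bound[of "norm (c - a)" "norm (c - b)"] by (simp add: power2_sum)
  finally show ?thesis .
qed

text \<open>The normalising constant of \<open>fourier\<close>.\<close>

definition unitary_const :: "'a::euclidean_space itself \<Rightarrow> real" where
  "unitary_const _ = (2 * pi) powr (- real DIM('a) / 2)"

lemma unitary_const_pos: "unitary_const TYPE('a::euclidean_space) > 0"
  by (simp add: unitary_const_def)

lemma unitary_const_square: "(unitary_const TYPE('a::euclidean_space))\<^sup>2 * (2 * pi) ^ DIM('a) = 1"
proof -
  have "(unitary_const TYPE('a))\<^sup>2 = (2 * pi) powr (- real DIM('a))"
    unfolding unitary_const_def power2_eq_square by (simp flip: powr_add)
  moreover have "(2 * pi) ^ DIM('a) = (2 * pi) powr real DIM('a)" by (simp add: powr_realpow)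
  ultimately show ?thesis by (simp flip: powr_add)
qed

text \<open>Cutting off to balls makes \<open>D\<close> integrable, so that its Fourier integral converges.\<close>

lemma square_integrable_truncation:
  fixes D :: "'a::euclidean_space \<Rightarrow> complex"
  assumes [measurable]: "D \<in> borel_measurable borel" and D2: "integrable lborel (\<lambda>x. (norm (D x))\<^sup>2)"
    and \<epsilon>: "\<epsilon> > 0"
  obtains E where "E \<in> borel_measurable borel" "integrable lborel E"
    "\<And>x. norm (E x) \<le> norm (D x)" "\<And>x. norm (D x - E x) \<le> norm (D x)"
    "(LINT x|lborel. (norm (D x - E x))\<^sup>2) \<le> \<epsilon>"
proof -
  define E where "E k x = (if norm x \<le> real k then D x else 0)" for k :: nat and x
  have [measurable]: "E k \<in> borel_measurable borel" for k unfolding E_def by measurable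
  have E1: "norm (E k x) \<le> norm (D x)" "norm (D x - E k x) \<le> norm (D x)" for k x by (auto simp: E_def)
  have "integrable lborel (E k)" for k
  proof (rule Bochner_Integration.integrable_bound)
    show "integrable lborel (\<lambda>x. indicator (cball 0 (real k)) x + (norm (D x))\<^sup>2)"
      using D2 emeasure_bounded_finite[OF bounded_cball[of "0::'a" "real k"]]
      by (intro Bochner_Integration.integrable_add integrable_real_indicator) auto
    show "AE x in lborel. norm (E k x) \<le> norm (indicator (cball 0 (real k)) x + (norm (D x))\<^sup>2)"
    proof (rule AE_I2)
      fix x
      have "0 \<le> (norm (D x) - 1)\<^sup>2 + (norm (D x))\<^sup>2" by simp
      then have "norm (D x) \<le> 1 + (norm (D x))\<^sup>2" by (simp add: power2_diff)
      then show "norm (E k x) \<le> norm (indicator (cball 0 (real k)) x + (norm (D x))\<^sup>2)"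
        by (simp add: E_def)
    qed
  qed simp
  moreover have "(\<lambda>k. LINT x|lborel. (norm (D x - E k x))\<^sup>2) \<longlonglongrightarrow> (LINT x::'a|lborel. 0)"
  proof (rule integral_dominated_convergence[OF _ _ D2])
    show "AE x in lborel. (\<lambda>k. (norm (D x - E k x))\<^sup>2) \<longlonglongrightarrow> 0"
    proof (rule AE_I2)
      fix x :: 'a
      have "eventually (\<lambda>k. norm x \<le> real k) sequentially" 
        by (rule eventually_compose_filterlim[OF eventually_ge_at_top filterlim_real_sequentially])
      then have "eventually (\<lambda>k. (norm (D x - E k x))\<^sup>2 = 0) sequentially"
        by eventually_elim (simp add: E_def)
      then show "(\<lambda>k. (norm (D x - E k x))\<^sup>2) \<longlonglongrightarrow> 0" by (rule tendsto_eventually)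
    qed
    show "AE x in lborel. norm ((norm (D x - E k x))\<^sup>2) \<le> (norm (D x))\<^sup>2" for k
      using E1 by (auto intro!: power_mono)
  qed measurable
  then have "eventually (\<lambda>k. (LINT x|lborel. (norm (D x - E k x))\<^sup>2) < \<epsilon>) sequentially"
    by (rule order_tendstoD) (use \<epsilon> in simp)
  then obtain k where "(LINT x|lborel. (norm (D x - E k x))\<^sup>2) < \<epsilon>"
    by (auto dest: eventually_happens)
  ultimately show ?thesis using E1 by (intro that[of "E k"]) auto
qed

text \<open>Transform the truncations of \<open>D\<close> to balls.  By the \<open>L^2\<close> bound the transforms form a Cauchy sequence, whose
  limit pairs with Schwartz functions as the inverse transform of \<open>D\<close> should.\<close>

theorem square_integrable_inverse_FT:
  fixes D :: "'a::euclidean_space \<Rightarrow> complex"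
  assumes [measurable]: "D \<in> borel_measurable borel" and D2: "integrable lborel (\<lambda>x. (norm (D x))\<^sup>2)"
  obtains f where "f \<in> borel_measurable borel" "integrable lborel (\<lambda>x. (norm (f x))\<^sup>2)"
    "(LINT x|lborel. (norm (f x))\<^sup>2) \<le> (LINT x|lborel. (norm (D x))\<^sup>2)"
    "\<And>\<psi>. \<psi> \<in> schwartz_space \<Longrightarrow>
      (LINT x|lborel. f x * \<psi> x) = of_real (unitary_const TYPE('a)) * (LINT x|lborel. D x * FT 1 \<psi> x)"
proof -
  define c where "c = unitary_const TYPE('a)"
  \<comment> \<open>The errors \<open>4^(-j)\<close> give the transforms the geometric rate that makes them converge
    almost everywhere.\<close>
  define approx where "approx j E \<longleftrightarrow> E \<in> borel_measurable borel \<and> integrable lborel E \<and>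
      (\<forall>x. norm (E x) \<le> norm (D x)) \<and> (\<forall>x. norm (D x - E x) \<le> norm (D x)) \<and>
      (LINT x|lborel. (norm (D x - E x))\<^sup>2) \<le> (1/4) ^ j" for j :: nat and E
  have "\<exists>E. approx j E" for j
  proof -
    have "(1/4::real) ^ j > 0" by simp
    then show ?thesis
    proof (rule square_integrable_truncation[OF assms])
      fix E assume "E \<in> borel_measurable borel" "integrable lborel E" "\<And>x. norm (E x) \<le> norm (D x)"
        "\<And>x. norm (D x - E x) \<le> norm (D x)" "(LINT x|lborel. (norm (D x - E x))\<^sup>2) \<le> (1/4) ^ j"
      then have "approx j E" by (simp add: approx_def)
      then show ?thesis by (rule exI[of _ E])
    qed
  qed
  then have "\<exists>E. \<forall>j. approx j (E j)" by (intro choice allI)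
  then obtain E where "\<And>j. approx j (E j)" by blast
  then have E_meas[measurable]: "\<And>j. E j \<in> borel_measurable borel" and E_int: "\<And>j. integrable lborel (E j)"
    and E_le: "\<And>j x. norm (E j x) \<le> norm (D x)" and DE_le: "\<And>j x. norm (D x - E j x) \<le> norm (D x)"
    and T: "\<And>j::nat. (LINT x|lborel. (norm (D x - E j x))\<^sup>2) \<le> (1/4) ^ j"
    unfolding approx_def by auto
  have sq: "integrable lborel (\<lambda>x. (norm (h x))\<^sup>2)" if [measurable]: "h \<in> borel_measurable borel" and "\<And>x. norm (h x) \<le> norm (D x)" for h :: "'a \<Rightarrow> complex"
    by (rule Bochner_Integration.integrable_bound[OF D2]) (use that in \<open>auto intro!: power_mono AE_I2\<close>)
  have E2: "integrable lborel (\<lambda>x. (norm (E j x))\<^sup>2)" and DE2: "integrable lborel (\<lambda>x. (norm (D x - E j x))\<^sup>2)" for j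
    using E_le DE_le by (intro sq; simp)+
  define f where "f j x = of_real c * FT 1 (E j) x" for j x
  have f_meas[measurable]: "f j \<in> borel_measurable borel" for j unfolding f_def by measurable
  have bound: "(\<integral>\<^sup>+x. ennreal ((norm (of_real c * FT 1 h x))\<^sup>2) \<partial>lborel) \<le> ennreal (LINT x|lborel. (norm (h x))\<^sup>2)"
    if h: "integrable lborel h" "integrable lborel (\<lambda>x. (norm (h x))\<^sup>2)" for h :: "'a \<Rightarrow> complex"
  proof -
    have [measurable]: "h \<in> borel_measurable borel" using borel_measurable_integrable[OF h(1)] by simp
    have "(\<integral>\<^sup>+x. ennreal ((norm (of_real c * FT 1 h x))\<^sup>2) \<partial>lborel) = (\<integral>\<^sup>+x. ennreal (c\<^sup>2) * ennreal ((norm (FT 1 h x))\<^sup>2) \<partial>lborel)"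
      by (simp add: norm_mult power_mult_distrib ennreal_mult)
    also have "\<dots> = ennreal (c\<^sup>2) * (\<integral>\<^sup>+x. ennreal ((norm (FT 1 h x))\<^sup>2) \<partial>lborel)"
      by (rule nn_integral_cmult) measurable
    also have "\<dots> \<le> ennreal (c\<^sup>2) * ennreal ((2 * pi) ^ DIM('a) * (LINT x|lborel. (norm (h x))\<^sup>2))"
      by (intro mult_left_mono FT_L2_bound h) simp
    also have "\<dots> = ennreal ((c\<^sup>2 * (2 * pi) ^ DIM('a)) * (LINT x|lborel. (norm (h x))\<^sup>2))"
      by (simp add: ennreal_mult[symmetric] mult.assoc)
    finally show ?thesis unfolding c_def unitary_const_square mult_1 .
  qed
  have cauchy: "(\<integral>\<^sup>+x. ennreal ((norm (f i x - f j x))\<^sup>2) \<partial>lborel) \<le> ennreal (4 * (1/4) ^ j)" if "j \<le> i" for i j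
  proof -
    have e: "f i x - f j x = of_real c * FT 1 (\<lambda>x. E i x - E j x) x" for x
      unfolding f_def FT_def 
      using integrable_cis_mult[OF E_int[of i], of 1 x] integrable_cis_mult[OF E_int[of j], of 1 x]
      by (simp add: right_diff_distrib)
    have i2: "integrable lborel (\<lambda>x. 2 * (norm (D x - E i x))\<^sup>2 + 2 * (norm (D x - E j x))\<^sup>2)"
      using DE2 by simp
    have d2: "integrable lborel (\<lambda>x. (norm (E i x - E j x))\<^sup>2)"
    proof (rule Bochner_Integration.integrable_bound[OF i2])
      show "AE x in lborel. norm ((norm (E i x - E j x))\<^sup>2) \<le> norm (2 * (norm (D x - E i x))\<^sup>2 + 2 * (norm (D x - E j x))\<^sup>2)"
        using norm_diff_square_le by (intro AE_I2) simp
    qed measurable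
    have "(\<integral>\<^sup>+x. ennreal ((norm (f i x - f j x))\<^sup>2) \<partial>lborel) \<le> ennreal (LINT x|lborel. (norm (E i x - E j x))\<^sup>2)"
      unfolding e by (rule bound) (use E_int d2 in auto)
    also have "(LINT x|lborel. (norm (E i x - E j x))\<^sup>2) \<le> (LINT x|lborel. 2 * (norm (D x - E i x))\<^sup>2 + 2 * (norm (D x - E j x))\<^sup>2)"
      by (intro integral_mono d2 i2 norm_diff_square_le)
    also have "\<dots> = 2 * (LINT x|lborel. (norm (D x - E i x))\<^sup>2) + 2 * (LINT x|lborel. (norm (D x - E j x))\<^sup>2)"
      using DE2 by simp
    also have "\<dots> \<le> 2 * (1/4) ^ j + 2 * (1/4) ^ j"
    proof -
      have "(1/4::real) ^ i \<le> (1/4) ^ j" using that by (intro power_decreasing) auto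
      then show ?thesis using T[of i] T[of j] by linarith
    qed
    finally show ?thesis by (simp add: ennreal_leI)
  qed
  have "\<And>j. f j \<in> borel_measurable lborel" by simp
  from L2_fast_cauchy_limit[OF this cauchy]
  obtain g where g_meas: "g \<in> borel_measurable lborel" and lim: "AE x in lborel. (\<lambda>j. f j x) \<longlonglongrightarrow> g x"
    and gf: "\<And>j. (\<integral>\<^sup>+x. ennreal ((norm (g x - f j x))\<^sup>2) \<partial>lborel) \<le> ennreal (4 * (1/4) ^ j)"
    by auto
  note [measurable] = g_meas[simplified]
  have f2: "(\<integral>\<^sup>+x. ennreal ((norm (f j x))\<^sup>2) \<partial>lborel) \<le> ennreal (LINT x|lborel. (norm (D x))\<^sup>2)" for j
  proof -
    have "(\<integral>\<^sup>+x. ennreal ((norm (f j x))\<^sup>2) \<partial>lborel) \<le> ennreal (LINT x|lborel. (norm (E j x))\<^sup>2)"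
      unfolding f_def by (rule bound[OF E_int E2])
    also have "\<dots> \<le> ennreal (LINT x|lborel. (norm (D x))\<^sup>2)"
      using E_le by (intro ennreal_leI integral_mono E2 D2 power_mono) auto
    finally show ?thesis .
  qed
  have int_of_nn: "integrable lborel (\<lambda>x. (norm (h x))\<^sup>2)" "(LINT x|lborel. (norm (h x))\<^sup>2) \<le> (LINT x|lborel. (norm (D x))\<^sup>2)"
    if "(\<integral>\<^sup>+x. ennreal ((norm (h x))\<^sup>2) \<partial>lborel) \<le> ennreal (LINT x|lborel. (norm (D x))\<^sup>2)"
      and [measurable]: "h \<in> borel_measurable borel" for h :: "'a \<Rightarrow> complex"
  proof -
    show i: "integrable lborel (\<lambda>x. (norm (h x))\<^sup>2)"
      using that(1) by (intro integrableI_bounded) (auto simp: le_less_trans)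
    show "(LINT x|lborel. (norm (h x))\<^sup>2) \<le> (LINT x|lborel. (norm (D x))\<^sup>2)"
      using that(1) by (subst (asm) nn_integral_eq_integral[OF i]) (auto simp: ennreal_le_iff)
  qed
  have g2: "(\<integral>\<^sup>+x. ennreal ((norm (g x))\<^sup>2) \<partial>lborel) \<le> ennreal (LINT x|lborel. (norm (D x))\<^sup>2)"
  proof (rule nn_integral_limit_le[OF _ _ f2])
    show "AE x in lborel. (\<lambda>j. ennreal ((norm (f j x))\<^sup>2)) \<longlonglongrightarrow> ennreal ((norm (g x))\<^sup>2)"
      using lim by eventually_elim (intro tendsto_ennrealI tendsto_power tendsto_norm)
  qed measurable
  show thesis
  proof (rule that[of g])
    fix \<psi> :: "'a \<Rightarrow> complex" assume \<psi>: "\<psi> \<in> schwartz_space"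
    have F\<psi>: "FT 1 \<psi> \<in> schwartz_space" by (rule FT_schwartz[OF \<psi>]) simp
    note [measurable] = schwartz_measurable[OF \<psi>] schwartz_measurable[OF F\<psi>]
    note \<psi>2 = schwartz_square_integrable[OF \<psi>] and F\<psi>2 = schwartz_square_integrable[OF F\<psi>]
    have l1: "(\<lambda>j. LINT x|lborel. f j x * \<psi> x) \<longlonglongrightarrow> (LINT x|lborel. g x * \<psi> x)"
      by (rule L2_pairing_tendsto[OF _ _ _ gf _ _ \<psi>2])
        (auto intro!: integrable_product_L2 \<psi>2 int_of_nn f2 g2)
    have DE_nn: "(\<integral>\<^sup>+x. ennreal ((norm (D x - E j x))\<^sup>2) \<partial>lborel) \<le> ennreal (1 * (1/4) ^ j)" for j
      using T[of j] by (subst nn_integral_eq_integral[OF DE2]) (auto intro: ennreal_leI)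
    have "(\<lambda>j. LINT x|lborel. E j x * FT 1 \<psi> x) \<longlonglongrightarrow> (LINT x|lborel. D x * FT 1 \<psi> x)"
      by (rule L2_pairing_tendsto[OF _ _ _ DE_nn _ _ F\<psi>2])
        (auto intro!: integrable_product_L2 F\<psi>2 E2 D2)
    then have "(\<lambda>j. of_real c * (LINT x|lborel. E j x * FT 1 \<psi> x)) \<longlonglongrightarrow> of_real c * (LINT x|lborel. D x * FT 1 \<psi> x)"
      by (intro tendsto_mult tendsto_const)
    moreover have "of_real c * (LINT x|lborel. E j x * FT 1 \<psi> x) = (LINT x|lborel. f j x * \<psi> x)" for j
      unfolding FT_multiplication_formula[OF E_int schwartz_integrable[OF \<psi>]] f_def
      by (simp add: mult.assoc)
    ultimately show "(LINT x|lborel. g x * \<psi> x) = of_real (unitary_const TYPE('a)) * (LINT x|lborel. D x * FT 1 \<psi> x)"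
      using l1 unfolding c_def by (auto intro: LIMSEQ_unique)
  qed (use int_of_nn[OF g2] in auto)
qed

lemma lebesgue_measurable_ex_borel:
  fixes f :: "'a::euclidean_space \<Rightarrow> complex"
  assumes f: "f \<in> borel_measurable lebesgue"
  obtains g where "g \<in> borel_measurable borel" "AE x in lborel. f x = g x"
proof -
  have "(\<lambda>x. Re (f x)) \<in> borel_measurable lebesgue" "(\<lambda>x. Im (f x)) \<in> borel_measurable lebesgue"
    using f by measurable
  then obtain a b where [measurable]: "a \<in> borel_measurable lborel" "b \<in> borel_measurable lborel"
    and ae: "AE x in lborel. Re (f x) = a x" "AE x in lborel. Im (f x) = b x"
    using completion_ex_borel_measurable_real by metis
  show thesis
  proof (rule that[of "\<lambda>x. of_real (a x) + \<i> * of_real (b x)"])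
    show "(\<lambda>x. complex_of_real (a x) + \<i> * complex_of_real (b x)) \<in> borel_measurable borel"
      using \<open>a \<in> _\<close> \<open>b \<in> _\<close> by simp
    show "AE x in lborel. f x = of_real (a x) + \<i> * of_real (b x)"
      using ae by eventually_elim (simp add: complex_eq_iff)
  qed
qed

lemma fourier_eq_FT:
  fixes f :: "'a::euclidean_space \<Rightarrow> complex"
  assumes [measurable]: "f \<in> borel_measurable borel"
  shows "fourier f \<xi> = of_real (unitary_const TYPE('a)) * FT (- 1) f \<xi>"
proof -
  have "(\<lambda>x. cis (- 1 * (x \<bullet> \<xi>)) * f x) \<in> borel_measurable lborel" by measurable
  from integral_completion[OF this] show ?thesis
    by (simp add: fourier_def FT_def unitary_const_def)
qed

lemma schwartz_ex_inverse_fourier: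
  fixes \<psi> :: "'a::euclidean_space \<Rightarrow> complex"
  assumes \<psi>: "\<psi> \<in> schwartz_space"
  shows "(\<lambda>x. of_real (unitary_const TYPE('a)) * FT 1 \<psi> x) \<in> schwartz_space"
    and "fourier (\<lambda>x. of_real (unitary_const TYPE('a)) * FT 1 \<psi> x) = \<psi>"
proof -
  let ?c = "unitary_const TYPE('a)"
  have F: "FT 1 \<psi> \<in> schwartz_space" by (rule FT_schwartz[OF \<psi>]) simp
  then show S: "(\<lambda>x. of_real ?c * FT 1 \<psi> x) \<in> schwartz_space" by (rule schwartz_cmult)
  show "fourier (\<lambda>x. of_real ?c * FT 1 \<psi> x) = \<psi>"
  proof
    fix y
    have "FT (- 1) (\<lambda>x. of_real ?c * FT 1 \<psi> x) y = of_real ?c * FT (- 1) (FT 1 \<psi>) y"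
      unfolding FT_def[of "- 1"] by (subst integral_mult_right_zero[symmetric]) (simp add: mult_ac)
    then have "fourier (\<lambda>x. of_real ?c * FT 1 \<psi> x) y = of_real (?c\<^sup>2 * (2 * pi) ^ DIM('a)) * \<psi> y"
      unfolding fourier_eq_FT[OF schwartz_measurable[OF S]]
      by (simp only: FT_inversion[OF \<psi>] of_real_mult power2_eq_square mult.assoc)
    then show "fourier (\<lambda>x. of_real ?c * FT 1 \<psi> x) y = \<psi> y" by (simp only: unitary_const_square of_real_1 mult_1)
  qed
qed

text \<open>Every Schwartz function \<open>\<psi>\<close> is the Fourier transform of a Schwartz function, so the values of
  \<open>T\<close> on the Schwartz space are determined by \<open>D\<close>, and they are the pairings with the inverse transform
  of \<open>D\<close>.\<close>

theorem norm_L2_distr_le_fourier: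
  fixes T :: "'a::euclidean_space distr"
  assumes D: "D \<in> L2_space" and rep: "represents D (fourier_distr T)"
  shows "norm_L2_distr T \<le> ennreal (norm_L2 D)"
proof -
  have D_meas: "D \<in> borel_measurable lebesgue" and D2: "integrable lebesgue (\<lambda>x. (norm (D x))\<^sup>2)"
    using D by (auto simp: L2_space_def)
  obtain D' where [measurable]: "D' \<in> borel_measurable borel" and ae: "AE x in lborel. D x = D' x"
    using lebesgue_measurable_ex_borel[OF D_meas] .
  have ae': "AE x in lebesgue. D x = D' x" using ae by (rule AE_completion)
  have meas': "(\<lambda>x. h x) \<in> borel_measurable lebesgue" if "h \<in> borel_measurable borel" for h :: "'a \<Rightarrow> 'b::topological_space"
    using that by (intro measurable_completion) simp
  have sq_eq: "(LINT x|lebesgue. (norm (D x))\<^sup>2) = (LINT x|lborel. (norm (D' x))\<^sup>2)"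
    and D'2: "integrable lborel (\<lambda>x. (norm (D' x))\<^sup>2)"
  proof -
    have m: "(\<lambda>x. (norm (D' x))\<^sup>2) \<in> borel_measurable borel" by measurable
    have "(LINT x|lebesgue. (norm (D x))\<^sup>2) = (LINT x|lebesgue. (norm (D' x))\<^sup>2)"
      using ae' D2 meas'[OF m] by (intro integral_cong_AE) auto
    also have "\<dots> = (LINT x|lborel. (norm (D' x))\<^sup>2)" using m by (intro integral_completion) simp
    finally show "(LINT x|lebesgue. (norm (D x))\<^sup>2) = (LINT x|lborel. (norm (D' x))\<^sup>2)" .
    have "integrable lebesgue (\<lambda>x. (norm (D' x))\<^sup>2)"
      by (rule integrable_cong_AE_imp[OF D2 meas'[OF m]]) (use ae' in eventually_elim, simp)
    then show "integrable lborel (\<lambda>x. (norm (D' x))\<^sup>2)" using m by (subst (asm) integrable_completion) simp_all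
  qed
  obtain f where f_meas[measurable]: "f \<in> borel_measurable borel" and f2: "integrable lborel (\<lambda>x. (norm (f x))\<^sup>2)"
    and f_le: "(LINT x|lborel. (norm (f x))\<^sup>2) \<le> (LINT x|lborel. (norm (D' x))\<^sup>2)"
    and f_eq: "\<And>\<psi>. \<psi> \<in> schwartz_space \<Longrightarrow>
      (LINT x|lborel. f x * \<psi> x) = of_real (unitary_const TYPE('a)) * (LINT x|lborel. D' x * FT 1 \<psi> x)"
    using square_integrable_inverse_FT[OF _ D'2] by auto
  have fsq: "(\<lambda>x. (norm (f x))\<^sup>2) \<in> borel_measurable lborel" by measurable
  have f_L2: "f \<in> L2_space"
    unfolding L2_space_def using meas'[OF f_meas] f2 integrable_completion[OF fsq] by simp
  have "represents f T"
    unfolding represents_def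
  proof (intro conjI ballI)
    show "f \<in> borel_measurable lebesgue" by (rule meas'[OF f_meas])
    fix \<psi> :: "'a \<Rightarrow> complex" assume \<psi>: "\<psi> \<in> schwartz_space"
    note [measurable] = schwartz_measurable[OF \<psi>]
    have m: "(\<lambda>x. f x * \<psi> x) \<in> borel_measurable lborel" by measurable
    have "integrable lborel (\<lambda>x. f x * \<psi> x)"
      by (intro integrable_product_L2 f2 schwartz_square_integrable[OF \<psi>]) measurable
    then show "integrable lebesgue (\<lambda>x. f x * \<psi> x)" using integrable_completion[OF m] by simp
    let ?\<phi> = "\<lambda>x. of_real (unitary_const TYPE('a)) * FT 1 \<psi> x"
    note S = schwartz_ex_inverse_fourier[OF \<psi>]
    note [measurable] = schwartz_measurable[OF S(1)]
    have m': "(\<lambda>x. D' x * ?\<phi> x) \<in> borel_measurable borel" by measurable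
    have "T \<psi> = (LINT x|lebesgue. D x * ?\<phi> x)"
      using rep S unfolding represents_def fourier_distr_def by fastforce
    also have "\<dots> = (LINT x|lebesgue. D' x * ?\<phi> x)"
    proof (rule integral_cong_AE)
      show "(\<lambda>x. D x * ?\<phi> x) \<in> borel_measurable lebesgue"
        by (rule borel_measurable_times[OF D_meas meas'[OF schwartz_measurable[OF S(1)]]])
      show "(\<lambda>x. D' x * ?\<phi> x) \<in> borel_measurable lebesgue" by (rule meas'[OF m'])
      show "AE x in lebesgue. D x * ?\<phi> x = D' x * ?\<phi> x" using ae' by eventually_elim simp
    qed
    also have "\<dots> = (LINT x|lborel. D' x * ?\<phi> x)" using m' by (intro integral_completion) simp
    also have "\<dots> = of_real (unitary_const TYPE('a)) * (LINT x|lborel. D' x * FT 1 \<psi> x)"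
      by (subst integral_mult_right_zero[symmetric]) (simp add: mult_ac)
    also have "\<dots> = (LINT x|lborel. f x * \<psi> x)" by (rule f_eq[OF \<psi>, symmetric])
    also have "\<dots> = (LINT x|lebesgue. f x * \<psi> x)" by (rule integral_completion[OF m, symmetric])
    finally show "T \<psi> = (LINT x|lebesgue. f x * \<psi> x)" .
  qed
  then have "norm_L2_distr T \<le> ennreal (norm_L2 f)"
    unfolding norm_L2_distr_def using f_L2 by (intro INF_lower) simp
  also have "\<dots> \<le> ennreal (norm_L2 D)"
    unfolding norm_L2_def sq_eq integral_completion[OF fsq]
    by (intro ennreal_leI real_sqrt_le_mono f_le)
  finally show ?thesis .
qed

section \<open>Damped oscillators\<close>

text \<open>The solution concept asks for the differential equations only at positive times, with continuity up to
  the initial time; this relation between a function and its derivative expresses exactly that.\<close>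

definition evolves :: "(real \<Rightarrow> 'b::real_normed_vector) \<Rightarrow> (real \<Rightarrow> 'b) \<Rightarrow> bool" where
  "evolves f f' \<longleftrightarrow> continuous_on {0..} f \<and> (\<forall>t>0. (f has_vector_derivative f' t) (at t))"

lemma evolvesI:
  assumes "continuous_on {0..} f" "\<And>t. t > 0 \<Longrightarrow> (f has_vector_derivative f' t) (at t)"
  shows "evolves f f'"
  using assms by (simp add: evolves_def)

lemma evolves_cong: "evolves f g \<Longrightarrow> (\<And>t. t > 0 \<Longrightarrow> g t = h t) \<Longrightarrow> evolves f h"
  by (simp add: evolves_def)

lemma evolves_add: "evolves f f' \<Longrightarrow> evolves g g' \<Longrightarrow> evolves (\<lambda>t. f t + g t) (\<lambda>t. f' t + g' t)"
  unfolding evolves_def by (auto intro!: continuous_intros derivative_intros)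

lemma evolves_diff: "evolves f f' \<Longrightarrow> evolves g g' \<Longrightarrow> evolves (\<lambda>t. f t - g t) (\<lambda>t. f' t - g' t)"
  unfolding evolves_def by (auto intro!: continuous_intros derivative_intros)

lemma evolves_minus: "evolves f f' \<Longrightarrow> evolves (\<lambda>t. - f t) (\<lambda>t. - f' t)"
  unfolding evolves_def by (auto intro!: continuous_intros derivative_intros)

lemma evolves_scaleR: "evolves f f' \<Longrightarrow> evolves (\<lambda>t. c *\<^sub>R f t) (\<lambda>t. c *\<^sub>R f' t)"
  unfolding evolves_def
  by (auto intro!: continuous_intros bounded_linear.has_vector_derivative[OF bounded_linear_scaleR_right])

lemma evolves_mult_left:
  fixes f :: "real \<Rightarrow> real"
  assumes "evolves f f'" shows "evolves (\<lambda>t. c * f t) (\<lambda>t. c * f' t)"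
  using evolves_scaleR[OF assms, of c] by simp

lemma evolves_exp: "evolves (\<lambda>t. exp (c * t) *\<^sub>R z) (\<lambda>t. (c * exp (c * t)) *\<^sub>R z)"
proof (rule evolvesI)
  fix t :: real
  have "((\<lambda>t. exp (c * t)) has_vector_derivative (c * exp (c * t))) (at t)"
    unfolding has_real_derivative_iff_has_vector_derivative[symmetric]
    by (auto intro!: derivative_eq_intros)
  then show "((\<lambda>t. exp (c * t) *\<^sub>R z) has_vector_derivative ((c * exp (c * t)) *\<^sub>R z)) (at t)"
    by (rule bounded_linear.has_vector_derivative[OF bounded_linear_scaleR_left])
qed (auto intro!: continuous_intros)

lemma evolves_power2_norm:
  fixes f :: "real \<Rightarrow> 'b::real_inner"
  assumes "evolves f f'"
  shows "evolves (\<lambda>t. (norm (f t))\<^sup>2) (\<lambda>t. 2 * (f t \<bullet> f' t))"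
proof (rule evolvesI)
  show "continuous_on {0..} (\<lambda>t. (norm (f t))\<^sup>2)"
    using assms by (auto simp: evolves_def intro!: continuous_intros)
  fix t :: real assume "t > 0"
  then have "(f has_derivative (\<lambda>h. h *\<^sub>R f' t)) (at t)"
    using assms by (auto simp: evolves_def has_vector_derivative_def)
  then show "((\<lambda>t. (norm (f t))\<^sup>2) has_vector_derivative 2 * (f t \<bullet> f' t)) (at t)"
    unfolding has_vector_derivative_def power2_norm_eq_inner
    by (auto intro!: derivative_eq_intros simp: inner_commute algebra_simps)
qed

text \<open>The forcing term is absorbed by half of the dissipation, and the inequality that remains is integrated.
  Giving up half of the rate avoids the factor \<open>t\<close> that Duhamel's formula would produce
  when the forcing decays at the rate of the homogeneous solution.\<close>

lemma lyapunov_decay: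
  fixes L L' :: "real \<Rightarrow> real"
  assumes ev: "evolves L L'"
    and nonneg: "\<And>t. t \<ge> 0 \<Longrightarrow> L t \<ge> 0"
    and diss: "\<And>t. t > 0 \<Longrightarrow> L' t \<le> - 2 * k * L t + 2 * (M * exp (- k * t)) * sqrt (L t)"
    and k: "k > 0" and M: "M \<ge> 0" and t: "t \<ge> 0"
  shows "sqrt (L t) \<le> exp (- k * t / 2) * (sqrt (L 0) + M / k)"
proof -
  define g where "g t = exp (k * t) * L t + (M\<^sup>2 / k\<^sup>2) * exp (- k * t)" for t
  have cont: "continuous_on {0..t} g"
    unfolding g_def using ev k
    by (auto simp: evolves_def intro!: continuous_intros elim: continuous_on_subset)
  have "g t \<le> g 0"
  proof (rule DERIV_nonpos_imp_decreasing_open[OF t _ cont])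
    fix x assume x: "0 < x" "x < t"
    have "(L has_real_derivative L' x) (at x)"
      using ev x by (auto simp: evolves_def has_real_derivative_iff_has_vector_derivative)
    then have d: "(g has_real_derivative exp (k * x) * (k * L x + L' x) - (M\<^sup>2 / k) * exp (- k * x)) (at x)"
      unfolding g_def using k
      by (auto intro!: derivative_eq_intros simp: field_simps power2_eq_square)
    have "0 \<le> (sqrt k * sqrt (L x) - (M * exp (- k * x)) / sqrt k)\<^sup>2" by simp
    also have "\<dots> = k * L x + (M * exp (- k * x))\<^sup>2 / k - 2 * (M * exp (- k * x)) * sqrt (L x)"
      using k nonneg[of x] x by (simp add: power2_diff power_mult_distrib power_divide)
    finally have "L' x \<le> - k * L x + (M * exp (- k * x))\<^sup>2 / k"
      using diss[of x] x by linarith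
    then have "k * L x + L' x \<le> (M\<^sup>2 / k) * exp (- k * x) * exp (- k * x)"
      by (simp add: power_mult_distrib power2_eq_square mult_ac)
    then have "exp (k * x) * (k * L x + L' x) \<le> exp (k * x) * ((M\<^sup>2 / k) * exp (- k * x) * exp (- k * x))"
      by (rule mult_left_mono) simp
    also have "\<dots> = (M\<^sup>2 / k) * exp (- k * x)"
      by (simp add: exp_minus field_simps)
    finally show "\<exists>y. (g has_real_derivative y) (at x) \<and> y \<le> 0"
      using d by (intro exI[of _ "exp (k * x) * (k * L x + L' x) - (M\<^sup>2 / k) * exp (- k * x)"]) auto
  qed
  moreover have "(M\<^sup>2 / k\<^sup>2) * exp (- k * t) \<ge> 0" by simp
  ultimately have "exp (k * t) * L t \<le> L 0 + (M / k)\<^sup>2"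
    unfolding g_def power_divide mult_zero_right exp_zero mult_1 mult_1_right by linarith
  then have "L t \<le> exp (- k * t) * (L 0 + (M / k)\<^sup>2)"
    by (simp add: exp_minus field_simps)
  also have "\<dots> \<le> exp (- k * t) * (sqrt (L 0) + M / k)\<^sup>2"
    using nonneg[of 0] k M by (intro mult_left_mono) (auto simp: power2_sum)
  also have "\<dots> = (exp (- k * t / 2) * (sqrt (L 0) + M / k))\<^sup>2"
    by (simp add: power_mult_distrib power2_eq_square flip: exp_add)
  finally show ?thesis
    using k M nonneg[of 0] by (intro real_le_lsqrt) auto
qed

lemma exponential_decay_unique:
  fixes Q :: "real \<Rightarrow> 'b::real_inner"
  assumes Q: "evolves Q (\<lambda>t. - s *\<^sub>R Q t)" and s: "s > 0" and t: "t \<ge> 0"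
  shows "Q t = exp (- s * t) *\<^sub>R Q 0"
proof -
  define D where "D t = Q t - exp (- s * t) *\<^sub>R Q 0" for t
  have ev: "evolves D (\<lambda>t. - s *\<^sub>R Q t - (- s * exp (- s * t)) *\<^sub>R Q 0)"
    unfolding D_def by (intro evolves_diff Q evolves_exp)
  have "sqrt ((norm (D t))\<^sup>2) \<le> exp (- s * t / 2) * (sqrt ((norm (D 0))\<^sup>2) + 0 / s)"
  proof (rule lyapunov_decay[OF evolves_power2_norm[OF ev] _ _ s _ t])
    fix t :: real
    have "- s *\<^sub>R Q t - (- s * exp (- s * t)) *\<^sub>R Q 0 = - s *\<^sub>R D t"
      by (simp add: D_def algebra_simps)
    then show "2 * (D t \<bullet> (- s *\<^sub>R Q t - (- s * exp (- s * t)) *\<^sub>R Q 0)) \<le>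
        - 2 * s * (norm (D t))\<^sup>2 + 2 * (0 * exp (- s * t)) * sqrt ((norm (D t))\<^sup>2)"
      by (simp add: power2_norm_eq_inner)
  qed auto
  then show ?thesis by (simp add: D_def)
qed

text \<open>For \<open>p^2 < 4 q\<close> the functional \<open>|X' + p X / 2|^2 + (q - p^2/4) |X|^2\<close> is positive, and along
  solutions of \<open>X'' + p X' + q X = F\<close> its derivative is exactly \<open>- p\<close> times itself plus the contribution
  of \<open>F\<close>.\<close>

lemma underdamped_decay:
  fixes X X1 F :: "real \<Rightarrow> 'b::real_inner"
  assumes X: "evolves X X1" and X1: "evolves X1 (\<lambda>t. F t - p *\<^sub>R X1 t - q *\<^sub>R X t)"
    and F: "\<And>t. t > 0 \<Longrightarrow> norm (F t) \<le> M * exp (- k * t)"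
    and k: "0 < k" "2 * k \<le> p" and pq: "p\<^sup>2 / 4 < q" and M: "M \<ge> 0" and t: "t \<ge> 0"
  defines "B \<equiv> exp (- k * t / 2) *
    (norm (X1 0) + p / 2 * norm (X 0) + sqrt q * norm (X 0) + M / k)"
  shows "norm (X1 t + (p / 2) *\<^sub>R X t) \<le> B" "sqrt (q - p\<^sup>2 / 4) * norm (X t) \<le> B"
proof -
  define Z where "Z t = X1 t + (p / 2) *\<^sub>R X t" for t
  define L where "L t = (norm (Z t))\<^sup>2 + (q - p\<^sup>2 / 4) * (norm (X t))\<^sup>2" for t
  have Z: "evolves Z (\<lambda>t. F t - p *\<^sub>R X1 t - q *\<^sub>R X t + (p / 2) *\<^sub>R X1 t)"
    unfolding Z_def by (intro evolves_add evolves_scaleR X X1)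
  have ev: "evolves L (\<lambda>t. 2 * (Z t \<bullet> (F t - p *\<^sub>R X1 t - q *\<^sub>R X t + (p / 2) *\<^sub>R X1 t)) +
      (q - p\<^sup>2 / 4) * (2 * (X t \<bullet> X1 t)))" (is "evolves _ ?L'")
    unfolding L_def by (intro evolves_add evolves_mult_left evolves_power2_norm Z X)
  have nonneg: "L t \<ge> 0" for t using pq by (simp add: L_def)
  have ZL: "norm (Z t) \<le> sqrt (L t)" for t
    using pq by (intro real_le_rsqrt) (simp add: L_def)
  have L': "?L' t = - p * L t + 2 * (F t \<bullet> Z t)" for t
    unfolding L_def power2_norm_eq_inner Z_def
    by (simp add: inner_simps inner_commute algebra_simps power2_eq_square)
  have main: "sqrt (L t) \<le> exp (- k * t / 2) * (sqrt (L 0) + M / k)"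
  proof (rule lyapunov_decay[OF ev nonneg _ k(1) M t])
    fix t :: real assume t: "t > 0"
    have "F t \<bullet> Z t \<le> norm (F t) * norm (Z t)" by (rule norm_cauchy_schwarz)
    also have "\<dots> \<le> M * exp (- k * t) * sqrt (L t)"
      using F[OF t] ZL[of t] by (intro mult_mono) (auto intro: order_trans[OF norm_ge_zero])
    finally have "F t \<bullet> Z t \<le> M * exp (- k * t) * sqrt (L t)" .
    moreover have "- p * L t \<le> - 2 * k * L t"
      using k nonneg[of t] by (auto intro!: mult_right_mono)
    ultimately show "?L' t \<le> - 2 * k * L t + 2 * (M * exp (- k * t)) * sqrt (L t)"
      unfolding L' by linarith
  qed
  have "L 0 \<le> (norm (Z 0) + sqrt (q - p\<^sup>2 / 4) * norm (X 0))\<^sup>2"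
    using pq unfolding L_def by (simp add: power2_sum power_mult_distrib)
  then have "sqrt (L 0) \<le> norm (Z 0) + sqrt (q - p\<^sup>2 / 4) * norm (X 0)"
    using pq by (intro real_le_lsqrt) auto
  also have "\<dots> \<le> norm (X1 0) + p / 2 * norm (X 0) + sqrt q * norm (X 0)"
    using k unfolding Z_def
    by (intro add_mono mult_right_mono) (auto intro: norm_triangle_le)
  finally have "exp (- k * t / 2) * (sqrt (L 0) + M / k) \<le> B"
    unfolding B_def by (intro mult_left_mono) auto
  with main have LB: "sqrt (L t) \<le> B" by linarith
  then show "norm (X1 t + (p / 2) *\<^sub>R X t) \<le> B"
    using ZL[of t] unfolding Z_def by linarith
  have "sqrt (q - p\<^sup>2 / 4) * norm (X t) = sqrt ((q - p\<^sup>2 / 4) * (norm (X t))\<^sup>2)"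
    by (simp add: real_sqrt_mult)
  also have "\<dots> \<le> sqrt (L t)" unfolding L_def by simp
  finally show "sqrt (q - p\<^sup>2 / 4) * norm (X t) \<le> B" using LB by linarith
qed

text \<open>With \<open>Z = X' + p X\<close> the equation becomes \<open>Z' = (q/p) (X' - Z) + F\<close> and
  \<open>X'' = - p X' - (q/p) (Z - X') + F\<close>.  The cross terms in the derivative of \<open>|Z|^2 + |X'|^2\<close> cancel, which leaves
  the slow rate \<open>q/p\<close> for \<open>Z\<close> and the fast rate \<open>p - q/p\<close> for \<open>X'\<close>.  Since \<open>X = (Z - X') / p\<close>, a
  large \<open>p\<close> makes \<open>X\<close> small.\<close>

lemma overdamped_decay:
  fixes X X1 F :: "real \<Rightarrow> 'b::real_inner"
  assumes X: "evolves X X1" and X1: "evolves X1 (\<lambda>t. F t - p *\<^sub>R X1 t - q *\<^sub>R X t)"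
    and F: "\<And>t. t > 0 \<Longrightarrow> norm (F t) \<le> M * exp (- k * t)"
    and k: "0 < k" "k \<le> q / p" "k \<le> p - q / p" and p: "p > 0" and M: "M \<ge> 0" and t: "t \<ge> 0"
    and X0: "X 0 = 0"
  shows "norm (X t) \<le> 2 / p * exp (- k * t / 2) * (norm (X1 0) + M / k)"
proof -
  define Z where "Z t = X1 t + p *\<^sub>R X t" for t
  define L where "L t = (norm (Z t))\<^sup>2 + (norm (X1 t))\<^sup>2" for t
  have Z: "evolves Z (\<lambda>t. F t - p *\<^sub>R X1 t - q *\<^sub>R X t + p *\<^sub>R X1 t)"
    unfolding Z_def by (intro evolves_add evolves_scaleR X X1)
  have ev: "evolves L (\<lambda>t. 2 * (Z t \<bullet> (F t - p *\<^sub>R X1 t - q *\<^sub>R X t + p *\<^sub>R X1 t)) +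
      2 * (X1 t \<bullet> (F t - p *\<^sub>R X1 t - q *\<^sub>R X t)))" (is "evolves _ ?L'")
    unfolding L_def by (intro evolves_add evolves_power2_norm Z X1)
  have nonneg: "L t \<ge> 0" for t by (simp add: L_def)
  have ZL: "norm (Z t) + norm (X1 t) \<le> sqrt 2 * sqrt (L t)" for t
  proof -
    have "(norm (Z t) + norm (X1 t))\<^sup>2 \<le> 2 * L t"
      unfolding L_def using sum_squares_bound[of "norm (Z t)" "norm (X1 t)"] by (simp add: power2_sum)
    then show ?thesis unfolding real_sqrt_mult[symmetric] by (rule real_le_rsqrt)
  qed
  have Xeq: "q *\<^sub>R X t = (q / p) *\<^sub>R Z t - (q / p) *\<^sub>R X1 t" for t
    using p by (simp add: Z_def algebra_simps)
  have L': "?L' t = - 2 * (q / p) * (norm (Z t))\<^sup>2 - 2 * (p - q / p) * (norm (X1 t))\<^sup>2 + 2 * (F t \<bullet> (Z t + X1 t))" for t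
    unfolding Xeq power2_norm_eq_inner
    by (simp add: inner_simps inner_commute algebra_simps)
  have main: "sqrt (L t) \<le> exp (- k * t / 2) * (sqrt (L 0) + (sqrt 2 * M) / k)"
  proof (rule lyapunov_decay[OF ev nonneg _ k(1) _ t])
    fix t :: real assume t: "t > 0"
    have "F t \<bullet> (Z t + X1 t) \<le> norm (F t) * norm (Z t + X1 t)" by (rule norm_cauchy_schwarz)
    also have "\<dots> \<le> (M * exp (- k * t)) * (sqrt 2 * sqrt (L t))"
      using F[OF t] norm_triangle_le[OF ZL[of t]]
      by (intro mult_mono) (auto intro: order_trans[OF norm_ge_zero])
    also have "\<dots> = sqrt 2 * M * exp (- k * t) * sqrt (L t)" by simp
    finally have "F t \<bullet> (Z t + X1 t) \<le> sqrt 2 * M * exp (- k * t) * sqrt (L t)" .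
    moreover have "k * L t \<le> (q / p) * (norm (Z t))\<^sup>2 + (p - q / p) * (norm (X1 t))\<^sup>2"
      unfolding L_def distrib_left using k by (intro add_mono mult_right_mono) auto
    ultimately show "?L' t \<le> - 2 * k * L t + 2 * (sqrt 2 * M * exp (- k * t)) * sqrt (L t)"
      unfolding L' by linarith
  qed (use M in auto)
  have "L 0 = 2 * (norm (X1 0))\<^sup>2" by (simp add: L_def Z_def X0)
  then have L0: "sqrt (L 0) = sqrt 2 * norm (X1 0)" by (simp add: real_sqrt_mult)
  have "p * norm (X t) = norm (Z t - X1 t)" using p by (simp add: Z_def)
  also have "\<dots> \<le> sqrt 2 * sqrt (L t)" using ZL[of t] norm_triangle_ineq4[of "Z t" "X1 t"] by linarith
  also have "\<dots> \<le> sqrt 2 * (exp (- k * t / 2) * (sqrt 2 * norm (X1 0) + (sqrt 2 * M) / k))"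
    using main unfolding L0 by (intro mult_left_mono) auto
  also have "\<dots> = 2 * exp (- k * t / 2) * (norm (X1 0) + M / k)"
    by (simp add: field_simps flip: mult.assoc)
  finally show ?thesis using p by (simp add: field_simps)
qed

section \<open>The two Cauchy problems at a fixed frequency\<close>

text \<open>\<open>- s\<close> is a root of the characteristic polynomial \<open>(x + \<rho>)(x^2 + \<rho>) + x\<close> of the wave-heat system, and
  \<open>x^2 + p x + q\<close> is the cofactor of \<open>x + s\<close>.\<close>

locale wave_heat_root =
  fixes \<rho> s :: real
  assumes s_pos: "0 < s" and s_less: "s < \<rho>"
    and root: "(\<rho> - s) * (s\<^sup>2 + \<rho>) = s"
begin

definition p where "p = \<rho> - s"
definition q where "q = \<rho> + 1 - s * p"

lemma rho_pos: "0 < \<rho>" using s_pos s_less by linarith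
lemma p_pos: "0 < p" using s_less by (simp add: p_def)
lemma p_eq: "p * (s\<^sup>2 + \<rho> + 1) = \<rho>" using root by (simp add: p_def algebra_simps)
lemma s_eq: "s * (s\<^sup>2 + \<rho> + 1) = \<rho> * (s\<^sup>2 + \<rho>)"
  using root by (simp add: algebra_simps)
lemma q_eq: "s * q = \<rho>\<^sup>2"
  using root unfolding p_def q_def by (simp add: algebra_simps power2_eq_square)
lemma q_rho: "(q - \<rho>) * (s\<^sup>2 + \<rho>) = \<rho>"
  using root unfolding p_def q_def by (simp add: algebra_simps power2_eq_square) algebra

lemma s_lower: "\<rho>\<^sup>2 \<le> s * (\<rho> + 1)"
proof -
  have "s * (s\<^sup>2 + \<rho> + 1) * (\<rho> + 1) - \<rho>\<^sup>2 * (s\<^sup>2 + \<rho> + 1) = \<rho> * s\<^sup>2"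
    unfolding s_eq by (simp add: algebra_simps power2_eq_square)
  then have "(s * (\<rho> + 1) - \<rho>\<^sup>2) * (s\<^sup>2 + \<rho> + 1) \<ge> 0"
    using rho_pos by (simp add: algebra_simps)
  moreover have "s\<^sup>2 + \<rho> + 1 > 0" using rho_pos by (simp add: add_nonneg_pos)
  ultimately show ?thesis by (simp add: zero_le_mult_iff)
qed

lemma s_upper: "s \<le> \<rho>\<^sup>2 * (1 + \<rho>)"
proof -
  have "s = p * (s\<^sup>2 + \<rho>)" using root by (simp add: p_def)
  also have "\<dots> \<le> \<rho> * (\<rho>\<^sup>2 + \<rho>)"
    using s_pos s_less by (intro mult_mono add_mono power_mono) (auto simp: p_def)
  finally show ?thesis by (simp add: algebra_simps power2_eq_square)
qed

lemma p_lower: "\<rho> \<le> p * (\<rho>\<^sup>2 + \<rho> + 1)"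
  using p_eq p_pos s_pos s_less by (smt (verit) mult_left_mono power_mono)

end

lemma wave_heat_root_exists:
  assumes "\<rho> > 0" obtains s where "wave_heat_root \<rho> s"
proof -
  define f where "f s = (\<rho> - s) * (s\<^sup>2 + \<rho>) - s" for s
  have "f 0 > 0" "f \<rho> < 0" using assms by (auto simp: f_def)
  moreover have "\<exists>s\<ge>0. s \<le> \<rho> \<and> f s = 0"
    by (rule IVT2) (use assms calculation in \<open>auto simp: f_def intro!: continuous_intros\<close>)
  then obtain s where "0 \<le> s" "s \<le> \<rho>" "f s = 0" by auto
  moreover have "s \<noteq> 0" "s \<noteq> \<rho>" using calculation by auto
  ultimately have "wave_heat_root \<rho> s" by unfold_locales (auto simp: f_def)
  then show ?thesis using that by blast
qed

text \<open>\<open>Q\<close> and \<open>Y\<close> separate the modes: \<open>Q = U'' + p U' + q U\<close> contains only \<open>exp (- s t)\<close>, and \<open>Y = U' + s U\<close>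
  contains only the oscillator \<open>x^2 + p x + q\<close>; \<open>Y1\<close> is the derivative of \<open>Y\<close>.  Second derivatives of
  \<open>U\<close> are replaced by means of the first equation, since a solution provides two derivatives of \<open>U\<close>
  and one of \<open>V\<close>.\<close>

locale wave_heat_mode = wave_heat_root +
  fixes U U1 V :: "real \<Rightarrow> complex"
  assumes U: "evolves U U1"
    and U1: "evolves U1 (\<lambda>t. - (\<rho> *\<^sub>R U t) - V t)"
    and V: "evolves V (\<lambda>t. U1 t - \<rho> *\<^sub>R V t)"
    and V0: "V 0 = 0"
begin

definition A where "A = norm (U 0) + norm (U1 0)"
definition Q where "Q t = - (\<rho> *\<^sub>R U t) - V t + p *\<^sub>R U1 t + q *\<^sub>R U t" for t
definition Y where "Y t = U1 t + s *\<^sub>R U t" for t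
definition Y1 where "Y1 t = - (\<rho> *\<^sub>R U t) - V t + s *\<^sub>R U1 t" for t

lemma A_nonneg: "A \<ge> 0" and U0_le: "norm (U 0) \<le> A" and U10_le: "norm (U1 0) \<le> A"
  by (auto simp: A_def)

lemma Q_decay: assumes "t \<ge> 0" shows "Q t = exp (- s * t) *\<^sub>R Q 0"
proof (rule exponential_decay_unique[OF _ s_pos assms])
  have "evolves Q (\<lambda>t. - (\<rho> *\<^sub>R U1 t) - (U1 t - \<rho> *\<^sub>R V t) + p *\<^sub>R (- (\<rho> *\<^sub>R U t) - V t) + q *\<^sub>R U1 t)"
    unfolding Q_def by (intro evolves_add evolves_diff evolves_minus evolves_scaleR U U1 V)
  moreover have "- (\<rho> *\<^sub>R U1 t) - (U1 t - \<rho> *\<^sub>R V t) + p *\<^sub>R (- (\<rho> *\<^sub>R U t) - V t) + q *\<^sub>R U1 t = - s *\<^sub>R Q t" for t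
  proof -
    have 1: "p * \<rho> = s * q - s * \<rho>" unfolding q_eq by (simp add: p_def power2_eq_square algebra_simps)
    have "- s *\<^sub>R Q t = (s * \<rho> - s * q) *\<^sub>R U t + s *\<^sub>R V t - (s * p) *\<^sub>R U1 t"
      by (simp add: Q_def algebra_simps)
    moreover have "- (\<rho> *\<^sub>R U1 t) - (U1 t - \<rho> *\<^sub>R V t) + p *\<^sub>R (- (\<rho> *\<^sub>R U t) - V t) + q *\<^sub>R U1 t
      = (- (p * \<rho>)) *\<^sub>R U t + (\<rho> - p) *\<^sub>R V t + (q - \<rho> - 1) *\<^sub>R U1 t"
      by (simp add: algebra_simps)
    moreover have "q - \<rho> - 1 = - (s * p)" "\<rho> - p = s" "- (p * \<rho>) = s * \<rho> - s * q"
      using 1 by (auto simp: q_def p_def)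
    ultimately show ?thesis by simp
  qed
  ultimately show "evolves Q (\<lambda>t. - s *\<^sub>R Q t)" by (simp add: evolves_def)
qed

lemma Y: "evolves Y Y1"
  unfolding Y_def Y1_def by (intro evolves_add evolves_diff evolves_scaleR U U1)

lemma Y1: "evolves Y1 (\<lambda>t. 0 - p *\<^sub>R Y1 t - q *\<^sub>R Y t)"
proof (rule evolves_cong)
  show "evolves Y1 (\<lambda>t. - (\<rho> *\<^sub>R U1 t) - (U1 t - \<rho> *\<^sub>R V t) + s *\<^sub>R (- (\<rho> *\<^sub>R U t) - V t))"
    unfolding Y1_def by (intro evolves_add evolves_diff evolves_minus evolves_scaleR U U1 V)
  fix t
  have "0 - p *\<^sub>R Y1 t - q *\<^sub>R Y t = (p * \<rho> - s * q) *\<^sub>R U t + p *\<^sub>R V t - (q + s * p) *\<^sub>R U1 t"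
    by (simp add: Y_def Y1_def algebra_simps)
  moreover have "- (\<rho> *\<^sub>R U1 t) - (U1 t - \<rho> *\<^sub>R V t) + s *\<^sub>R (- (\<rho> *\<^sub>R U t) - V t) =
     (- (s * \<rho>)) *\<^sub>R U t + (\<rho> - s) *\<^sub>R V t - (\<rho> + 1) *\<^sub>R U1 t"
    by (simp add: algebra_simps)
  moreover have "p * \<rho> - s * q = - (s * \<rho>)" unfolding q_eq by (simp add: p_def power2_eq_square algebra_simps)
  moreover have "q + s * p = \<rho> + 1" by (simp add: q_def)
  ultimately show "- (\<rho> *\<^sub>R U1 t) - (U1 t - \<rho> *\<^sub>R V t) + s *\<^sub>R (- (\<rho> *\<^sub>R U t) - V t) = 0 - p *\<^sub>R Y1 t - q *\<^sub>R Y t"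
    by (simp only: p_def)
qed

lemma U1': "evolves U1 (\<lambda>t. Q t - p *\<^sub>R U1 t - q *\<^sub>R U t)"
  by (rule evolves_cong[OF U1]) (simp add: Q_def)

text \<open>The value at \<open>- s\<close> of \<open>x^2 + p x + q\<close>, which is the derivative of the characteristic polynomial
  there.\<close>

definition \<Delta> where "\<Delta> = 3 * s\<^sup>2 - 2 * \<rho> * s + \<rho> + 1"

lemma U_decompose: "\<Delta> *\<^sub>R U t = Q t - Y1 t - (p - s) *\<^sub>R Y t"
proof -
  have "Q t - Y1 t - (p - s) *\<^sub>R Y t = (q - (p - s) * s) *\<^sub>R U t"
    by (simp add: Q_def Y1_def Y_def algebra_simps)
  moreover have "q - (p - s) * s = \<Delta>" by (simp add: q_def p_def \<Delta>_def algebra_simps power2_eq_square)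
  ultimately show ?thesis by simp
qed

lemma Q0: "Q 0 = p *\<^sub>R U1 0 + (q - \<rho>) *\<^sub>R U 0"
  by (simp add: Q_def V0 algebra_simps)

text \<open>\<open>U\<close> is recovered from \<open>Q\<close>, \<open>Y\<close> and \<open>Y'\<close> after division by \<open>\<Delta> \<ge> 1\<close>.  The part from \<open>Y\<close>
  decays at the rate \<open>p\<close> of the oscillator, of size \<open>\<rho>\<close>, and \<open>Q(0) / \<Delta>\<close> differs from \<open>U(0)\<close> by
  a term of size \<open>\<rho>\<close> because \<open>V(0) = 0\<close>.\<close>

lemma low_frequency_wave_heat:
  assumes low: "\<rho> \<le> 3/4" and t: "t \<ge> 0"
  shows "norm (U t - exp (- s * t) *\<^sub>R U 0) \<le> (16 * exp (- \<rho> * t / 12) + 4 * \<rho> * exp (- \<rho>\<^sup>2 * t / 4)) * A"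
proof -
  note rp = rho_pos
  have rr: "\<rho>\<^sup>2 \<le> 9/16" using power_mono[OF low, of 2] rp by (simp add: power2_eq_square)
  have rr2: "\<rho>\<^sup>2 \<le> 3/4 * \<rho>" using low rp by (simp add: power2_eq_square)
  have su: "s \<le> 7/4 * \<rho>\<^sup>2"
  proof -
    have "\<rho>\<^sup>2 * (1 + \<rho>) \<le> \<rho>\<^sup>2 * (7/4)" using low by (intro mult_left_mono) auto
    with s_upper show ?thesis by linarith
  qed
  have sl: "4/7 * \<rho>\<^sup>2 \<le> s"
  proof -
    have "s * (\<rho> + 1) \<le> s * (7/4)" using low s_pos by (intro mult_left_mono) auto
    with s_lower show ?thesis by linarith
  qed
  have s1: "s \<le> 3/4" using s_less low by linarith
  have ss: "s\<^sup>2 \<le> \<rho>\<^sup>2" using s_pos s_less by (intro power_mono) auto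
  have pl: "\<rho> / 3 \<le> p"
  proof -
    have "p * (\<rho>\<^sup>2 + \<rho> + 1) \<le> p * 3" using p_pos low rr by (intro mult_left_mono) auto
    with p_lower show ?thesis by linarith
  qed
  have pu: "p \<le> \<rho>" using s_pos by (simp add: p_def)
  have sp: "0 \<le> s * p" "s * p \<le> 3/4 * (3/4)"
    using s_pos p_pos s1 pu low mult_mono[of s "3/4" p "3/4"] by auto
  have qu: "q \<le> 7/4" using sp low by (simp add: q_def)
  have ql: "4/7 \<le> q"
  proof -
    have "q * s \<ge> (4/7) * s" using q_eq su by (simp add: mult.commute)
    then show ?thesis using s_pos by simp
  qed
  have p2: "p\<^sup>2 / 4 \<le> 9/64"
    using power_mono[of p "3/4" 2] pu low p_pos by (simp add: power2_eq_square)
  have pq: "1/4 \<le> q - p\<^sup>2 / 4" using ql p2 by linarith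
  have sq: "1/2 \<le> sqrt (q - p\<^sup>2 / 4)" using pq by (intro real_le_rsqrt) (simp add: power2_eq_square)
  have sqq: "sqrt q \<le> 3/2" using qu by (intro real_le_lsqrt) (auto simp: power2_eq_square)
  have nY0: "norm (Y 0) \<le> A"
  proof -
    have "norm (Y 0) \<le> norm (U1 0) + s * norm (U 0)"
      unfolding Y_def using s_pos by (intro norm_triangle_le) auto
    also have "\<dots> \<le> norm (U1 0) + 1 * norm (U 0)" using s1 by (intro add_mono mult_right_mono) auto
    finally show ?thesis by (simp add: A_def)
  qed
  have nY10: "norm (Y1 0) \<le> A"
  proof -
    have "norm (Y1 0) \<le> \<rho> * norm (U 0) + s * norm (U1 0)"
      unfolding Y1_def using s_pos rp by (intro norm_triangle_le) (auto simp: V0)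
    also have "\<dots> \<le> 1 * norm (U 0) + 1 * norm (U1 0)" using s1 low by (intro add_mono mult_right_mono) auto
    finally show ?thesis by (simp add: A_def)
  qed
  let ?B = "exp (- (\<rho> / 6) * t / 2) * (norm (Y1 0) + p / 2 * norm (Y 0) + sqrt q * norm (Y 0) + 0 / (\<rho> / 6))"
  have k: "0 < \<rho> / 6" "2 * (\<rho> / 6) \<le> p" using rp pl by auto
  have B: "norm (Y1 t + (p / 2) *\<^sub>R Y t) \<le> ?B" "sqrt (q - p\<^sup>2 / 4) * norm (Y t) \<le> ?B"
    using underdamped_decay[OF Y Y1 _ k _ order_refl t] pq by simp_all
  define e where "e = exp (- \<rho> * t / 12)"
  have "?B \<le> e * (A + 3/8 * A + 3/2 * A + 0)"
    unfolding e_def using nY0 nY10 pu low sqq ql p_pos A_nonneg by (intro mult_mono add_mono) auto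
  also have "\<dots> = 23/8 * (e * A)" by simp
  finally have B3: "?B \<le> 23/8 * (e * A)" .
  have eA: "e * A \<ge> 0" using A_nonneg by (simp add: e_def)
  have "1/2 * norm (Y t) \<le> sqrt (q - p\<^sup>2 / 4) * norm (Y t)" using sq by (intro mult_right_mono) auto
  with B(2) B3 eA have nY: "norm (Y t) \<le> 6 * (e * A)" by linarith
  have "norm (Y1 t) \<le> norm (Y1 t + (p / 2) *\<^sub>R Y t) + norm ((p / 2) *\<^sub>R Y t)"
    by (metis add_diff_cancel_right' norm_triangle_ineq4)
  also have "norm ((p / 2) *\<^sub>R Y t) \<le> 3/8 * norm (Y t)"
    unfolding norm_scaleR using p_pos pu low by (intro mult_right_mono) auto
  finally have nY1: "norm (Y1 t) \<le> 6 * (e * A)" using B(1) B3 nY eA by linarith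
  have D1: "1 \<le> \<Delta>"
  proof -
    have "0 \<le> 2 * (s - \<rho>/2)\<^sup>2 + s\<^sup>2" by simp
    then have "3 * s\<^sup>2 - 2 * \<rho> * s \<ge> - \<rho>\<^sup>2 / 2" by (simp add: power2_eq_square algebra_simps)
    then show ?thesis using rr2 rp unfolding \<Delta>_def by linarith
  qed
  have "\<bar>q - \<rho> - \<Delta>\<bar> \<le> 4 * \<rho>"
  proof -
    have "q - \<rho> - \<Delta> = s * \<rho> - 2 * s\<^sup>2 - \<rho>" by (simp add: \<Delta>_def q_def p_def algebra_simps power2_eq_square)
    moreover have "0 \<le> s * \<rho>" "s * \<rho> \<le> 1 * \<rho>" using s_pos rp s1 by (auto intro!: mult_right_mono)
    moreover have "0 \<le> s\<^sup>2" by simp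
    ultimately show ?thesis using ss rr2 rp by linarith
  qed
  then have nQ0: "norm (Q 0 - \<Delta> *\<^sub>R U 0) \<le> 4 * \<rho> * A"
  proof -
    assume b: "\<bar>q - \<rho> - \<Delta>\<bar> \<le> 4 * \<rho>"
    have "Q 0 - \<Delta> *\<^sub>R U 0 = p *\<^sub>R U1 0 + (q - \<rho> - \<Delta>) *\<^sub>R U 0" by (simp add: Q0 algebra_simps)
    then have "norm (Q 0 - \<Delta> *\<^sub>R U 0) \<le> p * norm (U1 0) + \<bar>q - \<rho> - \<Delta>\<bar> * norm (U 0)"
      using p_pos norm_triangle_ineq[of "p *\<^sub>R U1 0" "(q - \<rho> - \<Delta>) *\<^sub>R U 0"] by simp
    also have "\<dots> \<le> 4 * \<rho> * norm (U1 0) + 4 * \<rho> * norm (U 0)"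
      using b pu rp by (intro add_mono mult_right_mono) auto
    finally show ?thesis by (simp add: A_def algebra_simps)
  qed
  define e' where "e' = exp (- s * t)"
  have e': "e' \<le> exp (- \<rho>\<^sup>2 * t / 4)"
  proof -
    have "\<rho>\<^sup>2 / 4 \<le> s" using sl zero_le_power2[of \<rho>] by linarith
    then have "\<rho>\<^sup>2 / 4 * t \<le> s * t" using t by (rule mult_right_mono)
    then show ?thesis by (simp add: e'_def)
  qed
  have "\<Delta> *\<^sub>R (U t - e' *\<^sub>R U 0) = e' *\<^sub>R (Q 0 - \<Delta> *\<^sub>R U 0) - Y1 t - (p - s) *\<^sub>R Y t"
    using U_decompose[of t] Q_decay[OF t] by (simp add: e'_def algebra_simps)
  then have "\<Delta> * norm (U t - e' *\<^sub>R U 0) = norm (e' *\<^sub>R (Q 0 - \<Delta> *\<^sub>R U 0) - Y1 t - (p - s) *\<^sub>R Y t)"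
    using D1 by (metis abs_of_pos less_le_trans norm_scaleR zero_less_one)
  also have "\<dots> \<le> norm (e' *\<^sub>R (Q 0 - \<Delta> *\<^sub>R U 0)) + norm (Y1 t) + norm ((p - s) *\<^sub>R Y t)"
    by (meson add_mono norm_triangle_ineq4 norm_triangle_le_diff order_refl order_trans)
  also have "\<dots> \<le> exp (- \<rho>\<^sup>2 * t / 4) * (4 * \<rho> * A) + 6 * (e * A) + 1 * (6 * (e * A))"
  proof -
    have "norm (e' *\<^sub>R (Q 0 - \<Delta> *\<^sub>R U 0)) = e' * norm (Q 0 - \<Delta> *\<^sub>R U 0)" by (simp add: e'_def)
    also have "\<dots> \<le> exp (- \<rho>\<^sup>2 * t / 4) * (4 * \<rho> * A)"
      using e' nQ0 by (intro mult_mono) auto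
    finally have 1: "norm (e' *\<^sub>R (Q 0 - \<Delta> *\<^sub>R U 0)) \<le> exp (- \<rho>\<^sup>2 * t / 4) * (4 * \<rho> * A)" .
    have "norm ((p - s) *\<^sub>R Y t) \<le> 1 * (6 * (e * A))"
      unfolding norm_scaleR using nY s1 s_pos p_pos pu low by (intro mult_mono) auto
    with 1 nY1 show ?thesis by linarith
  qed
  also have "\<dots> \<le> (16 * exp (- \<rho> * t / 12) + 4 * \<rho> * exp (- \<rho>\<^sup>2 * t / 4)) * A"
    using eA by (simp add: e_def algebra_simps)
  finally have "\<Delta> * norm (U t - e' *\<^sub>R U 0) \<le> (16 * exp (- \<rho> * t / 12) + 4 * \<rho> * exp (- \<rho>\<^sup>2 * t / 4)) * A" .
  moreover have "1 * norm (U t - e' *\<^sub>R U 0) \<le> \<Delta> * norm (U t - e' *\<^sub>R U 0)"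
    using D1 by (intro mult_right_mono) auto
  ultimately show ?thesis unfolding e'_def by linarith
qed

text \<open>\<open>exp (- s t) U(0)\<close> solves the equation for \<open>W\<close> up to a residual of size \<open>\<rho>^2\<close>.  The difference is
  an overdamped oscillator with coefficients \<open>1/\<rho>\<close> and \<open>\<rho>\<close>, whose slow rate is \<open>\<rho>^2\<close>, so the residual
  costs no power of \<open>\<rho>\<close> when divided by the rate, and the prefactor \<open>\<rho>\<close> of the overdamped estimate survives.\<close>

lemma low_frequency_riesz_damped:
  assumes low: "\<rho> \<le> 3/4" and t: "t \<ge> 0"
    and W: "evolves W W1" and W1: "evolves W1 (\<lambda>t. - (\<rho> *\<^sub>R W t) - (1 / \<rho>) *\<^sub>R W1 t)"
    and W0: "W 0 = U 0"
  shows "norm (W t - exp (- s * t) *\<^sub>R U 0) \<le> 18 * \<rho> * exp (- \<rho>\<^sup>2 * t / 4) * (A + norm (W1 0))"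
proof -
  note rp = rho_pos
  have rr: "\<rho>\<^sup>2 \<le> 9/16" using power_mono[OF low, of 2] rp by (simp add: power2_eq_square)
  have su: "s \<le> 7/4 * \<rho>\<^sup>2"
  proof -
    have "\<rho>\<^sup>2 * (1 + \<rho>) \<le> \<rho>\<^sup>2 * (7/4)" using low by (intro mult_left_mono) auto
    with s_upper show ?thesis by linarith
  qed
  have sl: "1/2 * \<rho>\<^sup>2 \<le> s"
  proof -
    have "s * (\<rho> + 1) \<le> s * (7/4)" using low s_pos by (intro mult_left_mono) auto
    with s_lower zero_le_power2[of \<rho>] show ?thesis by linarith
  qed
  define D where "D t = W t - exp (- s * t) *\<^sub>R U 0" for t
  define D1 where "D1 t = W1 t - (- s * exp (- s * t)) *\<^sub>R U 0" for t
  define F where "F t = (- (s\<^sup>2 - s / \<rho> + \<rho>) * exp (- s * t)) *\<^sub>R U 0" for t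
  have D: "evolves D D1" unfolding D_def D1_def by (intro evolves_diff W evolves_exp)
  have D1: "evolves D1 (\<lambda>t. F t - (1 / \<rho>) *\<^sub>R D1 t - \<rho> *\<^sub>R D t)"
  proof (rule evolves_cong)
    have "evolves (\<lambda>t. (- s * exp (- s * t)) *\<^sub>R U 0) (\<lambda>t. (s\<^sup>2 * exp (- s * t)) *\<^sub>R U 0)"
      using evolves_scaleR[OF evolves_exp[of "- s" "U 0"], of "- s"] by (simp add: power2_eq_square mult.assoc)
    then show "evolves D1 (\<lambda>t. (- (\<rho> *\<^sub>R W t) - (1 / \<rho>) *\<^sub>R W1 t) - (s\<^sup>2 * exp (- s * t)) *\<^sub>R U 0)"
      unfolding D1_def by (intro evolves_diff W1)
    fix t
    show "(- (\<rho> *\<^sub>R W t) - (1 / \<rho>) *\<^sub>R W1 t) - (s\<^sup>2 * exp (- s * t)) *\<^sub>R U 0 = F t - (1 / \<rho>) *\<^sub>R D1 t - \<rho> *\<^sub>R D t"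
      by (simp add: F_def D1_def D_def algebra_simps)
  qed
  have Fb: "norm (F t) \<le> (4 * \<rho>\<^sup>2 * norm (U 0)) * exp (- (\<rho>\<^sup>2 / 2) * t)" if "t > 0" for t
  proof -
    have "s / \<rho> = s\<^sup>2 + \<rho> - s ^ 3 / \<rho> - s"
      using root rp by (simp add: field_simps power2_eq_square power3_eq_cube)
    moreover have "s ^ 3 / \<rho> \<le> s"
    proof -
      have "s * (s * s) \<le> s * (\<rho> * 1)" using s_pos s_less low by (intro mult_left_mono mult_mono) auto
      then show ?thesis using rp by (simp add: field_simps power3_eq_cube)
    qed
    moreover have "0 \<le> s ^ 3 / \<rho>" using s_pos rp by simp
    ultimately have "\<bar>s\<^sup>2 - s / \<rho> + \<rho>\<bar> \<le> 4 * \<rho>\<^sup>2" using su s_pos by linarith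
    moreover have "exp (- s * t) \<le> exp (- (\<rho>\<^sup>2 / 2) * t)"
      using sl that by (auto intro!: mult_right_mono)
    ultimately have "\<bar>s\<^sup>2 - s / \<rho> + \<rho>\<bar> * exp (- s * t) * norm (U 0) \<le> 4 * \<rho>\<^sup>2 * exp (- (\<rho>\<^sup>2 / 2) * t) * norm (U 0)"
      by (intro mult_right_mono mult_mono) auto
    moreover have "norm (F t) = \<bar>s\<^sup>2 - s / \<rho> + \<rho>\<bar> * exp (- s * t) * norm (U 0)"
      by (simp only: F_def norm_scaleR abs_mult abs_minus_cancel abs_exp_cancel)
    ultimately show ?thesis by (simp add: mult_ac)
  qed
  have r3: "2 * \<rho>\<^sup>2 * \<rho> \<le> 1"
  proof -
    have "\<rho>\<^sup>2 * \<rho> \<le> (9/16) * (3/4)" using rr low rp by (intro mult_mono) auto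
    then show ?thesis by linarith
  qed
  have "norm (D t) \<le> 2 / (1 / \<rho>) * exp (- (\<rho>\<^sup>2 / 2) * t / 2) * (norm (D1 0) + (4 * \<rho>\<^sup>2 * norm (U 0)) / (\<rho>\<^sup>2 / 2))"
  proof (rule overdamped_decay[OF D D1 Fb])
    show "\<rho>\<^sup>2 / 2 \<le> 1 / \<rho> - \<rho> / (1 / \<rho>)"
    proof -
      have "2 * \<rho>\<^sup>2 \<le> 1 / \<rho>" using r3 rp by (simp add: field_simps)
      moreover have "\<rho>\<^sup>2 \<ge> 0" by simp
      ultimately have "\<rho>\<^sup>2 / 2 \<le> 1 / \<rho> - \<rho>\<^sup>2" by linarith
      then show ?thesis by (simp add: power2_eq_square)
    qed
  qed (use rp t W0 in \<open>auto simp: D_def power2_eq_square\<close>)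
  also have "\<dots> = 2 * \<rho> * exp (- \<rho>\<^sup>2 * t / 4) * (norm (D1 0) + 8 * norm (U 0))"
    using rp by simp
  also have "\<dots> \<le> 2 * \<rho> * exp (- \<rho>\<^sup>2 * t / 4) * (9 * (A + norm (W1 0)))"
  proof (intro mult_left_mono)
    have "norm (D1 0) \<le> norm (W1 0) + s * norm (U 0)"
      unfolding D1_def using s_pos by (auto intro: norm_triangle_le)
    moreover have "s * norm (U 0) \<le> norm (U 0)" using s_less low mult_right_mono[of s 1 "norm (U 0)"] by auto
    moreover have "norm (U 0) \<le> A" "0 \<le> norm (W1 0)" by (auto simp: U0_le)
    ultimately show "norm (D1 0) + 8 * norm (U 0) \<le> 9 * (A + norm (W1 0))"
      by (smt (verit))
  qed (use rp in auto)
  finally show ?thesis by (simp add: D_def algebra_simps)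
qed

text \<open>The fast mode \<open>Q\<close> and the perturbations \<open>p - 1/\<rho>\<close> and \<open>q - \<rho>\<close> of the coefficients are collected in
  the forcing \<open>F\<close> of an oscillator for \<open>U - W\<close>.  Since \<open>U\<close> itself is controlled by the
  underdamped estimate, \<open>F\<close> has size \<open>1/\<rho>\<close>, which is compensated by the rate \<open>1/\<rho>\<close>.  The splitting point
  \<open>\<rho> = 3/4\<close> is chosen so that the equation for \<open>W\<close> is underdamped above it (\<open>4 \<rho>^3 > 1\<close>) and
  overdamped with room below it (\<open>2 \<rho>^3 \<le> 1\<close>).\<close>

lemma high_frequency_difference:
  assumes high: "3/4 \<le> \<rho>" and t: "t \<ge> 0"
    and W: "evolves W W1" and W1: "evolves W1 (\<lambda>t. - (\<rho> *\<^sub>R W t) - (1 / \<rho>) *\<^sub>R W1 t)"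
    and W0: "W 0 = U 0"
  shows "norm (U t - W t) \<le> 2000000 / sqrt \<rho> * exp (- t / (40 * \<rho>)) * (A + norm (W1 0))"
proof -
  note rp = rho_pos
  define r where "r = sqrt \<rho>"
  have r: "r > 0" "\<rho> = r\<^sup>2" using rp by (auto simp: r_def)
  have r34: "3/4 \<le> r" unfolding r_def using high by (intro real_le_rsqrt) (simp add: power2_eq_square)
  have rr: "3/4 * \<rho> \<le> \<rho>\<^sup>2" using high rp by (simp add: power2_eq_square)
  have sl: "3/7 * \<rho> \<le> s"
  proof -
    have "\<rho> * (3/7 * (\<rho> + 1)) \<le> \<rho> * \<rho>" using high rp by (intro mult_left_mono) auto
    with s_lower have "(3/7 * \<rho>) * (\<rho> + 1) \<le> s * (\<rho> + 1)" by (simp add: power2_eq_square algebra_simps)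
    then show ?thesis using rp by simp
  qed
  have ss: "9/49 * \<rho>\<^sup>2 \<le> s\<^sup>2"
    using power_mono[OF sl, of 2] rp by (simp add: power_mult_distrib power2_eq_square)
  have aux: "x \<le> 6 / \<rho>" if "x * (s\<^sup>2 + c) = \<rho>" "0 \<le> c" "0 \<le> x" for x c
  proof -
    have "x * (9/49 * \<rho>\<^sup>2) \<le> x * (s\<^sup>2 + c)" using that ss by (intro mult_left_mono) auto
    then have "(9/49 * (x * \<rho>)) * \<rho> \<le> 1 * \<rho>" using that by (simp add: power2_eq_square algebra_simps)
    then have "9/49 * (x * \<rho>) \<le> 1" using rp by (rule mult_right_le_imp_le)
    then have "x * \<rho> \<le> 49/9" by simp
    then have "x * \<rho> \<le> 6" by simp
    then show ?thesis using rp by (simp add: pos_le_divide_eq)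
  qed
  have pu: "p \<le> 6 / \<rho>" 
    by (rule aux[of p "\<rho> + 1"]) (use p_eq p_pos rp in \<open>auto simp: add.assoc\<close>)
  have pl: "1 / (5 * \<rho>) \<le> p"
  proof -
    have "\<rho>\<^sup>2 + \<rho> + 1 \<le> 5 * \<rho>\<^sup>2" using rr high by linarith
    then have "p * (\<rho>\<^sup>2 + \<rho> + 1) \<le> p * (5 * \<rho>\<^sup>2)" using p_pos by (intro mult_left_mono) auto
    with p_lower have "1 * \<rho> \<le> (p * (5 * \<rho>)) * \<rho>" by (simp add: power2_eq_square algebra_simps)
    then have "1 \<le> p * (5 * \<rho>)" using rp by (simp add: mult_le_cancel_right)
    then show ?thesis using rp by (simp add: field_simps)
  qed
  have p1: "p \<le> 1"
  proof -
    have "p * (s\<^sup>2 + \<rho> + 1) \<ge> p * \<rho>" using p_pos by (intro mult_left_mono) auto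
    with p_eq have "p * \<rho> \<le> 1 * \<rho>" by simp
    then show ?thesis using rp by (simp add: mult_le_cancel_right)
  qed
  have qp: "q - \<rho> \<ge> 0" using q_rho rp by (smt (verit) mult_nonpos_nonneg mult_neg_pos zero_le_power2)
  have qu: "q - \<rho> \<le> 6 / \<rho>" using aux[of "q - \<rho>" \<rho>] q_rho qp rp by simp
  have q1: "q \<le> 3 * \<rho>" using p_pos s_pos high mult_pos_pos[OF s_pos p_pos] unfolding q_def by linarith
  have p2: "p\<^sup>2 \<le> 1" using p1 p_pos by (simp add: power_le_one)
  have pq: "\<rho> / 4 \<le> q - p\<^sup>2 / 4" using p2 qp high by linarith
  have sq: "r / 2 \<le> sqrt (q - p\<^sup>2 / 4)"
    using pq by (intro real_le_rsqrt) (simp add: r power2_eq_square)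
  have sqq: "sqrt q \<le> 2 * r" 
  proof (rule real_le_lsqrt)
    show "q \<le> (2 * r)\<^sup>2" using q1 rp by (simp add: power_mult_distrib flip: r(2))
  qed (use r(1) in auto)
  define e where "e = exp (- t / (20 * \<rho>))"
  have Q0b: "norm (Q 0) \<le> 6 / \<rho> * A"
  proof -
    have "norm (Q 0) \<le> p * norm (U1 0) + (q - \<rho>) * norm (U 0)"
      unfolding Q0 using p_pos qp by (intro norm_triangle_le) auto
    also have "\<dots> \<le> 6 / \<rho> * norm (U1 0) + 6 / \<rho> * norm (U 0)"
      using pu qu by (intro add_mono mult_right_mono) auto
    finally show ?thesis by (simp add: A_def algebra_simps)
  qed
  have Qb: "norm (Q t) \<le> 6 / \<rho> * A * exp (- (1 / (10 * \<rho>)) * t)" if "t > 0" for t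
  proof -
    have "1 / (10 * \<rho>) \<le> s"
    proof -
      have "1 \<le> (3/7 * \<rho>) * (10 * \<rho>)" using mult_mono[OF high high] rp by simp
      also have "\<dots> \<le> s * (10 * \<rho>)" using sl rp by (intro mult_right_mono) auto
      finally show ?thesis using rp by (simp add: field_simps)
    qed
    then have "1 / (10 * \<rho>) * t \<le> s * t" using that by (intro mult_right_mono) auto
    then have "exp (- s * t) \<le> exp (- (1 / (10 * \<rho>)) * t)" by simp
    then have "exp (- s * t) * norm (Q 0) \<le> exp (- (1 / (10 * \<rho>)) * t) * (6 / \<rho> * A)"
      using Q0b by (intro mult_mono) auto
    moreover have "norm (Q t) = exp (- s * t) * norm (Q 0)" using Q_decay[of t] that by simp
    ultimately show ?thesis by (simp add: mult_ac)
  qed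
  have k: "0 < 1 / (10 * \<rho>)" "2 * (1 / (10 * \<rho>)) \<le> p" using rp pl by auto
  have Ub: "norm (U t) \<le> 170 * A * exp (- t / (20 * \<rho>))" "norm (U1 t) \<le> 200 * r * A * exp (- t / (20 * \<rho>))" if "t \<ge> 0" for t
  proof -
    define e where "e = exp (- t / (20 * \<rho>))"
    let ?B = "exp (- (1 / (10 * \<rho>)) * t / 2) * (norm (U1 0) + p / 2 * norm (U 0) + sqrt q * norm (U 0) + (6 / \<rho> * A) / (1 / (10 * \<rho>)))"
    have B: "norm (U1 t + (p / 2) *\<^sub>R U t) \<le> ?B" "sqrt (q - p\<^sup>2 / 4) * norm (U t) \<le> ?B"
      using underdamped_decay[OF U U1' Qb k _ _ that] pq rp A_nonneg by simp_all
    have "?B \<le> e * (A + 1 / 2 * A + 2 * r * A + 60 * A)"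
      using U0_le U10_le p1 sqq A_nonneg r rp p_pos q1 qp
      by (intro mult_mono add_mono) (auto simp: e_def)
    also have "\<dots> \<le> 85 * r * (e * A)"
    proof -
      have "A * e \<ge> 0" using A_nonneg by (simp add: e_def)
      then have "A * e * (3/4) \<le> A * e * r" using r34 by (intro mult_left_mono)
      then show ?thesis using \<open>A * e \<ge> 0\<close> by (simp add: algebra_simps)
    qed
    finally have B3: "?B \<le> 85 * r * (e * A)" .
    have "r / 2 * norm (U t) \<le> sqrt (q - p\<^sup>2 / 4) * norm (U t)" using sq by (intro mult_right_mono) auto
    with B(2) B3 have "r * norm (U t) \<le> r * (170 * (e * A))" by linarith
    then have nU: "norm (U t) \<le> 170 * (e * A)" using r by (simp only: mult_le_cancel_left_pos)
    then show "norm (U t) \<le> 170 * A * exp (- t / (20 * \<rho>))" by (simp add: e_def mult_ac)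
    have "norm (U1 t) \<le> norm (U1 t + (p / 2) *\<^sub>R U t) + norm ((p / 2) *\<^sub>R U t)"
      by (metis add_diff_cancel_right' norm_triangle_ineq4)
    also have "norm ((p / 2) *\<^sub>R U t) \<le> 1/2 * norm (U t)"
      unfolding norm_scaleR using p_pos p1 by (intro mult_right_mono) auto
    finally have "norm (U1 t) \<le> 85 * r * (e * A) + 85 * (e * A)" using B(1) B3 nU by linarith
    moreover have "3/4 * (e * A) \<le> r * (e * A)" using r34 A_nonneg by (intro mult_right_mono) (auto simp: e_def)
    moreover have "0 \<le> e * A" using A_nonneg by (simp add: e_def)
    ultimately have "norm (U1 t) \<le> 200 * (r * (e * A))" unfolding mult.assoc by linarith
    then show "norm (U1 t) \<le> 200 * r * A * exp (- t / (20 * \<rho>))" by (simp add: e_def mult_ac)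
  qed
  define D where "D t = U t - W t" for t
  define D1 where "D1 t = U1 t - W1 t" for t
  define F where "F t = Q t - (p - 1 / \<rho>) *\<^sub>R U1 t - (q - \<rho>) *\<^sub>R U t" for t
  have D: "evolves D D1" unfolding D_def D1_def by (intro evolves_diff U W)
  have D1: "evolves D1 (\<lambda>t. F t - (1 / \<rho>) *\<^sub>R D1 t - \<rho> *\<^sub>R D t)"
  proof (rule evolves_cong)
    show "evolves D1 (\<lambda>t. (Q t - p *\<^sub>R U1 t - q *\<^sub>R U t) - (- (\<rho> *\<^sub>R W t) - (1 / \<rho>) *\<^sub>R W1 t))"
      unfolding D1_def by (intro evolves_diff U1' W1)
    show "(Q t - p *\<^sub>R U1 t - q *\<^sub>R U t) - (- (\<rho> *\<^sub>R W t) - (1 / \<rho>) *\<^sub>R W1 t) = F t - (1 / \<rho>) *\<^sub>R D1 t - \<rho> *\<^sub>R D t" for t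
      by (simp add: F_def D1_def D_def algebra_simps)
  qed
  have pd: "\<bar>p - 1 / \<rho>\<bar> \<le> 110 / \<rho>\<^sup>2"
  proof -
    have S: "9/49 * \<rho>\<^sup>2 \<le> s\<^sup>2 + \<rho> + 1" using ss rp by linarith
    have Sp: "0 < s\<^sup>2 + \<rho> + 1" using rp by (simp add: add_nonneg_pos)
    have "(\<rho> * p - 1) * (s\<^sup>2 + \<rho> + 1) = p * (\<rho> + s) - \<rho> - 1"
    proof -
      have "(\<rho> * p - 1) * (s\<^sup>2 + \<rho> + 1) = \<rho> * (p * (s\<^sup>2 + \<rho> + 1)) - (s\<^sup>2 + \<rho> + 1)"
        by (simp add: algebra_simps)
      also have "\<dots> = p * (\<rho> + s) - \<rho> - 1"
        unfolding p_eq by (simp add: p_def algebra_simps power2_eq_square)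
      finally show ?thesis .
    qed
    moreover have "p * (\<rho> + s) \<le> 12"
    proof -
      have "p * (\<rho> + s) \<le> (6 / \<rho>) * (2 * \<rho>)" using pu p_pos s_pos s_less rp by (intro mult_mono) auto
      then show ?thesis using rp by simp
    qed
    moreover have "0 \<le> p * (\<rho> + s)" using p_pos rp s_pos by simp
    ultimately have "\<bar>(\<rho> * p - 1) * (s\<^sup>2 + \<rho> + 1)\<bar> \<le> 20 * \<rho>" using high by linarith
    then have "\<bar>\<rho> * p - 1\<bar> * (s\<^sup>2 + \<rho> + 1) \<le> 20 * \<rho>" using Sp by (simp add: abs_mult)
    moreover have "\<bar>\<rho> * p - 1\<bar> * (9/49 * \<rho>\<^sup>2) \<le> \<bar>\<rho> * p - 1\<bar> * (s\<^sup>2 + \<rho> + 1)"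
      using S by (intro mult_left_mono) auto
    ultimately have "\<bar>\<rho> * p - 1\<bar> * (9/49 * \<rho>\<^sup>2) \<le> 20 * \<rho>" by linarith
    then have "(9/49 * (\<bar>\<rho> * p - 1\<bar> * \<rho>)) * \<rho> \<le> 20 * \<rho>" by (simp add: power2_eq_square mult_ac)
    then have "9/49 * (\<bar>\<rho> * p - 1\<bar> * \<rho>) \<le> 20" using rp by (rule mult_right_le_imp_le)
    then have "\<bar>\<rho> * p - 1\<bar> * \<rho> \<le> 110" by linarith
    then have "\<bar>\<rho> * p - 1\<bar> \<le> 110 / \<rho>" using rp by (simp add: pos_le_divide_eq)
    then have "\<bar>\<rho> * p - 1\<bar> / \<rho> \<le> 110 / \<rho> / \<rho>" using rp by (intro divide_right_mono) auto
    moreover have "p - 1 / \<rho> = (\<rho> * p - 1) / \<rho>" using rp by (simp add: diff_divide_distrib)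
    ultimately show ?thesis using rp by (simp add: power2_eq_square)
  qed
  have Fb: "norm (F t) \<le> (31000 / \<rho> * A) * exp (- (1 / (20 * \<rho>)) * t)" if "t > 0" for t
  proof -
    define e where "e = exp (- t / (20 * \<rho>))"
    have e: "e > 0" "e = exp (- (1 / (20 * \<rho>)) * t)" by (auto simp: e_def)
    have Ae: "A * e \<ge> 0" using A_nonneg e by simp
    define X where "X = 1 / \<rho> * (A * e)"
    have X: "X \<ge> 0" using Ae rp by (simp add: X_def)
    have "norm (F t) \<le> norm (Q t - (p - 1 / \<rho>) *\<^sub>R U1 t) + norm ((q - \<rho>) *\<^sub>R U t)"
      unfolding F_def by (rule norm_triangle_ineq4)
    moreover have "norm (Q t - (p - 1 / \<rho>) *\<^sub>R U1 t) \<le> norm (Q t) + norm ((p - 1 / \<rho>) *\<^sub>R U1 t)"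
      by (rule norm_triangle_ineq4)
    moreover have "norm (Q t) \<le> 6 * X"
    proof -
      have "norm (Q t) \<le> 6 / \<rho> * A * exp (- (1 / (10 * \<rho>)) * t)" by (rule Qb[OF that])
      also have "\<dots> \<le> 6 / \<rho> * A * e"
        using A_nonneg rp that by (intro mult_left_mono) (auto simp: e_def field_simps)
      finally show ?thesis by (simp add: X_def mult_ac)
    qed
    moreover have "norm ((p - 1 / \<rho>) *\<^sub>R U1 t) \<le> 29500 * X"
    proof -
      have "norm ((p - 1 / \<rho>) *\<^sub>R U1 t) \<le> 110 / \<rho>\<^sup>2 * (200 * r * A * e)"
        unfolding norm_scaleR using pd Ub(2)[of t] that by (intro mult_mono) (auto simp: e_def)
      also have "\<dots> = 22000 * (r / \<rho>) * X" by (simp add: X_def power2_eq_square)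
      also have "\<dots> \<le> 22000 * (4/3) * X"
      proof (intro mult_right_mono mult_left_mono X)
        have "r / \<rho> = 1 / r" using r(1) unfolding r(2) by (simp add: power2_eq_square)
        then show "r / \<rho> \<le> 4/3" using r34 r(1) by (simp add: field_simps)
      qed auto
      finally show ?thesis using X by linarith
    qed
    moreover have "norm ((q - \<rho>) *\<^sub>R U t) \<le> 1020 * X"
    proof -
      have "norm ((q - \<rho>) *\<^sub>R U t) \<le> 6 / \<rho> * (170 * A * e)"
        unfolding norm_scaleR using qu qp rp Ub(1)[of t] that by (intro mult_mono) (auto simp: e_def)
      then show ?thesis by (simp add: X_def mult_ac)
    qed
    ultimately have "norm (F t) \<le> 31000 * X" using X by linarith
    then show ?thesis unfolding X_def e(2) by (simp add: mult_ac)
  qed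
  have iq: "\<rho> / 4 \<le> \<rho> - (1 / \<rho>)\<^sup>2 / 4"
  proof -
    have "27/64 \<le> \<rho> ^ 3" using power_mono[OF high, of 3] by (simp add: power3_eq_cube)
    then have "1 \<le> 3 * \<rho> ^ 3" by linarith
    then have "(1 / \<rho>)\<^sup>2 \<le> 3 * \<rho>" using rp by (simp add: field_simps power2_eq_square power3_eq_cube)
    then show ?thesis by linarith
  qed
  have iq': "r / 2 \<le> sqrt (\<rho> - (1 / \<rho>)\<^sup>2 / 4)"
    using iq by (intro real_le_rsqrt) (simp add: r power2_eq_square)
  have k': "0 < 1 / (20 * \<rho>)" "2 * (1 / (20 * \<rho>)) \<le> 1 / \<rho>" "0 \<le> 31000 / \<rho> * A"
    using rp A_nonneg by (auto simp: field_simps)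
  have k'': "(1 / \<rho>)\<^sup>2 / 4 < \<rho>" using iq rp by linarith
  have "r / 2 * norm (D t) \<le> sqrt (\<rho> - (1 / \<rho>)\<^sup>2 / 4) * norm (D t)" using iq' by (intro mult_right_mono) auto
  also have "\<dots> \<le> exp (- (1 / (20 * \<rho>)) * t / 2) *
    (norm (D1 0) + 1 / \<rho> / 2 * norm (D 0) + sqrt \<rho> * norm (D 0) + 31000 / \<rho> * A / (1 / (20 * \<rho>)))"
    by (rule underdamped_decay(2)[OF D D1 Fb k'(1,2) k'' k'(3) t])
  also have "\<dots> = exp (- t / (40 * \<rho>)) * (norm (D1 0) + 620000 * A)"
    using rp by (simp add: D_def W0)
  also have "\<dots> \<le> exp (- t / (40 * \<rho>)) * (1000000 * (A + norm (W1 0)))"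
  proof (intro mult_left_mono)
    have "norm (D1 0) \<le> norm (U1 0) + norm (W1 0)" unfolding D1_def by (rule norm_triangle_ineq4)
    then show "norm (D1 0) + 620000 * A \<le> 1000000 * (A + norm (W1 0))"
      using U10_le A_nonneg norm_ge_zero[of "W1 0"] by (smt (verit))
  qed auto
  finally have "norm (D t) * r \<le> 2000000 * exp (- t / (40 * \<rho>)) * (A + norm (W1 0))" by (simp add: algebra_simps)
  then have "norm (D t) \<le> 2000000 * exp (- t / (40 * \<rho>)) * (A + norm (W1 0)) / r"
    using r by (simp add: pos_le_divide_eq)
  then show ?thesis by (simp add: D_def r_def)
qed

lemma low_frequency_difference:
  assumes low: "\<rho> \<le> 3/4" and t: "t \<ge> 0"
    and W: "evolves W W1" and W1: "evolves W1 (\<lambda>t. - (\<rho> *\<^sub>R W t) - (1 / \<rho>) *\<^sub>R W1 t)"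
    and W0: "W 0 = U 0"
  shows "norm (U t - W t) \<le> 22 * (exp (- \<rho> * t / 12) + \<rho> * exp (- \<rho>\<^sup>2 * t / 4)) * (A + norm (W1 0))"
proof -
  let ?a = "exp (- \<rho> * t / 12)" and ?b = "\<rho> * exp (- \<rho>\<^sup>2 * t / 4)"
  have "norm (U t - W t) \<le> norm (U t - exp (- s * t) *\<^sub>R U 0) + norm (W t - exp (- s * t) *\<^sub>R U 0)"
    using norm_triangle_ineq4[of "U t - exp (- s * t) *\<^sub>R U 0" "W t - exp (- s * t) *\<^sub>R U 0"] by simp
  also have "\<dots> \<le> (16 * ?a + 4 * ?b) * A + 18 * ?b * (A + norm (W1 0))"
    using low_frequency_wave_heat[OF low t] low_frequency_riesz_damped[OF low t W W1 W0] by (simp add: mult.assoc)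
  also have "\<dots> \<le> 22 * ?a * (A + norm (W1 0)) + 22 * ?b * (A + norm (W1 0))"
  proof -
    have "0 \<le> ?a * A" "0 \<le> ?a * norm (W1 0)" "0 \<le> ?b * A" "0 \<le> ?b * norm (W1 0)"
      using A_nonneg rho_pos by auto
    then show ?thesis unfolding distrib_left distrib_right by linarith
  qed
  finally show ?thesis by (simp add: algebra_simps)
qed

end

section \<open>Decay of a single frequency\<close>

lemma powr_exp_bounded:
  assumes l: "l \<ge> 0" and k: "(k::real) > 0"
  obtains K where "K > 0" "\<And>x. x > 0 \<Longrightarrow> x powr l * exp (- k * x) \<le> K"
proof (cases "l = 0")
  case True
  then show ?thesis using k by (intro that[of 1]) auto
next
  case False
  then have l: "l > 0" using l by simp
  have "x powr l * exp (- k * x) \<le> exp (l * ln (l / k))" if x: "x > 0" for x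
  proof -
    have "ln (x * k / l) \<le> x * k / l - 1" using x k l by (intro ln_le_minus_one) auto
    then have "ln x \<le> ln (l / k) + x * k / l" using x k l by (simp add: ln_mult ln_div)
    then have "l * ln x \<le> l * (ln (l / k) + x * k / l)" using l by (intro mult_left_mono) auto
    also have "\<dots> = l * ln (l / k) + k * x" using l by (simp add: distrib_left mult.commute)
    finally have "l * ln x - k * x \<le> l * ln (l / k)" by simp
    then show ?thesis using x by (simp add: powr_def flip: exp_add)
  qed
  then show ?thesis by (intro that[of "exp (l * ln (l / k))"]) auto
qed

lemma exp_shift_time:
  fixes c t :: real
  assumes "c \<le> 1" shows "exp (- c * t) \<le> 3 * exp (- c * (1 + t))"
proof -
  have "exp (- c * t) = exp c * exp (- c * (1 + t))" by (simp add: algebra_simps flip: exp_add)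
  also have "\<dots> \<le> 3 * exp (- c * (1 + t))"
    using assms exp_le by (intro mult_right_mono) (auto intro: order_trans[of _ "exp 1"])
  finally show ?thesis .
qed

text \<open>The squared decay factors of the difference at the frequency \<open>\<rho> = |\<xi>|^2\<close> and the shifted time
  \<open>T = 1 + t\<close>: the first two come from low and the last one from high frequencies.\<close>

definition frequency_profile :: "real \<Rightarrow> real \<Rightarrow> real \<Rightarrow> real" where
  "frequency_profile l T \<rho> = exp (- \<rho> * T / 6) + \<rho>\<^sup>2 * exp (- \<rho>\<^sup>2 * T / 2) + T powr (- l) * (1 + \<rho>) powr (l - 1)"

text \<open>Squares of the two pointwise estimates, written with \<open>1 + t\<close> in place of \<open>t\<close>.  At high frequencies
  \<open>exp (- (1 + t) / (20 \<rho>))\<close> is traded for \<open>(\<rho> / (1 + t))^l\<close>, which together with the factor \<open>1 / \<rho>\<close>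
  produces the weight \<open>(1 + \<rho>)^(l - 1)\<close>.\<close>

lemma single_frequency_bound:
  assumes l: "l \<ge> 0"
  obtains C where "C > 0"
    "\<And>\<rho> U U1 V W W1 t. \<lbrakk>\<rho> > 0; evolves U U1; evolves U1 (\<lambda>t. - (\<rho> *\<^sub>R U t) - V t);
       evolves V (\<lambda>t. U1 t - \<rho> *\<^sub>R V t); V 0 = 0;
       evolves W W1; evolves W1 (\<lambda>t. - (\<rho> *\<^sub>R W t) - (1 / \<rho>) *\<^sub>R W1 t); W 0 = U 0; t \<ge> 0\<rbrakk>
     \<Longrightarrow> (norm (U t - W t :: complex))\<^sup>2 \<le>
         C * frequency_profile l (1 + t) \<rho> * (norm (U 0) + norm (U1 0) + norm (W1 0))\<^sup>2"
proof -
  obtain K where K: "K > 0" "\<And>x. x > 0 \<Longrightarrow> x powr l * exp (- (1/20) * x) \<le> K"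
    using powr_exp_bounded[OF l, of "1/20"] by auto
  define C where "C = 2904 + 28 * 10 ^ 12 * K"
  show thesis
  proof (rule that[of C])
    show "C > 0" using K by (simp add: C_def)
    fix \<rho> t :: real and U U1 V W W1 :: "real \<Rightarrow> complex"
    assume rp: "\<rho> > 0" and U: "evolves U U1" "evolves U1 (\<lambda>t. - (\<rho> *\<^sub>R U t) - V t)"
      and V: "evolves V (\<lambda>t. U1 t - \<rho> *\<^sub>R V t)" "V 0 = 0"
      and W: "evolves W W1" "evolves W1 (\<lambda>t. - (\<rho> *\<^sub>R W t) - (1 / \<rho>) *\<^sub>R W1 t)" "W 0 = U 0"
      and t: "t \<ge> 0"
    obtain s where "wave_heat_root \<rho> s" using wave_heat_root_exists[OF rp] .
    then interpret wave_heat_root \<rho> s .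
    interpret wave_heat_mode \<rho> s U U1 V by unfold_locales (use U V in auto)
    define a where "a = A + norm (W1 0)"
    have a_eq: "a = norm (U 0) + norm (U1 0) + norm (W1 0)" by (simp add: a_def A_def)
    define T where "T = 1 + t"
    have T: "T > 0" using t by (simp add: T_def)
    define E where "E = exp (- \<rho> * T / 6) + \<rho>\<^sup>2 * exp (- \<rho>\<^sup>2 * T / 2)"
    define H where "H = T powr (- l) * (1 + \<rho>) powr (l - 1)"
    have EH: "E \<ge> 0" "H \<ge> 0" by (auto simp: E_def H_def)
    have "(norm (U t - W t))\<^sup>2 \<le> C * (E + H) * a\<^sup>2"
    proof (cases "\<rho> \<le> 3/4")
      case True
      define x y where "x = exp (- \<rho> * t / 12)" and "y = exp (- \<rho>\<^sup>2 * t / 4)"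
      have "norm (U t - W t) \<le> 22 * (x + \<rho> * y) * a"
        unfolding x_def y_def a_def by (rule low_frequency_difference[OF True t W])
      then have "(norm (U t - W t))\<^sup>2 \<le> (22 * (x + \<rho> * y) * a)\<^sup>2" by (intro power_mono) auto
      also have "\<dots> = 484 * (x + \<rho> * y)\<^sup>2 * a\<^sup>2" by (simp only: power_mult_distrib) simp
      also have "\<dots> \<le> 484 * (2 * (3 * E)) * a\<^sup>2"
      proof (intro mult_right_mono mult_left_mono)
        have r1: "\<rho> / 6 \<le> 1" using True by simp
        have r2: "\<rho>\<^sup>2 / 2 \<le> 1" using power_mono[of \<rho> "3/4" 2] True rp by (simp add: power2_eq_square)
        have x2: "x\<^sup>2 = exp (- (\<rho> / 6) * t)" by (simp add: x_def power2_eq_square flip: exp_add)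
        have y2: "y\<^sup>2 = exp (- (\<rho>\<^sup>2 / 2) * t)" by (simp add: y_def power2_eq_square flip: exp_add)
        have "x\<^sup>2 \<le> 3 * exp (- (\<rho> / 6) * (1 + t))" "y\<^sup>2 \<le> 3 * exp (- (\<rho>\<^sup>2 / 2) * (1 + t))"
          unfolding x2 y2 by (rule exp_shift_time[OF r1], rule exp_shift_time[OF r2])
        then have "x\<^sup>2 \<le> 3 * exp (- \<rho> * T / 6)" "\<rho>\<^sup>2 * y\<^sup>2 \<le> \<rho>\<^sup>2 * (3 * exp (- \<rho>\<^sup>2 * T / 2))"
          by (auto simp: T_def intro!: mult_left_mono)
        then have "x\<^sup>2 + \<rho>\<^sup>2 * y\<^sup>2 \<le> 3 * E" by (simp add: E_def distrib_left mult.left_commute)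
        then have E: "2 * (x\<^sup>2 + \<rho>\<^sup>2 * y\<^sup>2) \<le> 2 * (3 * E)" by (rule mult_left_mono) simp
        have "(x + \<rho> * y)\<^sup>2 \<le> 2 * (x\<^sup>2 + \<rho>\<^sup>2 * y\<^sup>2)"
          using sum_squares_bound[of x "\<rho> * y"] by (simp add: power2_sum power_mult_distrib)
        from order_trans[OF this E] show "(x + \<rho> * y)\<^sup>2 \<le> 2 * (3 * E)" .
      qed auto
      also have "\<dots> = 2904 * E * a\<^sup>2" by simp
      also have "\<dots> \<le> C * (E + H) * a\<^sup>2"
        using EH K by (intro mult_right_mono mult_mono) (auto simp: C_def)
      finally show ?thesis .
    next
      case False
      then have high: "3/4 \<le> \<rho>" by simp
      have "norm (U t - W t) \<le> 2000000 / sqrt \<rho> * exp (- t / (40 * \<rho>)) * a"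
        unfolding a_def by (rule high_frequency_difference[OF high t W])
      then have "(norm (U t - W t))\<^sup>2 \<le> (2000000 / sqrt \<rho> * exp (- t / (40 * \<rho>)) * a)\<^sup>2" by (intro power_mono) auto
      also have "\<dots> = 4 * 10 ^ 12 * (1 / \<rho> * exp (- t / (20 * \<rho>))) * a\<^sup>2"
        using rp by (simp add: power_mult_distrib power_divide) (simp add: power2_eq_square flip: exp_add)
      also have "\<dots> \<le> 4 * 10 ^ 12 * (7 * K * H) * a\<^sup>2"
      proof (intro mult_right_mono mult_left_mono)
        have e: "exp (- t / (20 * \<rho>)) \<le> 3 * exp (- (1/20) * (T / \<rho>))"
        proof -
          have "1 / (20 * \<rho>) \<le> 1" using high by simp
          from exp_shift_time[OF this, of t] show ?thesis by (simp add: T_def)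
        qed
        have "T / \<rho> > 0" using T rp by simp
        from K(2)[OF this] have "exp (- (1/20) * (T / \<rho>)) \<le> K * (T / \<rho>) powr (- l)"
          using T rp by (simp add: powr_minus field_simps)
        also have "(T / \<rho>) powr (- l) = T powr (- l) * \<rho> powr l"
          using T rp by (simp add: powr_divide powr_minus field_simps)
        finally have "exp (- t / (20 * \<rho>)) \<le> 3 * (K * (T powr (- l) * \<rho> powr l))" using e by linarith
        then have "1 / \<rho> * exp (- t / (20 * \<rho>)) \<le> 1 / \<rho> * (3 * (K * (T powr (- l) * \<rho> powr l)))"
          using rp by (intro mult_left_mono) auto
        also have "\<dots> = 3 * K * T powr (- l) * \<rho> powr (l - 1)"
          using rp by (simp add: powr_diff)
        also have "\<dots> \<le> 3 * K * T powr (- l) * (7/3 * (1 + \<rho>) powr (l - 1))"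
        proof (intro mult_left_mono)
          \<comment> \<open>\<open>l - 1\<close> may be negative; as \<open>y\<close> lies between \<open>3/7\<close> and \<open>1\<close> and \<open>l - 1 \<ge> - 1\<close>, the
            power of \<open>y\<close> is at most \<open>7/3\<close>.\<close>
          define y where "y = \<rho> / (1 + \<rho>)"
          have y: "3/7 \<le> y" "y \<le> 1" using high by (auto simp: y_def field_simps)
          have "y powr (l - 1) \<le> y powr (- 1)" using y l by (intro powr_mono') auto
          also have "\<dots> \<le> 7/3" using y by (simp add: powr_minus field_simps)
          finally have "y powr (l - 1) * (1 + \<rho>) powr (l - 1) \<le> 7/3 * (1 + \<rho>) powr (l - 1)"
            by (intro mult_right_mono) auto
          moreover have "y powr (l - 1) * (1 + \<rho>) powr (l - 1) = \<rho> powr (l - 1)"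
            using rp by (subst powr_mult[symmetric]) (auto simp: y_def)
          ultimately show "\<rho> powr (l - 1) \<le> 7/3 * (1 + \<rho>) powr (l - 1)" by simp
        qed (use K in auto)
        also have "\<dots> = 7 * K * H" by (simp add: H_def)
        finally show "1 / \<rho> * exp (- t / (20 * \<rho>)) \<le> 7 * K * H" .
      qed auto
      also have "\<dots> = (28 * 10 ^ 12 * K) * H * a\<^sup>2" by simp
      also have "\<dots> \<le> C * (E + H) * a\<^sup>2"
        using EH K by (intro mult_right_mono mult_mono) (auto simp: C_def)
      finally show ?thesis .
    qed
    then show "(norm (U t - W t))\<^sup>2 \<le> C * frequency_profile l (1 + t) \<rho> * (norm (U 0) + norm (U1 0) + norm (W1 0))\<^sup>2"
      unfolding frequency_profile_def a_eq E_def H_def T_def .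
  qed
qed

section \<open>Decay in \<open>L\<^sup>2\<close>\<close>

lemma heat_profile_integral:
  fixes T :: real
  assumes T: "T > 0"
  shows "integrable lborel (\<lambda>\<xi>::'a::euclidean_space. exp (- (norm \<xi>)\<^sup>2 * T / 6))"
    and "(LINT \<xi>::'a|lborel. exp (- (norm \<xi>)\<^sup>2 * T / 6)) = (sqrt (2 * pi) / sqrt (1/3)) ^ DIM('a) * T powr (- real DIM('a) / 2)"
proof -
  define \<delta> where "\<delta> = sqrt (T / 3)"
  have \<delta>: "\<delta> > 0" using T by (simp add: \<delta>_def)
  have e: "exp (- (norm \<xi>)\<^sup>2 * T / 6) = gauss \<delta> \<xi>" for \<xi> :: 'a
    using T by (simp add: gauss_def \<delta>_def power_mult_distrib)
  show "integrable lborel (\<lambda>\<xi>::'a. exp (- (norm \<xi>)\<^sup>2 * T / 6))" unfolding e by (rule gauss_integral[OF \<delta>])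
  have d: "sqrt (2 * pi) / \<delta> = (sqrt (2 * pi) / sqrt (1/3)) * (1 / sqrt T)"
    unfolding \<delta>_def by (simp add: real_sqrt_divide)
  have "1 / sqrt T = T powr (- (1/2))"
    using T by (simp add: powr_minus_divide powr_half_sqrt)
  then have "(1 / sqrt T) ^ DIM('a) = T powr (real DIM('a) * - (1/2))"
    using T by (simp only:) (rule powr_power, simp)
  also have "real DIM('a) * - (1/2) = - real DIM('a) / 2" by simp
  finally show "(LINT \<xi>::'a|lborel. exp (- (norm \<xi>)\<^sup>2 * T / 6)) = (sqrt (2 * pi) / sqrt (1/3)) ^ DIM('a) * T powr (- real DIM('a) / 2)"
    unfolding e gauss_integral(2)[OF \<delta>] d power_mult_distrib by (simp only:)
qed

text \<open>The power of \<open>T\<close> comes from the substitution \<open>\<xi> \<mapsto> T^(1/4) \<xi>\<close>; the integral at \<open>T = 1\<close> is finite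
  by comparison with a Gaussian.\<close>

lemma fourth_order_profile_integral:
  fixes T :: real
  assumes T: "T > 0"
  shows "integrable lborel (\<lambda>\<xi>::'a::euclidean_space. ((norm \<xi>)\<^sup>2)\<^sup>2 * exp (- ((norm \<xi>)\<^sup>2)\<^sup>2 * T / 2))"
    and "(LINT \<xi>::'a|lborel. ((norm \<xi>)\<^sup>2)\<^sup>2 * exp (- ((norm \<xi>)\<^sup>2)\<^sup>2 * T / 2)) =
      (LINT \<xi>::'a|lborel. ((norm \<xi>)\<^sup>2)\<^sup>2 * exp (- ((norm \<xi>)\<^sup>2)\<^sup>2 / 2)) * T powr (- 1 - real DIM('a) / 4)"
proof -
  define h where "h \<xi> = ((norm \<xi>)\<^sup>2)\<^sup>2 * exp (- ((norm \<xi>)\<^sup>2)\<^sup>2 / 2)" for \<xi> :: 'a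
  have h_meas[measurable]: "h \<in> borel_measurable borel" unfolding h_def by measurable
  have h: "integrable lborel h"
  proof (rule Bochner_Integration.integrable_bound)
    show "integrable lborel (\<lambda>\<xi>::'a. (4 * exp (1/4)) * gauss 1 \<xi>)"
      by (intro integrable_mult_right gauss_integral) simp
    show "AE \<xi> in lborel. norm (h \<xi>) \<le> norm ((4 * exp (1/4)) * gauss 1 \<xi>)"
    proof (rule AE_I2)
      fix \<xi> :: 'a
      define y where "y = (norm \<xi>)\<^sup>2"
      have "y\<^sup>2 / 4 \<le> exp (y\<^sup>2 / 4)" using exp_ge_add_one_self[of "y\<^sup>2 / 4"] by linarith
      then have "y\<^sup>2 * exp (- y\<^sup>2 / 2) \<le> (4 * exp (y\<^sup>2 / 4)) * exp (- y\<^sup>2 / 2)"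
        by (intro mult_right_mono) auto
      also have "\<dots> = 4 * exp (- y\<^sup>2 / 4)" by (simp flip: exp_add)
      also have "\<dots> \<le> 4 * (exp (1/4) * exp (- y / 2))"
      proof -
        have "0 \<le> (y - 1)\<^sup>2" by simp
        then have "- y\<^sup>2 / 4 \<le> 1/4 + - y / 2" by (simp add: power2_diff)
        then show ?thesis unfolding exp_add[symmetric] by simp
      qed
      finally show "norm (h \<xi>) \<le> norm ((4 * exp (1/4)) * gauss 1 \<xi>)"
        by (simp add: h_def y_def gauss_def abs_mult)
    qed
  qed simp
  define \<delta> where "\<delta> = T powr (1/4)"
  have \<delta>: "\<delta> > 0" using T by (simp add: \<delta>_def)
  have \<delta>4: "(\<delta>\<^sup>2)\<^sup>2 = T" unfolding \<delta>_def using T by (simp add: power2_eq_square flip: powr_add)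
  have e: "((norm \<xi>)\<^sup>2)\<^sup>2 * exp (- ((norm \<xi>)\<^sup>2)\<^sup>2 * T / 2) = inverse T * h (0 + \<delta> *\<^sub>R \<xi>)" for \<xi> :: 'a
    using T \<delta> \<delta>4 by (simp add: h_def power_mult_distrib field_simps)
  show "integrable lborel (\<lambda>\<xi>::'a. ((norm \<xi>)\<^sup>2)\<^sup>2 * exp (- ((norm \<xi>)\<^sup>2)\<^sup>2 * T / 2))"
    unfolding e using h by (intro integrable_mult_right iffD2[OF lborel_scale(2)[OF h_meas \<delta>]])
  have "(LINT \<xi>|lborel. h \<xi>) = \<delta> ^ DIM('a) * (LINT \<xi>|lborel. h (0 + \<delta> *\<^sub>R \<xi>))"
    using lborel_scale(1)[OF h_meas \<delta>, of 0] by simp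
  then have "(LINT \<xi>|lborel. h (0 + \<delta> *\<^sub>R \<xi>)) = (LINT \<xi>|lborel. h \<xi>) * inverse (\<delta> ^ DIM('a))"
    using \<delta> by (simp add: field_simps)
  moreover have "inverse (\<delta> ^ DIM('a)) = T powr (- real DIM('a) / 4)"
    unfolding \<delta>_def using T by (subst powr_power) (auto simp: powr_minus)
  moreover have "inverse T * T powr (- real DIM('a) / 4) = T powr (- 1 - real DIM('a) / 4)"
  proof -
    have "inverse T = T powr (- 1)" using T by (simp add: powr_minus)
    then have "inverse T * T powr (- real DIM('a) / 4) = T powr (- 1 + - real DIM('a) / 4)"
      by (simp only: powr_add)
    also have "- 1 + - real DIM('a) / 4 = - 1 - real DIM('a) / 4" by simp
    finally show ?thesis .
  qed
  ultimately have "inverse T * (LINT \<xi>|lborel. h (0 + \<delta> *\<^sub>R \<xi>)) = (LINT \<xi>|lborel. h \<xi>) * T powr (- 1 - real DIM('a) / 4)"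
    by (simp only: mult.left_commute[of "inverse T"])
  then show "(LINT \<xi>::'a|lborel. ((norm \<xi>)\<^sup>2)\<^sup>2 * exp (- ((norm \<xi>)\<^sup>2)\<^sup>2 * T / 2)) =
      (LINT \<xi>::'a|lborel. ((norm \<xi>)\<^sup>2)\<^sup>2 * exp (- ((norm \<xi>)\<^sup>2)\<^sup>2 / 2)) * T powr (- 1 - real DIM('a) / 4)"
    unfolding e integral_mult_right_zero unfolding h_def[symmetric] .
qed

lemma fourier_norm_le:
  fixes f :: "'a::euclidean_space \<Rightarrow> complex"
  shows "norm (fourier f \<xi>) \<le> unitary_const TYPE('a) * norm_L1 f"
proof -
  have "norm (LINT x|lebesgue. cis (- (x \<bullet> \<xi>)) * f x) \<le> (LINT x|lebesgue. norm (cis (- (x \<bullet> \<xi>)) * f x))"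
    by (rule integral_norm_bound)
  also have "\<dots> = norm_L1 f" by (simp add: norm_L1_def norm_mult)
  finally show ?thesis
    using unitary_const_pos[where 'a='a] by (simp add: fourier_def norm_mult unitary_const_def)
qed

lemma evolves_of_solution:
  fixes f :: "real \<Rightarrow> complex"
  assumes "\<And>t. t \<ge> 0 \<Longrightarrow> (f has_vector_derivative f' t) (at t within {0..})"
  shows "evolves f f'"
proof (rule evolvesI)
  show "continuous_on {0..} f"
    unfolding continuous_on_eq_continuous_within
    using assms has_vector_derivative_continuous by blast
  fix t :: real assume t: "t > 0"
  then have "at t within {0..} = at t" by (intro at_within_interior interiorI[of "{0<..}"]) auto
  with assms[of t] t show "(f has_vector_derivative f' t) (at t)" by simp
qed

text \<open>Both solutions satisfy their ordinary differential equations outside one null set that does not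
  depend on time, and the frequency \<open>0\<close> may be discarded as well.\<close>

lemma difference_frequency_bound:
  assumes l: "l \<ge> 0"
  obtains C where "C > 0"
    "\<And>u0 u1 w1 u v w. \<lbrakk>wave_heat_solution u0 u1 (\<lambda>_. 0) u v; riesz_damped_wave_solution u0 w1 w\<rbrakk> \<Longrightarrow>
      \<exists>D. (\<forall>t\<ge>0. represents (D t) (fourier_distr (\<lambda>\<phi>. u t \<phi> - w t \<phi>))) \<and>
         (\<forall>t\<ge>0. AE \<xi>::'a::euclidean_space in lebesgue. (norm (D t \<xi>))\<^sup>2 \<le> C * frequency_profile l (1 + t) ((norm \<xi>)\<^sup>2) *
            (norm (fourier u0 \<xi>) + norm (fourier u1 \<xi>) + norm (fourier w1 \<xi>))\<^sup>2)"
proof -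
  obtain C where C: "C > 0" and bound: "\<And>\<rho> U U1 V W W1 t. \<lbrakk>\<rho> > 0; evolves U U1; evolves U1 (\<lambda>t. - (\<rho> *\<^sub>R U t) - V t);
       evolves V (\<lambda>t. U1 t - \<rho> *\<^sub>R V t); V 0 = 0;
       evolves W W1; evolves W1 (\<lambda>t. - (\<rho> *\<^sub>R W t) - (1 / \<rho>) *\<^sub>R W1 t); W 0 = U 0; t \<ge> 0\<rbrakk>
     \<Longrightarrow> (norm (U t - W t :: complex))\<^sup>2 \<le>
         C * frequency_profile l (1 + t) \<rho> * (norm (U 0) + norm (U1 0) + norm (W1 0))\<^sup>2"
    using single_frequency_bound[OF l] by blast
  show thesis
  proof (rule that[OF C])
    fix u0 u1 w1 :: "'a \<Rightarrow> complex" and u v w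
    assume uv: "wave_heat_solution u0 u1 (\<lambda>_. 0) u v" and w: "riesz_damped_wave_solution u0 w1 w"
    from uv obtain U V where
      Urep: "\<And>t. t \<ge> 0 \<Longrightarrow> represents (U t) (fourier_distr (u t))" and
      Uode: "AE \<xi> in lebesgue. \<exists>U' U'' V'.
           (\<forall>t\<ge>0. ((\<lambda>s. U s \<xi>) has_vector_derivative U' t) (at t within {0..})) \<and>
           continuous_on {0..} U' \<and> continuous_on {0..} (\<lambda>t. V t \<xi>) \<and>
           (\<forall>t>0. (U' has_vector_derivative U'' t) (at t) \<and>
                   ((\<lambda>s. V s \<xi>) has_vector_derivative V' t) (at t) \<and>
                   U'' t + (norm \<xi>)\<^sup>2 *\<^sub>R U t \<xi> + V t \<xi> = 0 \<and>
                   V' t + (norm \<xi>)\<^sup>2 *\<^sub>R V t \<xi> - U' t = 0) \<and>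
           U 0 \<xi> = fourier u0 \<xi> \<and> U' 0 = fourier u1 \<xi> \<and> V 0 \<xi> = fourier (\<lambda>_. 0) \<xi>"
      unfolding wave_heat_solution_def by blast
    from w obtain W where
      Wrep: "\<And>t. t \<ge> 0 \<Longrightarrow> represents (W t) (fourier_distr (w t))" and
      Wode: "AE \<xi> in lebesgue. \<exists>W' W''.
           (\<forall>t\<ge>0. ((\<lambda>s. W s \<xi>) has_vector_derivative W' t) (at t within {0..})) \<and>
           continuous_on {0..} W' \<and>
           (\<forall>t>0. (W' has_vector_derivative W'' t) (at t) \<and>
                   W'' t + (norm \<xi>)\<^sup>2 *\<^sub>R W t \<xi> + inverse ((norm \<xi>)\<^sup>2) *\<^sub>R W' t = 0) \<and>
           W 0 \<xi> = fourier u0 \<xi> \<and> W' 0 = fourier w1 \<xi>"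
      unfolding riesz_damped_wave_solution_def by blast
    have nz: "AE \<xi>::'a in lebesgue. \<xi> \<noteq> 0" by (intro AE_completion AE_lborel_singleton)
    let ?D = "\<lambda>t \<xi>. U t \<xi> - W t \<xi>"
    have "represents (?D t) (fourier_distr (\<lambda>\<phi>. u t \<phi> - w t \<phi>))" if "t \<ge> 0" for t
      using Urep[OF that] Wrep[OF that]
      unfolding represents_def fourier_distr_def by (auto simp: left_diff_distrib)
    moreover have "AE \<xi> in lebesgue. (norm (?D t \<xi>))\<^sup>2 \<le> C * frequency_profile l (1 + t) ((norm \<xi>)\<^sup>2) *
            (norm (fourier u0 \<xi>) + norm (fourier u1 \<xi>) + norm (fourier w1 \<xi>))\<^sup>2" if t: "t \<ge> 0" for t
      using Uode Wode nz
    proof eventually_elim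
      case (elim \<xi>)
      define \<rho> where "\<rho> = (norm \<xi>)\<^sup>2"
      have \<rho>: "\<rho> > 0" using elim(3) by (simp add: \<rho>_def)
      from elim(1) obtain U' U'' V' where
        U: "\<And>t. t \<ge> 0 \<Longrightarrow> ((\<lambda>s. U s \<xi>) has_vector_derivative U' t) (at t within {0..})"
        "continuous_on {0..} U'" "continuous_on {0..} (\<lambda>t. V t \<xi>)"
        "\<And>t. t > 0 \<Longrightarrow> (U' has_vector_derivative U'' t) (at t)"
        "\<And>t. t > 0 \<Longrightarrow> ((\<lambda>s. V s \<xi>) has_vector_derivative V' t) (at t)"
        "\<And>t. t > 0 \<Longrightarrow> U'' t + \<rho> *\<^sub>R U t \<xi> + V t \<xi> = 0"
        "\<And>t. t > 0 \<Longrightarrow> V' t + \<rho> *\<^sub>R V t \<xi> - U' t = 0"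
        "U 0 \<xi> = fourier u0 \<xi>" "U' 0 = fourier u1 \<xi>" "V 0 \<xi> = fourier (\<lambda>_. 0) \<xi>"
        unfolding \<rho>_def by blast
      from elim(2) obtain W' W'' where
        W: "\<And>t. t \<ge> 0 \<Longrightarrow> ((\<lambda>s. W s \<xi>) has_vector_derivative W' t) (at t within {0..})"
        "continuous_on {0..} W'"
        "\<And>t. t > 0 \<Longrightarrow> (W' has_vector_derivative W'' t) (at t)"
        "\<And>t. t > 0 \<Longrightarrow> W'' t + \<rho> *\<^sub>R W t \<xi> + inverse \<rho> *\<^sub>R W' t = 0"
        "W 0 \<xi> = fourier u0 \<xi>" "W' 0 = fourier w1 \<xi>"
        unfolding \<rho>_def by blast
      have U'': "U'' t = - (\<rho> *\<^sub>R U t \<xi>) - V t \<xi>" if "t > 0" for t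
        using U(6)[OF that] by (simp add: eq_neg_iff_add_eq_0 algebra_simps)
      have V': "V' t = U' t - \<rho> *\<^sub>R V t \<xi>" if "t > 0" for t
        using U(7)[OF that] by (simp add: eq_diff_eq)
      have W'': "W'' t = - (\<rho> *\<^sub>R W t \<xi>) - (1 / \<rho>) *\<^sub>R W' t" if "t > 0" for t
        using W(4)[OF that] by (simp add: eq_neg_iff_add_eq_0 algebra_simps inverse_eq_divide)
      have "(norm (U t \<xi> - W t \<xi>))\<^sup>2 \<le> C * frequency_profile l (1 + t) \<rho> * (norm (U 0 \<xi>) + norm (U' 0) + norm (W' 0))\<^sup>2"
      proof (rule bound[OF \<rho>])
        show "evolves (\<lambda>t. U t \<xi>) U'" using U(1) by (rule evolves_of_solution)
        show "evolves (\<lambda>t. W t \<xi>) W'" using W(1) by (rule evolves_of_solution)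
        show "evolves U' (\<lambda>t. - (\<rho> *\<^sub>R U t \<xi>) - V t \<xi>)"
          using U(2,4) U'' by (simp add: evolves_def)
        show "evolves (\<lambda>t. V t \<xi>) (\<lambda>t. U' t - \<rho> *\<^sub>R V t \<xi>)"
          using U(3,5) V' by (simp add: evolves_def)
        show "evolves W' (\<lambda>t. - (\<rho> *\<^sub>R W t \<xi>) - (1 / \<rho>) *\<^sub>R W' t)"
          using W(2,3) W'' by (simp add: evolves_def)
        show "V 0 \<xi> = 0" using U(10) by (simp add: fourier_def)
        show "W 0 \<xi> = U 0 \<xi>" using U(8) W(5) by simp
      qed (rule t)
      then show ?case using U(8,9) W(6) by (simp add: \<rho>_def)
    qed
    ultimately show "\<exists>D. (\<forall>t\<ge>0. represents (D t) (fourier_distr (\<lambda>\<phi>. u t \<phi> - w t \<phi>))) \<and>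
         (\<forall>t\<ge>0. AE \<xi>::'a in lebesgue. (norm (D t \<xi>))\<^sup>2 \<le> C * frequency_profile l (1 + t) ((norm \<xi>)\<^sup>2) *
            (norm (fourier u0 \<xi>) + norm (fourier u1 \<xi>) + norm (fourier w1 \<xi>))\<^sup>2)"
      by (intro exI[of _ ?D]) blast
  qed
qed

lemma norm_bessel_weight_square:
  "(norm (bessel_weight s f \<xi>))\<^sup>2 = (1 + (norm \<xi>)\<^sup>2) powr s * (norm (fourier f \<xi>))\<^sup>2"
proof -
  have "((1 + (norm \<xi>)\<^sup>2) powr (s / 2))\<^sup>2 = (1 + (norm \<xi>)\<^sup>2) powr s"
    by (simp add: power2_eq_square flip: powr_add)
  then show ?thesis by (simp add: bessel_weight_def norm_mult power_mult_distrib)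
qed

lemma norm_L2_square: "(norm_L2 f)\<^sup>2 = (LINT x|lebesgue. (norm (f x))\<^sup>2)"
  by (simp add: norm_L2_def)

lemma square_sum3_le: "(a + b + c)\<^sup>2 \<le> 3 * (a\<^sup>2 + b\<^sup>2 + c\<^sup>2)" for a b c :: real
  using sum_squares_bound[of a b] sum_squares_bound[of a c] sum_squares_bound[of b c]
  by (simp add: power2_sum algebra_simps power2_eq_square)

text \<open>In the low frequency terms the transforms of the data are bounded by \<open>L^1\<close> norms, and the exponentials
  are integrated; in the high frequency term the weight \<open>(1 + |\<xi>|^2)^(l - 1)\<close> turns the transforms into
  Sobolev norms.\<close>

lemma L2_bound_of_profile:
  fixes D :: "'a::euclidean_space \<Rightarrow> complex"
  assumes C: "C \<ge> 0" and T: "T \<ge> 1"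
    and D: "D \<in> borel_measurable lebesgue"
    and data: "u0 \<in> L1_Sobolev (l - 1)" "u1 \<in> L1_Sobolev (l - 1)" "w1 \<in> L1_Sobolev (l - 1)"
    and le: "AE \<xi> in lebesgue. (norm (D \<xi>))\<^sup>2 \<le> C * frequency_profile l T ((norm \<xi>)\<^sup>2) *
            (norm (fourier u0 \<xi>) + norm (fourier u1 \<xi>) + norm (fourier w1 \<xi>))\<^sup>2"
  defines "K \<equiv> (sqrt (2 * pi) / sqrt (1/3)) ^ DIM('a) +
      (LINT \<xi>::'a|lborel. ((norm \<xi>)\<^sup>2)\<^sup>2 * exp (- ((norm \<xi>)\<^sup>2)\<^sup>2 / 2))"
  shows "D \<in> L2_space"
    and "norm_L2 D \<le> (1 + C * (K * (unitary_const TYPE('a))\<^sup>2 + 3)) *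
           (T powr (- min (real DIM('a) / 8 + 1 / 2) (real DIM('a) / 4)) * (norm_L1 u0 + norm_L1 u1 + norm_L1 w1) +
            T powr (- l / 2) * (norm_Sobolev (l - 1) u0 + norm_Sobolev (l - 1) u1 + norm_Sobolev (l - 1) w1))"
proof -
  define c where "c = unitary_const TYPE('a)"
  define S where "S = norm_L1 u0 + norm_L1 u1 + norm_L1 w1"
  define h where "h = norm_Sobolev (l - 1) u0 + norm_Sobolev (l - 1) u1 + norm_Sobolev (l - 1) w1"
  define m where "m = min (real DIM('a) / 8 + 1 / 2) (real DIM('a) / 4)"
  define K1 where "K1 = (sqrt (2 * pi) / sqrt (1/3)) ^ DIM('a)"
  define K2 where "K2 = (LINT \<xi>::'a|lborel. ((norm \<xi>)\<^sup>2)\<^sup>2 * exp (- ((norm \<xi>)\<^sup>2)\<^sup>2 / 2))"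
  have K12: "K1 \<ge> 0" "K2 \<ge> 0" "K = K1 + K2" by (auto simp: K1_def K2_def K_def)
  have T0: "T > 0" using T by simp
  have L1_nonneg: "norm_L1 f \<ge> 0" for f :: "'a \<Rightarrow> complex" by (simp add: norm_L1_def)
  have So_nonneg: "norm_Sobolev s f \<ge> 0" for s and f :: "'a \<Rightarrow> complex" by (simp add: norm_Sobolev_def norm_L2_def)
  have S: "S \<ge> 0" and h: "h \<ge> 0" using L1_nonneg So_nonneg by (auto simp: S_def h_def)
  define e where "e \<xi> = exp (- (norm \<xi>)\<^sup>2 * T / 6)" for \<xi> :: 'a
  define g where "g \<xi> = ((norm \<xi>)\<^sup>2)\<^sup>2 * exp (- ((norm \<xi>)\<^sup>2)\<^sup>2 * T / 2)" for \<xi> :: 'a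
  define b where "b f \<xi> = (norm (bessel_weight (l - 1) f \<xi>))\<^sup>2" for f and \<xi> :: 'a
  have eg_meas: "e \<in> borel_measurable lborel" "g \<in> borel_measurable lborel"
    unfolding e_def g_def by measurable
  have e: "integrable lebesgue e" "(LINT \<xi>|lebesgue. e \<xi>) = K1 * T powr (- real DIM('a) / 2)"
    unfolding integrable_completion[OF eg_meas(1)] integral_completion[OF eg_meas(1)] unfolding e_def K1_def
    by (rule heat_profile_integral[OF T0])+
  have g: "integrable lebesgue g" "(LINT \<xi>|lebesgue. g \<xi>) = K2 * T powr (- 1 - real DIM('a) / 4)"
    unfolding integrable_completion[OF eg_meas(2)] integral_completion[OF eg_meas(2)] unfolding g_def K2_def
    by (rule fourth_order_profile_integral[OF T0])+
  have bw: "bessel_weight (l - 1) f \<in> L2_space" if "f \<in> L1_Sobolev (l - 1)" for f :: "'a \<Rightarrow> complex"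
    using that by (simp add: L1_Sobolev_def)
  have b: "integrable lebesgue (b f)" "(LINT \<xi>|lebesgue. b f \<xi>) = (norm_Sobolev (l - 1) f)\<^sup>2"
    if "f \<in> L1_Sobolev (l - 1)" for f :: "'a \<Rightarrow> complex"
    using bw[OF that] norm_L2_square[of "bessel_weight (l - 1) f"]
    by (auto simp: b_def[abs_def] L2_space_def norm_Sobolev_def)
  define B where "B \<xi> = C * ((e \<xi> + g \<xi>) * (c * S)\<^sup>2 + 3 * T powr (- l) * (b u0 \<xi> + b u1 \<xi> + b w1 \<xi>))" for \<xi>
  have B: "integrable lebesgue B"
    unfolding B_def using e g b data by (intro integrable_mult_right Bochner_Integration.integrable_add integrable_mult_left) auto
  have B_int: "(LINT \<xi>|lebesgue. B \<xi>) = C * ((K1 * T powr (- real DIM('a) / 2) + K2 * T powr (- 1 - real DIM('a) / 4)) * (c * S)\<^sup>2 +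
      3 * T powr (- l) * ((norm_Sobolev (l - 1) u0)\<^sup>2 + (norm_Sobolev (l - 1) u1)\<^sup>2 + (norm_Sobolev (l - 1) w1)\<^sup>2))"
    unfolding B_def using e g b[OF data(1)] b[OF data(2)] b[OF data(3)] by simp
  have DB: "AE \<xi> in lebesgue. (norm (D \<xi>))\<^sup>2 \<le> B \<xi>"
    using le
  proof eventually_elim
    case (elim \<xi>)
    define a where "a = norm (fourier u0 \<xi>) + norm (fourier u1 \<xi>) + norm (fourier w1 \<xi>)"
    have "a \<le> c * norm_L1 u0 + c * norm_L1 u1 + c * norm_L1 w1"
      unfolding a_def c_def by (intro add_mono fourier_norm_le)
    then have "a \<le> c * S" by (simp add: S_def distrib_left)
    then have a: "a\<^sup>2 \<le> (c * S)\<^sup>2" by (intro power_mono) (simp_all add: a_def)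
    have "(1 + (norm \<xi>)\<^sup>2) powr (l - 1) * a\<^sup>2 \<le> (1 + (norm \<xi>)\<^sup>2) powr (l - 1) *
        (3 * ((norm (fourier u0 \<xi>))\<^sup>2 + (norm (fourier u1 \<xi>))\<^sup>2 + (norm (fourier w1 \<xi>))\<^sup>2))"
      unfolding a_def by (intro mult_left_mono square_sum3_le) simp
    also have "\<dots> = 3 * (b u0 \<xi> + b u1 \<xi> + b w1 \<xi>)"
      by (simp add: b_def norm_bessel_weight_square distrib_left mult_ac)
    finally have bb: "T powr (- l) * ((1 + (norm \<xi>)\<^sup>2) powr (l - 1) * a\<^sup>2) \<le> T powr (- l) * (3 * (b u0 \<xi> + b u1 \<xi> + b w1 \<xi>))"
      by (intro mult_left_mono) auto
    have eg: "0 \<le> e \<xi> + g \<xi>" by (simp add: e_def g_def)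
    have "C * frequency_profile l T ((norm \<xi>)\<^sup>2) * a\<^sup>2 =
        C * ((e \<xi> + g \<xi>) * a\<^sup>2 + T powr (- l) * ((1 + (norm \<xi>)\<^sup>2) powr (l - 1) * a\<^sup>2))"
      unfolding frequency_profile_def e_def[symmetric] g_def[symmetric] by (simp only: distrib_right mult.assoc)
    also have "\<dots> \<le> C * ((e \<xi> + g \<xi>) * (c * S)\<^sup>2 + T powr (- l) * (3 * (b u0 \<xi> + b u1 \<xi> + b w1 \<xi>)))"
      by (rule mult_left_mono[OF add_mono[OF mult_left_mono[OF a eg] bb] C])
    also have "\<dots> = B \<xi>" by (simp add: B_def)
    finally show ?case using elim unfolding a_def by simp
  qed
  have D_sq: "(\<lambda>x. (norm (D x))\<^sup>2) \<in> borel_measurable lebesgue" using D by measurable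
  have D2: "integrable lebesgue (\<lambda>\<xi>. (norm (D \<xi>))\<^sup>2)"
    by (rule Bochner_Integration.integrable_bound[OF B D_sq]) (use DB in eventually_elim, simp)
  then show "D \<in> L2_space" using D by (simp add: L2_space_def)
  define M where "M = 1 + C * (K * c\<^sup>2 + 3)"
  have M1: "1 \<le> M" using C K12 by (simp add: M_def)
  have M2: "C * (K * c\<^sup>2) \<le> M\<^sup>2" "C * 3 \<le> M\<^sup>2"
  proof -
    have "M \<le> M\<^sup>2" using M1 by (simp add: power2_eq_square)
    moreover have "0 \<le> C * (K * c\<^sup>2)" using C K12 by simp
    ultimately show "C * (K * c\<^sup>2) \<le> M\<^sup>2" "C * 3 \<le> M\<^sup>2" using C unfolding M_def by (auto simp: distrib_left)
  qed
  have "(LINT \<xi>|lebesgue. (norm (D \<xi>))\<^sup>2) \<le> (LINT \<xi>|lebesgue. B \<xi>)"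
    by (rule integral_mono_AE[OF D2 B DB])
  also have "\<dots> \<le> C * ((K1 * T powr (- 2 * m) + K2 * T powr (- 2 * m)) * (c * S)\<^sup>2 + 3 * T powr (- l) * h\<^sup>2)"
    unfolding B_int
  proof (intro mult_left_mono add_mono mult_right_mono C)
    have "m \<le> real DIM('a) / 4" "m \<le> real DIM('a) / 8 + 1 / 2"
      unfolding m_def by (rule min.cobounded2, rule min.cobounded1)
    then show "T powr (- real DIM('a) / 2) \<le> T powr (- 2 * m)" "T powr (- 1 - real DIM('a) / 4) \<le> T powr (- 2 * m)"
      using T by (intro powr_mono; simp)+
    show "(norm_Sobolev (l - 1) u0)\<^sup>2 + (norm_Sobolev (l - 1) u1)\<^sup>2 + (norm_Sobolev (l - 1) w1)\<^sup>2 \<le> h\<^sup>2"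
      using So_nonneg[of "l - 1" u0] So_nonneg[of "l - 1" u1] So_nonneg[of "l - 1" w1]
      by (simp add: h_def power2_sum)
  qed (use K12 in auto)
  also have "\<dots> = C * (K * c\<^sup>2) * (T powr (- m) * S)\<^sup>2 + C * 3 * (T powr (- l / 2) * h)\<^sup>2"
  proof -
    have "T powr (- 2 * m) = (T powr (- m))\<^sup>2" "T powr (- l) = (T powr (- l / 2))\<^sup>2"
      by (auto simp: power2_eq_square simp flip: powr_add)
    then show ?thesis unfolding K12(3) power_mult_distrib by (simp add: algebra_simps)
  qed
  also have "\<dots> \<le> M\<^sup>2 * (T powr (- m) * S)\<^sup>2 + M\<^sup>2 * (T powr (- l / 2) * h)\<^sup>2"
    using M2 by (intro add_mono mult_right_mono) auto
  also have "\<dots> \<le> (M * (T powr (- m) * S + T powr (- l / 2) * h))\<^sup>2"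
    using S h M1 by (simp add: power_mult_distrib[of M] power2_sum distrib_left)
  finally have "norm_L2 D \<le> M * (T powr (- m) * S + T powr (- l / 2) * h)"
    unfolding norm_L2_def using S h M1 by (intro real_le_lsqrt) auto
  then show "norm_L2 D \<le> (1 + C * (K * (unitary_const TYPE('a))\<^sup>2 + 3)) *
           (T powr (- min (real DIM('a) / 8 + 1 / 2) (real DIM('a) / 4)) * (norm_L1 u0 + norm_L1 u1 + norm_L1 w1) +
            T powr (- l / 2) * (norm_Sobolev (l - 1) u0 + norm_Sobolev (l - 1) u1 + norm_Sobolev (l - 1) w1))"
    unfolding M_def m_def S_def h_def c_def .
qed

lemma powr_decay:
  fixes a b :: real
  assumes a: "a \<ge> 0" and ab: "a < b"
  shows "((\<lambda>t. t powr a * (1 + t) powr (- b)) \<longlongrightarrow> 0) at_top"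
proof (rule tendsto_sandwich[OF _ _ tendsto_const])
  show "eventually (\<lambda>t. 0 \<le> t powr a * (1 + t) powr (- b)) at_top" by simp
  show "eventually (\<lambda>t. t powr a * (1 + t) powr (- b) \<le> (1 + t) powr (a - b)) at_top"
    using eventually_gt_at_top[of 0]
  proof eventually_elim
    case (elim t)
    have "t powr a * (1 + t) powr (- b) \<le> (1 + t) powr a * (1 + t) powr (- b)"
      using elim a by (intro mult_right_mono powr_mono2) auto
    also have "\<dots> = (1 + t) powr (a - b)" by (simp flip: powr_add)
    finally show ?case .
  qed
  have "filterlim (\<lambda>t::real. 1 + t) at_top at_top"
    by (intro filterlim_tendsto_add_at_top[OF tendsto_const] filterlim_ident)
  then show "((\<lambda>t. (1 + t) powr (a - b)) \<longlongrightarrow> 0) at_top"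
    using ab by (intro tendsto_neg_powr) auto
qed

lemma tendsto_zero_of_bound:
  fixes N :: "real \<Rightarrow> ennreal"
  assumes le: "\<And>t. t \<ge> 0 \<Longrightarrow> N t \<le> ennreal (C * ((1 + t) powr (- m) * S + (1 + t) powr (- l / 2) * h))"
    and a: "a \<ge> 0" "a < m" "a < l / 2"
  shows "((\<lambda>t. ennreal (t powr a) * N t) \<longlongrightarrow> 0) at_top"
proof (rule tendsto_sandwich[OF _ _ tendsto_const])
  let ?f = "\<lambda>t. C * (t powr a * (1 + t) powr (- m) * S + t powr a * (1 + t) powr (- l / 2) * h)"
  show "eventually (\<lambda>t. 0 \<le> ennreal (t powr a) * N t) at_top" by simp
  show "eventually (\<lambda>t. ennreal (t powr a) * N t \<le> ennreal (?f t)) at_top"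
    using eventually_ge_at_top[of 0]
  proof eventually_elim
    case (elim t)
    have "ennreal (t powr a) * N t \<le> ennreal (t powr a) * ennreal (C * ((1 + t) powr (- m) * S + (1 + t) powr (- l / 2) * h))"
      by (intro mult_left_mono le elim) simp
    also have "\<dots> = ennreal (t powr a * (C * ((1 + t) powr (- m) * S + (1 + t) powr (- l / 2) * h)))"
      by (simp add: ennreal_mult')
    also have "t powr a * (C * ((1 + t) powr (- m) * S + (1 + t) powr (- l / 2) * h)) = ?f t"
      by (simp add: algebra_simps)
    finally show ?case .
  qed
  have "((\<lambda>t. t powr a * (1 + t) powr (- l / 2)) \<longlongrightarrow> 0) at_top"
    using powr_decay[of a "l / 2"] a by simp
  then have "(?f \<longlongrightarrow> C * (0 * S + 0 * h)) at_top"
    using a by (intro tendsto_mult tendsto_add tendsto_const powr_decay) auto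
  then have "((\<lambda>t. ennreal (?f t)) \<longlongrightarrow> ennreal (C * (0 * S + 0 * h))) at_top" by (rule tendsto_ennrealI)
  then show "((\<lambda>t. ennreal (?f t)) \<longlongrightarrow> 0) at_top" by simp
qed

text \<open>For the limit, \<open>n/8\<close> is smaller than both \<open>n/8 + 1/2\<close> and \<open>n/4\<close>, and smaller than \<open>l/2\<close> if \<open>l > n/4\<close>.\<close>

theorem corollary2p1:
  fixes l :: real
  assumes "l \<ge> 0"
  shows
    "(\<exists>C>0. \<forall>(u0 :: 'a::euclidean_space \<Rightarrow> complex) u1 w1 u v w.
        u0 \<in> L1_Sobolev (l - 1) \<and> u1 \<in> L1_Sobolev (l - 1) \<and> w1 \<in> L1_Sobolev (l - 1) \<and>
        wave_heat_solution u0 u1 (\<lambda>_. 0) u v \<and> riesz_damped_wave_solution u0 w1 w \<longrightarrow>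
        (\<forall>t\<ge>0. norm_L2_distr (\<lambda>\<phi>. u t \<phi> - w t \<phi>) \<le> ennreal (C *
           ((1 + t) powr (- min (real DIM('a) / 8 + 1 / 2) (real DIM('a) / 4)) *
              (norm_L1 u0 + norm_L1 u1 + norm_L1 w1) +
            (1 + t) powr (- l / 2) *
              (norm_Sobolev (l - 1) u0 + norm_Sobolev (l - 1) u1 + norm_Sobolev (l - 1) w1))))) \<and>
     (l > real DIM('a) / 4 \<longrightarrow>
       (\<forall>(u0 :: 'a \<Rightarrow> complex) u1 w1 u v w.
        u0 \<in> L1_Sobolev (l - 1) \<and> u1 \<in> L1_Sobolev (l - 1) \<and> w1 \<in> L1_Sobolev (l - 1) \<and>
        wave_heat_solution u0 u1 (\<lambda>_. 0) u v \<and> riesz_damped_wave_solution u0 w1 w \<longrightarrow>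
        ((\<lambda>t. ennreal (t powr (real DIM('a) / 8)) * norm_L2_distr (\<lambda>\<phi>. u t \<phi> - w t \<phi>))
           \<longlongrightarrow> 0) at_top))"
proof -
  let ?rate = "min (real DIM('a) / 8 + 1 / 2) (real DIM('a) / 4)"
  obtain C where C: "C > 0" and freq: "\<And>(u0::'a \<Rightarrow> complex) u1 w1 u v w.
      \<lbrakk>wave_heat_solution u0 u1 (\<lambda>_. 0) u v; riesz_damped_wave_solution u0 w1 w\<rbrakk> \<Longrightarrow>
      \<exists>D. (\<forall>t\<ge>0. represents (D t) (fourier_distr (\<lambda>\<phi>. u t \<phi> - w t \<phi>))) \<and>
         (\<forall>t\<ge>0. AE \<xi> in lebesgue. (norm (D t \<xi>))\<^sup>2 \<le> C * frequency_profile l (1 + t) ((norm \<xi>)\<^sup>2) *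
            (norm (fourier u0 \<xi>) + norm (fourier u1 \<xi>) + norm (fourier w1 \<xi>))\<^sup>2)"
    using difference_frequency_bound[OF assms] by blast
  define M where "M = 1 + C * (((sqrt (2 * pi) / sqrt (1/3)) ^ DIM('a) +
      (LINT \<xi>::'a|lborel. ((norm \<xi>)\<^sup>2)\<^sup>2 * exp (- ((norm \<xi>)\<^sup>2)\<^sup>2 / 2))) * (unitary_const TYPE('a))\<^sup>2 + 3)"
  have M: "M > 0"
    unfolding M_def using C by (intro add_pos_nonneg mult_nonneg_nonneg add_nonneg_nonneg) auto
  have main: "norm_L2_distr (\<lambda>\<phi>. u t \<phi> - w t \<phi>) \<le> ennreal (M *
           ((1 + t) powr (- ?rate) * (norm_L1 u0 + norm_L1 u1 + norm_L1 w1) +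
            (1 + t) powr (- l / 2) *
              (norm_Sobolev (l - 1) u0 + norm_Sobolev (l - 1) u1 + norm_Sobolev (l - 1) w1)))"
    if data: "u0 \<in> L1_Sobolev (l - 1)" "u1 \<in> L1_Sobolev (l - 1)" "w1 \<in> L1_Sobolev (l - 1)"
      and sol: "wave_heat_solution u0 u1 (\<lambda>_. 0) u v" "riesz_damped_wave_solution u0 w1 w" and t: "t \<ge> 0"
    for u0 u1 w1 :: "'a \<Rightarrow> complex" and u v w t
  proof -
    obtain D where D: "represents D (fourier_distr (\<lambda>\<phi>. u t \<phi> - w t \<phi>))"
      "AE \<xi> in lebesgue. (norm (D \<xi>))\<^sup>2 \<le> C * frequency_profile l (1 + t) ((norm \<xi>)\<^sup>2) *
            (norm (fourier u0 \<xi>) + norm (fourier u1 \<xi>) + norm (fourier w1 \<xi>))\<^sup>2"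
      using freq[OF sol] t by blast
    have D_meas: "D \<in> borel_measurable lebesgue" using D(1) by (simp add: represents_def)
    have "0 \<le> C" "1 \<le> 1 + t" using C t by auto
    note bound = L2_bound_of_profile[OF this D_meas data D(2)]
    have "norm_L2_distr (\<lambda>\<phi>. u t \<phi> - w t \<phi>) \<le> ennreal (norm_L2 D)"
      by (rule norm_L2_distr_le_fourier[OF bound(1) D(1)])
    also have "\<dots> \<le> ennreal (M * ((1 + t) powr (- ?rate) * (norm_L1 u0 + norm_L1 u1 + norm_L1 w1) +
            (1 + t) powr (- l / 2) *
              (norm_Sobolev (l - 1) u0 + norm_Sobolev (l - 1) u1 + norm_Sobolev (l - 1) w1)))"
      unfolding M_def by (rule ennreal_leI[OF bound(2)])
    finally show ?thesis .
  qed
  show ?thesis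
  proof (intro conjI exI[of _ M] M impI allI)
    fix u0 u1 w1 :: "'a \<Rightarrow> complex" and u v w and t :: real
    assume "u0 \<in> L1_Sobolev (l - 1) \<and> u1 \<in> L1_Sobolev (l - 1) \<and> w1 \<in> L1_Sobolev (l - 1) \<and>
        wave_heat_solution u0 u1 (\<lambda>_. 0) u v \<and> riesz_damped_wave_solution u0 w1 w" "0 \<le> t"
    then show "norm_L2_distr (\<lambda>\<phi>. u t \<phi> - w t \<phi>) \<le> ennreal (M *
           ((1 + t) powr (- ?rate) * (norm_L1 u0 + norm_L1 u1 + norm_L1 w1) +
            (1 + t) powr (- l / 2) *
              (norm_Sobolev (l - 1) u0 + norm_Sobolev (l - 1) u1 + norm_Sobolev (l - 1) w1)))"
      using main by blast
  next
    fix u0 u1 w1 :: "'a \<Rightarrow> complex" and u v w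
    assume l: "real DIM('a) / 4 < l"
      and "u0 \<in> L1_Sobolev (l - 1) \<and> u1 \<in> L1_Sobolev (l - 1) \<and> w1 \<in> L1_Sobolev (l - 1) \<and>
        wave_heat_solution u0 u1 (\<lambda>_. 0) u v \<and> riesz_damped_wave_solution u0 w1 w"
    then have "\<And>t. t \<ge> 0 \<Longrightarrow> norm_L2_distr (\<lambda>\<phi>. u t \<phi> - w t \<phi>) \<le> ennreal (M *
           ((1 + t) powr (- ?rate) * (norm_L1 u0 + norm_L1 u1 + norm_L1 w1) +
            (1 + t) powr (- l / 2) *
              (norm_Sobolev (l - 1) u0 + norm_Sobolev (l - 1) u1 + norm_Sobolev (l - 1) w1)))"
      using main by blast
    then show "((\<lambda>t. ennreal (t powr (real DIM('a) / 8)) * norm_L2_distr (\<lambda>\<phi>. u t \<phi> - w t \<phi>)) \<longlongrightarrow> 0) at_top"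
      by (rule tendsto_zero_of_bound) (use l in auto)
  qed
qed

end
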